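(* Let $L\ge1$ and let $\epsilon$ be a primitive $(n+1)L$-th root of unity. Let $k\in\mathbb N^*$ and $a_1,\dots,a_k\in\mathbb C^*$ be such that $$\frac{a_i}{a_j}\notin\{1,\epsilon^{n+1},\dots,\epsilon^{(n+1)(L-1)}\}\quad\text{and}\quad\frac{a_i}{a_j}\notin\{\epsilon^{\pm2},\epsilon^{\pm2+(n+1)},\dots,\epsilon^{\pm2+(n+1)(L-1)}\}$$ for all $1\le i\neq j\le k$. Then $\Delta_D$ endows the tensor product $$V(\boxed1_{a_1})_\epsilon\otimes V(\boxed1_{a_2})_\epsilon\otimes\cdots\otimes V(\boxed1_{a_k})_\epsilon$$ with a well-defined structure of $\mathcal U_\epsilon(sl_{n+1}^{tor})'$-module. Furthermore it is irreducible and finite-dimensional of dimension $[(n+1)L]^k$ (the $k$-th power of the integer $(n+1)L$).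
   Context: Fix an integer $n\ge 2$. $I=\{0,\dots,n\}$ is identified with $\mathbb Z/(n+1)\mathbb Z$ ($\bar j$ is the class of $j\in\mathbb Z$); $C=(C_{i,j})_{i,j\in I}$ is the Cartan matrix of type $A_n^{(1)}$ ($C_{i,i}=2$, $C_{i,i\pm1}=-1$, $C_{i,j}=0$ otherwise). Choose $\tau\in\mathbb C$ with $e^\tau=\epsilon$ and put $\epsilon^x=e^{\tau x}$ for $x\in\mathbb Q$. $\mathfrak h'=\mathbb Qh_0\oplus\dots\oplus\mathbb Qh_n$; $\alpha_i,\Lambda_i\in(\mathfrak h')^*$: $\alpha_i(h_j)=C_{j,i}$, $\Lambda_i(h_j)=\delta_{i,j}$. $\mathcal U_\epsilon(sl_{n+1}^{tor})'$ is the quantum toroidal algebra at $\epsilon$ without derivation element and without divided powers: the $\mathbb C$-algebra with generators $x_{i,r}^\pm$ ($i\in I,r\in\mathbb Z$), $k_h$ ($h\in\mathfrak h'$), $h_{i,m}$ ($i\in I$, $m\in\mathbb Z\setminus\{0\}$). Put $x_i^\pm(z)=\sum_{r\in\mathbb Z}x_{i,r}^\pm z^r$, $\delta(z)=\sum_{s\in\mathbb Z}z^s$, $k_i^{\pm1}=k_{\pm h_i}$, $\phi_i^\pm(z)=\sum_{m\ge0}\phi^\pm_{i,\pm m}z^{\pm m}=k_i^{\pm1}\exp(\pm(\epsilon-\epsilon^{-1})\sum_{m\ge1}h_{i,\pm m}z^{\pm m})$. Relations: $k_hk_{h'}=k_{h+h'}$, $k_0=1$; the $k_h$ and all coefficients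 of all $\phi_i^\pm(z)$ commute; $k_hx_j^\pm(z)k_{-h}=\epsilon^{\pm\alpha_j(h)}x_j^\pm(z)$; $(w-\epsilon^{\pm C_{ij}}z)\phi_i^{\sigma}(z)x_j^\pm(w)=(\epsilon^{\pm C_{ij}}w-z)x_j^\pm(w)\phi_i^{\sigma}(z)$ for $\sigma=+,-$; $[x_i^+(z),x_j^-(w)]=\frac{\delta_{i,j}}{\epsilon-\epsilon^{-1}}(\delta(\frac wz)\phi_i^+(w)-\delta(\frac zw)\phi_i^-(z))$; $(w-\epsilon^{\pm C_{ij}}z)x_i^\pm(z)x_j^\pm(w)=(\epsilon^{\pm C_{ij}}w-z)x_j^\pm(w)x_i^\pm(z)$; for $j=i\pm1$: $x_i^\pm(z_1)x_i^\pm(z_2)x_j^\pm(w)-(\epsilon+\epsilon^{-1})x_i^\pm(z_1)x_j^\pm(w)x_i^\pm(z_2)+x_j^\pm(w)x_i^\pm(z_1)x_i^\pm(z_2)+(z_1\leftrightarrow z_2)=0$; $[x_i^\pm(z),x_j^\pm(w)]=0$ for $i\ne j,j\pm1$. Let $\psi(z)=\frac{\epsilon-\epsilon^{-1}z}{1-z}$; rational functions describing $\phi_i^+$ (resp. $\phi_i^-$) are expanded at $z=0$ (resp. $z=\infty$). For $a\in\mathbb C^*$, $V(\boxed1_a)_\epsilon$ is obtained from the module with basis $\boxed j_a$ ($j\in\mathbb Z$) and action $x_i^+(z)\boxed j_a=\delta_{i,\overline{j-1}}\,\delta(a\epsilon^{j-1}z)\boxed{j-1}_a$, $x_i^-(z)\boxed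 j_a=\delta_{i,\bar j}\,\delta(a\epsilon^jz)\boxed{j+1}_a$, $\phi_i^\pm(z)\boxed j_a=\psi(a\epsilon^jz)\boxed j_a$ if $i=\bar j$, $=\psi(a\epsilon^{j+1}z)^{-1}\boxed j_a$ if $i=\overline{j-1}$, $=\boxed j_a$ otherwise (and $k_h\boxed j_a=\epsilon^{(\Lambda_{\bar j}-\Lambda_{\overline{j-1}})(h)}\boxed j_a$) by the quotient identifying $\boxed{j}_a$ with $\boxed{j+(n+1)L}_a$; it has dimension $(n+1)L$ and is irreducible. Drinfeld coproduct: $\Delta_D(x_i^+(z))=x_i^+(z)\otimes1+\phi_i^-(z)\otimes x_i^+(z)$, $\Delta_D(x_i^-(z))=x_i^-(z)\otimes\phi_i^+(z)+1\otimes x_i^-(z)$, $\Delta_D(\phi_i^\pm(z))=\phi_i^\pm(z)\otimes\phi_i^\pm(z)$, $\Delta_D(k_h)=k_h\otimes k_h$, iterated for $k$ factors. On tensors of basis vectors $b_1\otimes\cdots\otimes b_k$ with $\phi_i^\pm(z)b_s=f_{i,s}(z)b_s$, $f_{i,s}$ rational, this means $x_i^+(z)$ acts by $\sum_u\big(\prod_{s<u}f_{i,s}(z)\big)b_1\otimes\cdots\otimes x_i^+(z)b_u\otimes\cdots\otimes b_k$ and $x_i^-(z)$ by $\sum_u\big(\prod_{s>u}f_{i,s}(z)\big)b_1\otimes\cdots\otimes x_i^-(z)b_u\otimes\cdots\otimes b_k$, where $f(z)\delta(cz):=f(c^{-1})\delta(cz)$; it is well-defined if no pole occurs. *)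

theory Defs
  imports
    "HOL-Library.Poly_Mapping"
    "HOL-Library.Function_Algebras"
    "HOL-Complex_Analysis.Complex_Analysis"
begin

section \<open>Algebras given by generators and relations\<close>

text \<open>Words under concatenation form the free monoid (written additively), so the library's
  convolution ring on finitely supported functions on words is the free complex algebra.\<close>

datatype 'g word = Word (letters: "'g list")

instantiation word :: (type) monoid_add
begin
definition zero_word :: "'a word" where "0 = Word []"
definition plus_word :: "'a word \<Rightarrow> 'a word \<Rightarrow> 'a word"
  where "v + w = Word (letters v @ letters w)"
instance by standard (simp_all add: zero_word_def plus_word_def)
end

type_synonym 'g free_algebra = "'g word \<Rightarrow>\<^sub>0 complex"

definition gen :: "'g \<Rightarrow> 'g free_algebra"
  where "gen g = Poly_Mapping.single (Word [g]) 1"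

definition scalar :: "complex \<Rightarrow> 'g free_algebra"
  where "scalar c = Poly_Mapping.single 0 c"

inductive_set two_sided_ideal :: "'g free_algebra set \<Rightarrow> 'g free_algebra set"
  for R :: "'g free_algebra set"
where
  zero: "0 \<in> two_sided_ideal R"
| mult: "x \<in> R \<Longrightarrow> p * x * q \<in> two_sided_ideal R"
| add: "x \<in> two_sided_ideal R \<Longrightarrow> y \<in> two_sided_ideal R \<Longrightarrow> x + y \<in> two_sided_ideal R"

section \<open>Modules over a presented algebra\<close>

text \<open>All vector spaces here are subspaces of a space of functions \<open>'b \<Rightarrow> complex\<close>.\<close>

definition fscale :: "complex \<Rightarrow> ('b \<Rightarrow> complex) \<Rightarrow> ('b \<Rightarrow> complex)"
  where "fscale c f = (\<lambda>x. c * f x)"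

definition linear_on :: "('b \<Rightarrow> complex) set \<Rightarrow> (('b \<Rightarrow> complex) \<Rightarrow> ('b \<Rightarrow> complex)) \<Rightarrow> bool"
  where "linear_on V f \<longleftrightarrow>
    (\<forall>v\<in>V. f v \<in> V) \<and>
    (\<forall>v\<in>V. \<forall>w\<in>V. f (v + w) = f v + f w) \<and>
    (\<forall>c. \<forall>v\<in>V. f (fscale c v) = fscale c (f v))"

text \<open>A module structure on \<open>V\<close> over the quotient of the free algebra by the ideal generated by
  \<open>R\<close>: an action of the free algebra in which that ideal acts by zero.\<close>

definition presented_module ::
  "'g free_algebra set \<Rightarrow> ('b \<Rightarrow> complex) set \<Rightarrow>
   ('g free_algebra \<Rightarrow> ('b \<Rightarrow> complex) \<Rightarrow> ('b \<Rightarrow> complex)) \<Rightarrow> bool"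
  where "presented_module R V act \<longleftrightarrow>
    module.subspace fscale V \<and>
    (\<forall>p. linear_on V (act p)) \<and>
    (\<forall>c. \<forall>v\<in>V. act (scalar c) v = fscale c v) \<and>
    (\<forall>p q. \<forall>v\<in>V. act (p + q) v = act p v + act q v) \<and>
    (\<forall>p q. \<forall>v\<in>V. act (p * q) v = act p (act q v)) \<and>
    (\<forall>p \<in> two_sided_ideal R. \<forall>v\<in>V. act p v = 0)"

definition irreducible_module ::
  "('b \<Rightarrow> complex) set \<Rightarrow> ('g free_algebra \<Rightarrow> ('b \<Rightarrow> complex) \<Rightarrow> ('b \<Rightarrow> complex)) \<Rightarrow> bool"
  where "irreducible_module V act \<longleftrightarrow>
    V \<noteq> {0} \<and>
    (\<forall>W. W \<subseteq> V \<and> module.subspace fscale W \<and> (\<forall>p. \<forall>w\<in>W. act p w \<in> W) \<longrightarrow>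
         W = {0} \<or> W = V)"

section \<open>The quantum toroidal algebra at \<open>exp \<tau>\<close>\<close>

definition qpow :: "complex \<Rightarrow> rat \<Rightarrow> complex"
  where "qpow \<tau> x = exp (\<tau> * of_rat x)"

definition index_set :: "nat \<Rightarrow> int set"
  where "index_set n = {0..int n}"

definition cls :: "nat \<Rightarrow> int \<Rightarrow> int"
  where "cls n j = j mod (int n + 1)"

definition cartan :: "nat \<Rightarrow> int \<Rightarrow> int \<Rightarrow> int"
  where "cartan n i j =
    (if cls n i = cls n j then 2
     else if cls n i = cls n (j + 1) \<or> cls n i = cls n (j - 1) then -1 else 0)"

text \<open>An element of the rational Cartan subalgebra is given by its coordinates in the basis
  of the \<open>h\<^sub>i\<close>, extended by zero outside the index set.\<close>

definition cartan_space :: "nat \<Rightarrow> (int \<Rightarrow> rat) set"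
  where "cartan_space n = {h. \<forall>i. i \<notin> index_set n \<longrightarrow> h i = 0}"

definition simple_root :: "nat \<Rightarrow> int \<Rightarrow> (int \<Rightarrow> rat) \<Rightarrow> rat"
  where "simple_root n j h = (\<Sum>i\<in>index_set n. h i * of_int (cartan n i j))"

definition fund_weight :: "int \<Rightarrow> (int \<Rightarrow> rat) \<Rightarrow> rat"
  where "fund_weight j h = h j"

text \<open>Signs are encoded as the integers 1 and -1: \<open>X s i r\<close> is \<open>x\<^sub>i\<^sub>,\<^sub>r\<close> with superscript the
  sign of \<open>s\<close>.  Symbols that are not generators (such as \<open>X 0 i r\<close> or \<open>H i 0\<close>) are killed by the
  first family of relators below.\<close>

datatype tor_gen = X int int int | K "int \<Rightarrow> rat" | H int int

fun is_generator :: "nat \<Rightarrow> tor_gen \<Rightarrow> bool" where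
  "is_generator n (X s i r) \<longleftrightarrow> s \<in> {1, -1} \<and> i \<in> index_set n"
| "is_generator n (K h) \<longleftrightarrow> h \<in> cartan_space n"
| "is_generator n (H i m) \<longleftrightarrow> i \<in> index_set n \<and> m \<noteq> 0"

text \<open>\<open>fps_exp_nc S\<close> is the exponential of a series \<open>S\<close> without constant term; then only the
  powers up to \<open>m\<close> contribute to the coefficient of degree \<open>m\<close>.\<close>

definition fps_exp_nc :: "'g free_algebra fps \<Rightarrow> 'g free_algebra fps"
  where "fps_exp_nc S = Abs_fps (\<lambda>m. \<Sum>p\<le>m. scalar (1 / fact p) * fps_nth (S ^ p) m)"

definition h_series :: "complex \<Rightarrow> int \<Rightarrow> int \<Rightarrow> tor_gen free_algebra fps"
  where "h_series \<tau> s i = Abs_fps (\<lambda>m. if m = 0 then 0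
    else scalar (of_int s * (qpow \<tau> 1 - qpow \<tau> (-1))) * gen (H i (s * int m)))"

text \<open>The coefficient of \<open>z\<^sup>m\<close>, \<open>m\<close> any integer, in the series \<open>\<phi>\<^sub>i(z)\<close> of sign \<open>s\<close>, which is a
  power series in \<open>z\<close> for \<open>s = 1\<close> and in the inverse of \<open>z\<close> for \<open>s = -1\<close>.\<close>

definition phi :: "complex \<Rightarrow> int \<Rightarrow> int \<Rightarrow> int \<Rightarrow> tor_gen free_algebra"
  where "phi \<tau> s i m =
    (if s * m \<ge> 0
     then gen (K (\<lambda>j. if j = i then of_int s else 0)) *
          fps_nth (fps_exp_nc (h_series \<tau> s i)) (nat (s * m))
     else 0)"

inductive_set commuting_elements :: "nat \<Rightarrow> complex \<Rightarrow> tor_gen free_algebra set"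
  for n :: nat and \<tau> :: complex
where
  K: "h \<in> cartan_space n \<Longrightarrow> gen (K h) \<in> commuting_elements n \<tau>"
| phi: "i \<in> index_set n \<Longrightarrow> s \<in> {1, -1} \<Longrightarrow> phi \<tau> s i m \<in> commuting_elements n \<tau>"

text \<open>Each relation between generating series is written as the family of its coefficients:
  those of \<open>z\<^sup>m w\<^sup>r\<close> in \<open>phi_x\<close>, \<open>x_plus_x_minus\<close> and \<open>x_x\<close>, and those of
  \<open>z\<^sub>1\<^sup>m z\<^sub>2\<^sup>l w\<^sup>r\<close> in \<open>serre\<close>.\<close>

inductive_set toroidal_relators :: "nat \<Rightarrow> complex \<Rightarrow> tor_gen free_algebra set"
  for n :: nat and \<tau> :: complex
where
  no_generator: "\<not> is_generator n g \<Longrightarrow> gen g \<in> toroidal_relators n \<tau>"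
| K_add: "h \<in> cartan_space n \<Longrightarrow> h' \<in> cartan_space n \<Longrightarrow>
    gen (K h) * gen (K h') - gen (K (h + h')) \<in> toroidal_relators n \<tau>"
| K_zero: "gen (K 0) - 1 \<in> toroidal_relators n \<tau>"
| commute: "p \<in> commuting_elements n \<tau> \<Longrightarrow> q \<in> commuting_elements n \<tau> \<Longrightarrow>
    p * q - q * p \<in> toroidal_relators n \<tau>"
| K_x: "h \<in> cartan_space n \<Longrightarrow> j \<in> index_set n \<Longrightarrow> s \<in> {1, -1} \<Longrightarrow>
    gen (K h) * gen (X s j r) * gen (K (- h))
      - scalar (qpow \<tau> (of_int s * simple_root n j h)) * gen (X s j r)
    \<in> toroidal_relators n \<tau>"
| phi_x: "i \<in> index_set n \<Longrightarrow> j \<in> index_set n \<Longrightarrow> s \<in> {1, -1} \<Longrightarrow> \<sigma> \<in> {1, -1} \<Longrightarrow>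
    q = scalar (qpow \<tau> (of_int (s * cartan n i j))) \<Longrightarrow>
    (phi \<tau> \<sigma> i m * gen (X s j (r - 1)) - q * phi \<tau> \<sigma> i (m - 1) * gen (X s j r))
      - (q * gen (X s j (r - 1)) * phi \<tau> \<sigma> i m - gen (X s j r) * phi \<tau> \<sigma> i (m - 1))
    \<in> toroidal_relators n \<tau>"
| x_plus_x_minus: "i \<in> index_set n \<Longrightarrow> j \<in> index_set n \<Longrightarrow>
    (gen (X 1 i m) * gen (X (-1) j r) - gen (X (-1) j r) * gen (X 1 i m))
      - (if i = j
         then scalar (1 / (qpow \<tau> 1 - qpow \<tau> (-1))) * (phi \<tau> 1 i (m + r) - phi \<tau> (-1) i (m + r))
         else 0)
    \<in> toroidal_relators n \<tau>"
| x_x: "i \<in> index_set n \<Longrightarrow> j \<in> index_set n \<Longrightarrow> s \<in> {1, -1} \<Longrightarrow>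
    q = scalar (qpow \<tau> (of_int (s * cartan n i j))) \<Longrightarrow>
    (gen (X s i m) * gen (X s j (r - 1)) - q * gen (X s i (m - 1)) * gen (X s j r))
      - (q * gen (X s j (r - 1)) * gen (X s i m) - gen (X s j r) * gen (X s i (m - 1)))
    \<in> toroidal_relators n \<tau>"
| serre: "i \<in> index_set n \<Longrightarrow> j \<in> index_set n \<Longrightarrow> s \<in> {1, -1} \<Longrightarrow>
    j = cls n (i + 1) \<or> j = cls n (i - 1) \<Longrightarrow>
    q = scalar (qpow \<tau> 1 + qpow \<tau> (-1)) \<Longrightarrow>
    (gen (X s i m) * gen (X s i l) * gen (X s j r)
      - q * gen (X s i m) * gen (X s j r) * gen (X s i l)
      + gen (X s j r) * gen (X s i m) * gen (X s i l))
    + (gen (X s i l) * gen (X s i m) * gen (X s j r)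
      - q * gen (X s i l) * gen (X s j r) * gen (X s i m)
      + gen (X s j r) * gen (X s i l) * gen (X s i m))
    \<in> toroidal_relators n \<tau>"
| x_commute: "i \<in> index_set n \<Longrightarrow> j \<in> index_set n \<Longrightarrow> s \<in> {1, -1} \<Longrightarrow>
    i \<notin> {j, cls n (j + 1), cls n (j - 1)} \<Longrightarrow>
    gen (X s i m) * gen (X s j r) - gen (X s j r) * gen (X s i m) \<in> toroidal_relators n \<tau>"

section \<open>The modules \<open>V\<close> and their tensor products\<close>

definition primitive_root_of_unity :: "nat \<Rightarrow> complex \<Rightarrow> bool"
  where "primitive_root_of_unity N \<epsilon> \<longleftrightarrow>
    0 < N \<and> \<epsilon> ^ N = 1 \<and> (\<forall>m. 0 < m \<and> m < N \<longrightarrow> \<epsilon> ^ m \<noteq> 1)"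

text \<open>The underlying space of each factor consists of the functions on \<open>{0..<N}\<close>, extended by zero,
  with \<open>N = (n + 1) L\<close>.  The basis vector indexed by an arbitrary integer \<open>j\<close> is the indicator of
  the residue of \<open>j\<close>; this implements the identification of the vectors indexed by \<open>j\<close> and
  \<open>j + N\<close>.\<close>

definition box :: "nat \<Rightarrow> int \<Rightarrow> (int \<Rightarrow> complex)"
  where "box N j = (\<lambda>l. if l = j mod int N then 1 else 0)"

definition psi :: "complex \<Rightarrow> complex \<Rightarrow> complex"
  where "psi \<tau> z = (qpow \<tau> 1 - qpow \<tau> (-1) * z) / (1 - z)"

text \<open>The rational function by which \<open>\<phi>\<^sub>i(z)\<close> (both signs) acts on the \<open>j\<close>-th basis vector.\<close>

definition box_phi :: "nat \<Rightarrow> complex \<Rightarrow> complex \<Rightarrow> int \<Rightarrow> int \<Rightarrow> complex \<Rightarrow> complex"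
  where "box_phi n \<tau> a i j z =
    (if i = cls n j then psi \<tau> (a * qpow \<tau> (of_int j) * z)
     else if i = cls n (j - 1) then inverse (psi \<tau> (a * qpow \<tau> (of_int (j + 1)) * z))
     else 1)"

text \<open>\<open>x\<^sub>i(z)\<close> of sign \<open>s\<close> maps the \<open>j\<close>-th basis vector to 0 or to \<open>\<delta>(c z)\<close> times another
  basis vector, where \<open>c = box_delta \<tau> s a j\<close>; its coefficient of \<open>z\<^sup>r\<close> involves \<open>c\<^sup>r\<close>.\<close>

definition box_delta :: "complex \<Rightarrow> int \<Rightarrow> complex \<Rightarrow> int \<Rightarrow> complex"
  where "box_delta \<tau> s a j = a * qpow \<tau> (of_int (if s = 1 then j - 1 else j))"

definition box_supp :: "nat \<Rightarrow> int \<Rightarrow> int \<Rightarrow> int \<Rightarrow> bool"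
  where "box_supp n s i j \<longleftrightarrow> i = cls n (if s = 1 then j - 1 else j)"

definition box_x :: "nat \<Rightarrow> nat \<Rightarrow> complex \<Rightarrow> complex \<Rightarrow> int \<Rightarrow> int \<Rightarrow> int \<Rightarrow> int \<Rightarrow> (int \<Rightarrow> complex)"
  where "box_x n L \<tau> a s i r j =
    (if box_supp n s i j
     then fscale (box_delta \<tau> s a j powi r) (box ((n + 1) * L) (if s = 1 then j - 1 else j + 1))
     else 0)"

text \<open>Tensor product of \<open>k\<close> copies of the space of functions on \<open>{0..<N}\<close>: functions on
  \<open>k\<close>-tuples, with the pure tensors being the products of functions of the individual entries.\<close>

definition tensor_space :: "nat \<Rightarrow> nat \<Rightarrow> (int list \<Rightarrow> complex) set"
  where "tensor_space N k =
    {F. \<forall>js. F js \<noteq> 0 \<longrightarrow> length js = k \<and> set js \<subseteq> {0..<int N}}"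

definition pure_tensor :: "nat \<Rightarrow> (nat \<Rightarrow> int \<Rightarrow> complex) \<Rightarrow> (int list \<Rightarrow> complex)"
  where "pure_tensor k v = (\<lambda>js. if length js = k then (\<Prod>u<k. v u (js ! u)) else 0)"

text \<open>By the Drinfeld coproduct, when \<open>x\<^sub>i(z)\<close> acts on the factor \<open>u\<close>, a series \<open>\<phi>\<^sub>i(z)\<close> acts on
  each factor to the left (sign +) or to the right (sign -) of \<open>u\<close>.\<close>

definition other_factors :: "nat \<Rightarrow> int \<Rightarrow> nat \<Rightarrow> nat set"
  where "other_factors k s u = (if s = 1 then {..<u} else {u<..<k})"

text \<open>No factor of the products occurring in the coproduct formulas has a pole at the point where
  the accompanying delta function evaluates it.\<close>

definition drinfeld_pole_free :: "nat \<Rightarrow> complex \<Rightarrow> nat \<Rightarrow> (nat \<Rightarrow> complex) \<Rightarrow> bool"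
  where "drinfeld_pole_free n \<tau> k a \<longleftrightarrow>
    (\<forall>js :: nat \<Rightarrow> int. \<forall>i\<in>index_set n. \<forall>s\<in>{1, -1}. \<forall>u<k. \<forall>t\<in>other_factors k s u.
       box_supp n s i (js u) \<longrightarrow>
       \<not> is_pole (box_phi n \<tau> (a t) i (js t)) (inverse (box_delta \<tau> s (a u) (js u))))"

text \<open>The action is the one prescribed by the iterated Drinfeld coproduct on tensors of basis
  vectors.  In the formula for \<open>x\<close>, a product \<open>f(z) \<delta>(c z)\<close> is \<open>f(1/c) \<delta>(c z)\<close>.  The
  eigenvalues of the coefficients of \<open>\<phi>\<^sub>i(z)\<close> are the expansion coefficients of a rational
  function at 0 (sign +) and at infinity (sign -); Laurent expansions disregard the value at the
  centre, which is needed for the expansion at infinity.\<close>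

definition drinfeld_action ::
  "nat \<Rightarrow> nat \<Rightarrow> complex \<Rightarrow> nat \<Rightarrow> (nat \<Rightarrow> complex) \<Rightarrow>
   (tor_gen free_algebra \<Rightarrow> (int list \<Rightarrow> complex) \<Rightarrow> (int list \<Rightarrow> complex)) \<Rightarrow> bool"
  where "drinfeld_action n L \<tau> k a act \<longleftrightarrow>
    (\<forall>js :: nat \<Rightarrow> int.
      let b = (\<lambda>t. box ((n + 1) * L) (js t));
          F = (\<lambda>i z. \<Prod>t<k. box_phi n \<tau> (a t) i (js t) z)
      in
      (\<forall>i\<in>index_set n. \<forall>s\<in>{1, -1}. \<forall>r.
         act (gen (X s i r)) (pure_tensor k b) =
         (\<Sum>u<k. fscale
            (\<Prod>t\<in>other_factors k s u.
               box_phi n \<tau> (a t) i (js t) (inverse (box_delta \<tau> s (a u) (js u))))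
            (pure_tensor k (b(u := box_x n L \<tau> (a u) s i r (js u)))))) \<and>
      (\<forall>h\<in>cartan_space n.
         act (gen (K h)) (pure_tensor k b) =
         fscale
           (\<Prod>t<k. qpow \<tau> (fund_weight (cls n (js t)) h - fund_weight (cls n (js t - 1)) h))
           (pure_tensor k b)) \<and>
      (\<forall>i\<in>index_set n.
         (\<exists>A. F i has_laurent_expansion fps_to_fls A \<and>
            (\<forall>m. act (phi \<tau> 1 i (int m)) (pure_tensor k b) =
                 fscale (fps_nth A m) (pure_tensor k b))) \<and>
         (\<exists>A. (\<lambda>z. F i (inverse z)) has_laurent_expansion fps_to_fls A \<and>
            (\<forall>m. act (phi \<tau> (-1) i (- int m)) (pure_tensor k b) =
                 fscale (fps_nth A m) (pure_tensor k b)))))"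

end

theory Submission
  imports Defs
begin

text \<open>The basis vectors of one factor form a cycle of length \<open>N = (n + 1) L\<close>, and the current
  \<open>x\<^sub>i(z)\<close> of either sign moves the entry of one factor by one step along this cycle.  Label the
  edge of the cycle of factor \<open>u\<close> that joins \<open>m\<close> and \<open>m + 1\<close> by the class of \<open>m\<close> modulo \<open>n + 1\<close>
  and by the point \<open>a\<^sub>u \<epsilon>\<^sup>m\<close>.  Then \<open>x\<^sub>i\<^sub>,\<^sub>r\<close> is the sum over all edges of class \<open>i\<close> of the \<open>r\<close>-th power of
  the point times an edge operator \<open>move\<close>, which multiplies a basis tensor by values of the rational
  functions of the factors on one side and moves one entry across the edge.  The hypotheses on the
  ratios \<open>a\<^sub>i / a\<^sub>j\<close> say that the points of two edges of the same class in different factors never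
  have ratio \<open>1\<close> or \<open>\<epsilon>\<^sup>2\<close> or its inverse (\<open>pt_ne\<close>), and these are exactly the positions of the
  poles and zeros; so all coefficients exist and are nonzero (\<open>ev_not_pole\<close>, \<open>ev_nz\<close>).

  All relations come from one identity, \<open>box_series_step\<close>: when an entry crosses an edge of point
  \<open>c\<close>, the eigenvalue of \<open>\<phi>\<^sub>i(z)\<close> is multiplied by \<open>(q - c z) / (1 - q c z)\<close> with
  \<open>q\<close> a power of \<open>\<epsilon>\<close> given by the Cartan matrix.  Read in the expansions at 0 and at infinity it is
  the relation between \<open>\<phi>\<close> and \<open>x\<close>.  Read at the points of the other edges it gives the exchange
  relation of two edge operators (\<open>move_exchange\<close>), hence the quadratic relation, and the Serre
  relation through the polynomial identity \<open>serre_scalar\<close>; and it gives that edge operators of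
  opposite sign in different factors commute (\<open>move_mixed\<close>).  Opposite moves across the same edge
  compose to diagonal operators, and partial fractions identify the sum of their commutators with
  the difference of the two expansions of the eigenvalue of \<open>\<phi>\<^sub>i\<close> (\<open>phi_coeff_diff\<close>).  The generators
  \<open>h\<^sub>i\<^sub>,\<^sub>m\<close> act through the formal logarithm of that eigenvalue.

  The coproduct formulas prescribe \<open>x\<close>, \<open>k\<close> and \<open>\<phi>\<close> on a basis, and \<open>\<phi>\<close> determines the \<open>h\<^sub>i\<^sub>,\<^sub>m\<close>
  recursively because \<open>k\<close> is invertible (\<open>agree_h_series\<close>), so the structure is unique.  For
  irreducibility, the points of the edges of one class are distinct, so interpolation in \<open>r\<close> shows
  that a submodule is stable under every single edge operator (\<open>W_move\<close>).  Crossing an edge and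
  coming back is a diagonal operator whose support consists of the tensors with a prescribed entry;
  so a nonzero submodule contains a basis tensor (\<open>W_unit_vec\<close>), and walking around the cycles
  reaches all of them.\<close>

section \<open>The space of functions on tuples\<close>

interpretation fs: vector_space "fscale :: complex \<Rightarrow> ('b \<Rightarrow> complex) \<Rightarrow> ('b \<Rightarrow> complex)"
  by unfold_locales (auto simp: fscale_def fun_eq_iff algebra_simps)

lemma fscale_apply [simp]: "fscale c v x = c * v x"
  by (simp add: fscale_def)

lemma sum_fun_apply: "(\<Sum>a\<in>A. f a) x = (\<Sum>a\<in>A. f a x)"
  for f :: "'a \<Rightarrow> 'b \<Rightarrow> complex"
  by (induction A rule: infinite_finite_induct) auto

definition states :: "nat \<Rightarrow> nat \<Rightarrow> int list set"
  where "states N k = {ls. length ls = k \<and> set ls \<subseteq> {0..<int N}}"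

definition unit_vec :: "'b \<Rightarrow> 'b \<Rightarrow> complex"
  where "unit_vec b = (\<lambda>x. if x = b then 1 else 0)"

lemma finite_states: "finite (states N k)" and card_states: "card (states N k) = N ^ k"
proof -
  have eq: "states N k = {ls. set ls \<subseteq> {0..<int N} \<and> length ls = k}"
    by (auto simp: states_def)
  show "finite (states N k)" unfolding eq by (rule finite_lists_length_eq) simp
  show "card (states N k) = N ^ k" unfolding eq by (subst card_lists_length_eq) simp_all
qed

lemma tensor_space_iff: "v \<in> tensor_space N k \<longleftrightarrow> (\<forall>ls. ls \<notin> states N k \<longrightarrow> v ls = 0)"
  by (auto simp: tensor_space_def states_def)

lemma subspace_tensor_space: "module.subspace fscale (tensor_space N k)"
  by (rule fs.subspaceI) (auto simp: tensor_space_iff)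

lemma unit_vec_in_tensor_space: "ls \<in> states N k \<Longrightarrow> unit_vec ls \<in> tensor_space N k"
  by (auto simp: tensor_space_iff unit_vec_def)

lemma tensor_space_expand:
  assumes "v \<in> tensor_space N k"
  shows "v = (\<Sum>ls\<in>states N k. fscale (v ls) (unit_vec ls))"
proof
  fix x
  have "(\<Sum>ls\<in>states N k. fscale (v ls) (unit_vec ls)) x
      = (\<Sum>ls\<in>states N k. if x = ls then v ls else 0)"
    by (auto simp: sum_fun_apply unit_vec_def intro!: sum.cong)
  also have "\<dots> = v x"
    using assms by (auto simp: tensor_space_iff sum.delta' finite_states)
  finally show "v x = (\<Sum>ls\<in>states N k. fscale (v ls) (unit_vec ls)) x" by simp
qed

lemma span_unit_vec: "module.span fscale (unit_vec ` states N k) = tensor_space N k"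
proof
  show "fs.span (unit_vec ` states N k) \<subseteq> tensor_space N k"
    by (rule fs.span_minimal) (auto intro: unit_vec_in_tensor_space subspace_tensor_space)
  show "tensor_space N k \<subseteq> fs.span (unit_vec ` states N k)"
  proof
    fix v assume v: "v \<in> tensor_space N k"
    show "v \<in> fs.span (unit_vec ` states N k)"
      by (subst tensor_space_expand[OF v])
         (intro fs.span_sum fs.span_scale fs.span_base imageI)
  qed
qed

lemma inj_unit_vec: "inj unit_vec"
proof (rule injI)
  fix x y :: 'a assume "unit_vec x = unit_vec y"
  then have "unit_vec x x = unit_vec y x" by simp
  then show "x = y" by (auto simp: unit_vec_def split: if_splits)
qed

lemma dim_tensor_space: "vector_space.dim fscale (tensor_space N k) = N ^ k"
proof -
  let ?B = "unit_vec ` states N k"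
  have fin: "finite ?B" by (simp add: finite_states)
  have ind: "\<not> fs.dependent ?B"
  proof
    assume "fs.dependent ?B"
    then obtain u b where b: "b \<in> ?B" "u b \<noteq> 0" and s: "(\<Sum>v\<in>?B. fscale (u v) v) = 0"
      using fin by (auto simp: fs.dependent_finite)
    from b obtain ls where ls: "ls \<in> states N k" "b = unit_vec ls" by auto
    have "0 = (\<Sum>v\<in>?B. fscale (u v) v) ls" using s by simp
    also have "\<dots> = (\<Sum>l\<in>states N k. u (unit_vec l) * unit_vec l ls)"
      by (subst sum.reindex) (auto simp: sum_fun_apply intro: inj_on_subset[OF inj_unit_vec])
    also have "\<dots> = (\<Sum>l\<in>states N k. if ls = l then u (unit_vec l) else 0)"
      by (intro sum.cong) (auto simp: unit_vec_def)
    also have "\<dots> = u b" using ls by (simp add: sum.delta' finite_states)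
    finally show False using b by simp
  qed
  have "fs.dim (tensor_space N k) = card ?B"
  proof (rule fs.dim_unique)
    show "?B \<subseteq> tensor_space N k" by (auto intro: unit_vec_in_tensor_space)
    show "tensor_space N k \<subseteq> fs.span ?B" by (simp add: span_unit_vec)
    show "fs.independent ?B" by (rule ind)
  qed simp
  also have "card ?B = N ^ k"
    by (subst card_image) (auto intro: inj_on_subset[OF inj_unit_vec] simp: card_states)
  finally show ?thesis .
qed

section \<open>Actions of the free algebra\<close>

lemma poly_mapping_additive_induct [case_names zero single add]:
  assumes "P 0" "\<And>w c. P (Poly_Mapping.single w c)" "\<And>p q. P p \<Longrightarrow> P q \<Longrightarrow> P (p + q)"
  shows "P p"
proof (induction p rule: update_induct)
  case const
  show ?case using assms(1) by simp
next
  case (update p w c)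
  have "Poly_Mapping.update w c p = p + Poly_Mapping.single w c"
    using update by (intro poly_mapping_eqI)
      (auto simp: lookup_update lookup_add lookup_single when_def in_keys_iff)
  then show ?case using update assms by auto
qed

lemma scalar_mult_single: "scalar c * Poly_Mapping.single w d = Poly_Mapping.single w (c * d)"
  by (simp add: scalar_def mult_single)

text \<open>A property of the elements of the free algebra can be checked on constants and generators, since
  every word is a product of generators.\<close>

lemma free_algebra_induct [case_names scalar gen add mult]:
  fixes p :: "'g free_algebra"
  assumes "\<And>c. P (scalar c)" "\<And>g. P (gen g)"
    "\<And>p q. P p \<Longrightarrow> P q \<Longrightarrow> P (p + q)" "\<And>p q. P p \<Longrightarrow> P q \<Longrightarrow> P (p * q)"
  shows "P p"
proof (induction p rule: poly_mapping_additive_induct)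
  case zero
  have "(0 :: 'g free_algebra) = scalar 0" by (simp add: scalar_def)
  then show ?case using assms(1) by metis
next
  case (single w c)
  obtain gs where w: "w = Word gs" by (cases w) auto
  have "P (Poly_Mapping.single (Word gs) 1)"
  proof (induction gs)
    case Nil
    have "Poly_Mapping.single (Word []) 1 = (scalar 1 :: 'g free_algebra)"
      by (simp add: scalar_def zero_word_def)
    then show ?case using assms(1) by simp
  next
    case (Cons g gs)
    have "Poly_Mapping.single (Word (g # gs)) 1 = gen g * Poly_Mapping.single (Word gs) 1"
      by (simp add: gen_def mult_single plus_word_def)
    then show ?case using Cons assms by simp
  qed
  then have "P (scalar c * Poly_Mapping.single w 1)" using assms w by simp
  then show ?case by (simp add: scalar_mult_single)
next
  case (add p q) then show ?case using assms by simp
qed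

definition lift_ops :: "('g \<Rightarrow> ('b \<Rightarrow> complex) \<Rightarrow> ('b \<Rightarrow> complex)) \<Rightarrow>
    'g free_algebra \<Rightarrow> ('b \<Rightarrow> complex) \<Rightarrow> ('b \<Rightarrow> complex)"
  where "lift_ops ops p v = (\<Sum>w\<in>Poly_Mapping.keys p.
    fscale (Poly_Mapping.lookup p w) (foldr ops (letters w) v))"

lemma lift_ops_superset:
  assumes "finite A" "Poly_Mapping.keys p \<subseteq> A"
  shows "lift_ops ops p v = (\<Sum>w\<in>A. fscale (Poly_Mapping.lookup p w) (foldr ops (letters w) v))"
  unfolding lift_ops_def using assms
  by (intro sum.mono_neutral_left) (auto simp: in_keys_iff)

lemma lift_ops_add: "lift_ops ops (p + q) v = lift_ops ops p v + lift_ops ops q v"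
proof -
  let ?A = "Poly_Mapping.keys p \<union> Poly_Mapping.keys q"
  have "Poly_Mapping.keys (p + q) \<subseteq> ?A" by (rule Poly_Mapping.keys_add)
  then show ?thesis
    by (simp add: lift_ops_superset[where A = ?A] lookup_add fs.scale_left_distrib sum.distrib)
qed

lemma lift_ops_single:
  "lift_ops ops (Poly_Mapping.single w c) v = fscale c (foldr ops (letters w) v)"
  by (subst lift_ops_superset[where A = "{w}"]) auto

lemma linear_on_UNIV_iff: "linear_on UNIV f \<longleftrightarrow>
    (\<forall>v w. f (v + w) = f v + f w) \<and> (\<forall>c v. f (fscale c v) = fscale c (f v))"
  by (simp add: linear_on_def)

lemma lift_ops_0 [simp]: "lift_ops ops 0 v = 0"
  by (simp add: lift_ops_def)

lemma lift_ops_scalar: "lift_ops ops (scalar c) v = fscale c v"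
  by (simp add: scalar_def lift_ops_single zero_word_def)

lemma lift_ops_gen: "lift_ops ops (gen g) v = ops g v"
  by (simp add: gen_def lift_ops_single)

lemma linear_foldr:
  assumes "\<And>g. linear_on UNIV (ops g)"
  shows "linear_on UNIV (foldr ops gs)"
  using assms by (induction gs) (auto simp: linear_on_UNIV_iff)

lemma linear_lift_ops:
  assumes "\<And>g. linear_on UNIV (ops g)"
  shows "linear_on UNIV (lift_ops ops p)"
  using linear_foldr[of ops, OF assms]
  by (auto simp: linear_on_UNIV_iff lift_ops_def sum.distrib fs.scale_right_distrib
        fs.scale_sum_right mult.commute)

lemma lift_ops_mult:
  assumes "\<And>g. linear_on UNIV (ops g)"
  shows "lift_ops ops (p * q) v = lift_ops ops p (lift_ops ops q v)"
proof -
  note lin = linear_lift_ops[of ops, OF assms]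
  have zero: "lift_ops ops p 0 = 0" for p using lin[of p]
    by (metis linear_on_UNIV_iff fs.scale_zero_left)
  show ?thesis
  proof (induction p arbitrary: q rule: poly_mapping_additive_induct)
    case (single w c)
    show ?case
    proof (induction q rule: poly_mapping_additive_induct)
      case (single w' c')
      have "foldr ops (letters w) (fscale b x) = fscale b (foldr ops (letters w) x)" for b x
        using linear_foldr[of ops, OF assms] by (auto simp: linear_on_UNIV_iff)
      then show ?case
        by (simp only: mult_single lift_ops_single plus_word_def word.sel foldr_append comp_apply
              fs.scale_scale)
    next
      case (add p q)
      have "lift_ops ops r (x + y) = lift_ops ops r x + lift_ops ops r y" for r x y
        using lin by (simp only: linear_on_UNIV_iff)
      then show ?case by (simp only: distrib_left lift_ops_add add)
    qed (simp only: mult_zero_right lift_ops_0 zero)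
  next
    case (add p p')
    then show ?case by (simp only: distrib_right lift_ops_add)
  qed (simp only: mult_zero_left lift_ops_0)
qed

text \<open>Linearity makes the action multiplicative, so that \<open>p x q\<close> acts by zero whenever the relator
  \<open>x\<close> does; hence only the relators have to be checked.\<close>

lemma presented_module_lift_ops:
  assumes lin: "\<And>g. linear_on UNIV (ops g)"
    and V: "module.subspace fscale V"
    and inv: "\<And>g v. v \<in> V \<Longrightarrow> ops g v \<in> V"
    and rel: "\<And>x v. x \<in> R \<Longrightarrow> v \<in> V \<Longrightarrow> lift_ops ops x v = 0"
  shows "presented_module R V (lift_ops ops)"
proof -
  note linl = linear_lift_ops[of ops, OF lin]
  have inv': "lift_ops ops p v \<in> V" if "v \<in> V" for p v
    unfolding lift_ops_def
  proof (intro fs.subspace_sum[OF V] fs.subspace_scale[OF V])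
    have "foldr ops gs v \<in> V" for gs
      by (induction gs) (simp_all add: that inv)
    then show "foldr ops (letters w) v \<in> V" for w .
  qed
  have ideal: "lift_ops ops p v = 0" if "p \<in> two_sided_ideal R" "v \<in> V" for p v
    using that
  proof (induction arbitrary: v rule: two_sided_ideal.induct)
    case (mult x p q)
    have "lift_ops ops p 0 = 0" by (metis linl linear_on_UNIV_iff fs.scale_zero_left)
    then show ?case using mult inv' rel by (simp add: lift_ops_mult[OF lin])
  qed (auto simp: lift_ops_add)
  show ?thesis
    unfolding presented_module_def using linl inv' ideal V
    by (auto simp: lift_ops_add lift_ops_scalar lift_ops_mult[OF lin] linear_on_def)
qed

section \<open>Formal series\<close>

lemma fps_prod_nth_0: "fps_nth (\<Prod>t\<in>T. f t) 0 = (\<Prod>t\<in>T. fps_nth (f t) 0)"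
  for f :: "'t \<Rightarrow> complex fps"
  by (induction T rule: infinite_finite_induct) auto

text \<open>The logarithm is the compositional inverse of \<open>exp - 1\<close>.  It supplies eigenvalues for
  the \<open>h\<^sub>i\<^sub>,\<^sub>m\<close>, which the relations mention only inside an exponential.\<close>

lemma fps_exp_surj:
  fixes f :: "complex fps"
  assumes "fps_nth f 0 = 1"
  shows "\<exists>S. fps_nth S 0 = 0 \<and> fps_compose (fps_exp 1) S = f"
proof -
  let ?g = "fps_exp 1 - 1 :: complex fps"
  have g: "fps_nth ?g 0 = 0" "fps_nth ?g 1 \<noteq> 0" by simp_all
  have f1: "fps_nth (f - 1) 0 = 0" using assms by simp
  define S where "S = fps_compose (fps_inv ?g) (f - 1)"
  have S0: "fps_nth S 0 = 0" by (simp add: S_def fps_inv_def)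
  have "fps_compose ?g S = fps_compose (fps_compose ?g (fps_inv ?g)) (f - 1)"
    unfolding S_def using f1 by (subst fps_compose_assoc) (auto simp: fps_inv_def)
  also have "\<dots> = f - 1" using fps_inv_right[OF g] f1 by simp
  finally have "fps_compose (fps_exp 1) S = f"
    by (simp add: fps_compose_sub_distrib)
  then show ?thesis using S0 by blast
qed

lemma has_fps_expansion_geometric: "(\<lambda>z. 1 / (1 - p * z)) has_fps_expansion inverse (1 - fps_const p * fps_X)"
  for p :: complex
proof -
  have "(\<lambda>z. inverse (1 - p * z)) has_fps_expansion inverse (1 - fps_const p * fps_X)"
    by (intro fps_expansion_intros) auto
  then show ?thesis by (simp add: inverse_eq_divide)
qed

text \<open>Each \<open>G t\<close> stands for \<open>1 / (1 - p\<^sub>t z)\<close>.  The product rule in the last assumption is shared by the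
  expansions at 0 and at infinity and by the numerical values at a point, so the decomposition
  applies to all of them.  The induction uses this: the coefficient of the new pole is the value
  at that pole of the product of the other factors.\<close>

lemma partial_fractions:
  fixes G :: "'t \<Rightarrow> complex fps" and p \<kappa> \<rho> :: "'t \<Rightarrow> complex"
  assumes "finite T" "inj_on p T" "\<And>t. t \<in> T \<Longrightarrow> p t \<noteq> 0"
    and "\<And>t t'. t \<in> T \<Longrightarrow> t' \<in> T \<Longrightarrow> t \<noteq> t' \<Longrightarrow>
      fps_const (p t - p t') * (G t * G t') = fps_const (p t) * G t - fps_const (p t') * G t'"
  shows "(\<Prod>t\<in>T. fps_const (\<kappa> t) + fps_const (\<rho> t) * G t)
    = fps_const (\<Prod>t\<in>T. \<kappa> t)
      + (\<Sum>t\<in>T. fps_const (\<rho> t * (\<Prod>t'\<in>T-{t}. \<kappa> t' + \<rho> t' / (1 - p t' / p t))) * G t)"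
  using assms
proof (induction T arbitrary: G rule: finite_induct)
  case empty
  then show ?case by simp
next
  case (insert n T)
  define K where "K = (\<Prod>t\<in>T. \<kappa> t)"
  define ev where "ev = (\<lambda>t' q. \<kappa> t' + \<rho> t' / (1 - p t' / q))"
  define R where "R = (\<lambda>t. \<rho> t * (\<Prod>t'\<in>T-{t}. ev t' (p t)))"
  have pn: "p n \<noteq> 0" "\<And>t. t \<in> T \<Longrightarrow> p t \<noteq> 0" using insert.prems by auto
  have ne: "\<And>t. t \<in> T \<Longrightarrow> p t \<noteq> p n" using insert by (auto simp: inj_on_def)
  have IH: "(\<Prod>t\<in>T. fps_const (\<kappa> t) + fps_const (\<rho> t) * G' t)
      = fps_const K + (\<Sum>t\<in>T. fps_const (R t) * G' t)"
    if "\<And>t t'. t \<in> T \<Longrightarrow> t' \<in> T \<Longrightarrow> t \<noteq> t' \<Longrightarrow>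
      fps_const (p t - p t') * (G' t * G' t') = fps_const (p t) * G' t - fps_const (p t') * G' t'"
    for G'
    unfolding K_def R_def ev_def using insert.prems that by (intro insert.IH) auto
  \<comment> \<open>the same expansion for the numerical value at the pole of the new factor\<close>
  have "(\<Prod>t\<in>T. fps_const (\<kappa> t) + fps_const (\<rho> t) * fps_const (1 / (1 - p t / p n)))
      = fps_const K + (\<Sum>t\<in>T. fps_const (R t) * fps_const (1 / (1 - p t / p n)))"
  proof (rule IH)
    fix t t' assume t: "t \<in> T" "t' \<in> T" "t \<noteq> t'"
    have "p n - p t \<noteq> 0" "p n - p t' \<noteq> 0" using ne[of t] ne[of t'] t by auto
    then have "(p t - p t') * (1 / (1 - p t / p n) * (1 / (1 - p t' / p n)))
      = p t * (1 / (1 - p t / p n)) - p t' * (1 / (1 - p t' / p n))"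
      using pn(1) by (simp add: field_simps)
    then show "fps_const (p t - p t') * (fps_const (1 / (1 - p t / p n)) * fps_const (1 / (1 - p t' / p n)))
      = fps_const (p t) * fps_const (1 / (1 - p t / p n)) - fps_const (p t') * fps_const (1 / (1 - p t' / p n))"
      by (simp del: fps_const_sub add: fps_const_sub)
  qed
  then have "fps_nth (\<Prod>t\<in>T. fps_const (\<kappa> t) + fps_const (\<rho> t) * fps_const (1 / (1 - p t / p n))) 0
      = fps_nth (fps_const K + (\<Sum>t\<in>T. fps_const (R t) * fps_const (1 / (1 - p t / p n)))) 0"
    by simp
  then have evn: "(\<Prod>t\<in>T. ev t (p n)) = K + (\<Sum>t\<in>T. R t / (1 - p t / p n))"
    by (simp add: fps_prod_nth_0 fps_sum_nth ev_def del: fps_const_add fps_const_mult)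
  have GG: "G t * G n = fps_const (1 / (p t - p n)) * (fps_const (p t) * G t - fps_const (p n) * G n)"
    if "t \<in> T" for t
  proof -
    have "fps_const (p t - p n) * (G t * G n) = fps_const (p t) * G t - fps_const (p n) * G n"
      using insert.prems(3)[of t n] that insert.hyps by auto
    then have "fps_const (1 / (p t - p n)) * (fps_const (p t - p n) * (G t * G n))
      = fps_const (1 / (p t - p n)) * (fps_const (p t) * G t - fps_const (p n) * G n)" by simp
    moreover have "fps_const (1 / (p t - p n)) * fps_const (p t - p n) = 1"
      using ne[OF that] by (simp del: fps_const_sub add: fps_const_mult)
    ultimately show ?thesis by (metis mult.assoc mult_1)
  qed
  \<comment> \<open>each old pole is separated from the new one, which changes its coefficient by the factor ev n\<close>
  have split: "fps_const (R t) * G t * (fps_const (\<kappa> n) + fps_const (\<rho> n) * G n)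
     = fps_const (R t * ev n (p t)) * G t
       + fps_const (\<rho> n * (R t / (1 - p t / p n))) * G n" if t: "t \<in> T" for t
  proof -
    have c: "\<kappa> n + \<rho> n * (1 / (p t - p n) * p t) = ev n (p t)"
      "- (1 / (p t - p n) * p n) = 1 / (1 - p t / p n)"
      using ne[OF t] pn t unfolding ev_def by (auto simp: field_simps)
    have "fps_const (R t) * G t * (fps_const (\<kappa> n) + fps_const (\<rho> n) * G n)
      = fps_const (R t) * fps_const (\<kappa> n) * G t + fps_const (R t) * fps_const (\<rho> n) * (G t * G n)"
      by (simp add: algebra_simps del: fps_const_mult)
    also have "\<dots> = fps_const (R t) * (fps_const (\<kappa> n) + fps_const (\<rho> n) * (fps_const (1 / (p t - p n)) * fps_const (p t))) * G t
       + fps_const (\<rho> n) * fps_const (R t) * (- (fps_const (1 / (p t - p n)) * fps_const (p n))) * G n"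
      unfolding GG[OF t] by (simp add: algebra_simps del: fps_const_mult)
    also have "\<dots> = fps_const (R t * (\<kappa> n + \<rho> n * (1 / (p t - p n) * p t))) * G t
       + fps_const (\<rho> n * R t * (- (1 / (p t - p n) * p n))) * G n"
      by (simp only: fps_const_mult fps_const_add fps_const_neg)
    also have "\<dots> = fps_const (R t * ev n (p t)) * G t
       + fps_const (\<rho> n * (R t / (1 - p t / p n))) * G n"
      unfolding c by (simp add: mult.assoc)
    finally show ?thesis .
  qed
  have "(\<Prod>t\<in>insert n T. fps_const (\<kappa> t) + fps_const (\<rho> t) * G t)
      = (fps_const K + (\<Sum>t\<in>T. fps_const (R t) * G t)) * (fps_const (\<kappa> n) + fps_const (\<rho> n) * G n)"
    using insert.hyps insert.prems(3) by (subst IH[symmetric]) (auto simp: mult.commute)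
  also have "\<dots> = fps_const (K * \<kappa> n) + fps_const (\<rho> n * K) * G n
      + (\<Sum>t\<in>T. fps_const (R t) * G t * (fps_const (\<kappa> n) + fps_const (\<rho> n) * G n))"
    unfolding sum_distrib_right[symmetric] fps_const_mult[symmetric] by (simp only: algebra_simps)
  also have "\<dots> = fps_const (K * \<kappa> n) + fps_const (\<rho> n * K) * G n
      + ((\<Sum>t\<in>T. fps_const (R t * ev n (p t)) * G t)
      + (\<Sum>t\<in>T. fps_const (\<rho> n * (R t / (1 - p t / p n)))) * G n)"
    by (simp add: split sum.distrib sum_distrib_right)
  also have "(\<Sum>t\<in>T. fps_const (\<rho> n * (R t / (1 - p t / p n))))
      = fps_const (\<rho> n * (\<Sum>t\<in>T. R t / (1 - p t / p n)))"
    by (rule fps_ext) (simp add: fps_sum_nth sum_distrib_left)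
  finally have "(\<Prod>t\<in>insert n T. fps_const (\<kappa> t) + fps_const (\<rho> t) * G t)
     = fps_const (K * \<kappa> n) + fps_const (\<rho> n * (\<Prod>t\<in>T. ev t (p n))) * G n
       + (\<Sum>t\<in>T. fps_const (R t * ev n (p t)) * G t)"
    unfolding evn by (simp add: distrib_left distrib_right flip: fps_const_add)
  moreover have "R t * ev n (p t) = \<rho> t * (\<Prod>t'\<in>insert n T-{t}. ev t' (p t))" if "t \<in> T" for t
  proof -
    have "insert n T - {t} = insert n (T - {t})" using that insert.hyps by auto
    then show ?thesis using insert.hyps by (simp add: R_def mult.assoc mult.commute)
  qed
  moreover have "insert n T - {n} = T" using insert.hyps by auto
  ultimately show ?case using insert.hyps
    by (simp add: K_def ev_def mult.commute add.assoc)
qed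

section \<open>Identities in commutative rings\<close>

text \<open>The six numbers are the matrix entries of the products of two operators of class \<open>i\<close> (digits) and
  one of class \<open>j\<close> (letter z), written in the order of the product; they are linked by exchange
  relations.  If neither \<open>c1\<close> nor \<open>c2\<close> equals \<open>q w\<close>, all are multiples of one of them and the claim
  is a polynomial identity.  Otherwise three of the numbers vanish, and the claim is what is
  left of the same identity; this happens only for consecutive edges of one cycle.\<close>

lemma serre_scalar:
  fixes q c1 c2 w :: complex
  assumes q: "q \<noteq> 0" "q^2 \<noteq> 1" and c: "c1 \<noteq> 0" "c2 \<noteq> 0"
    and c12: "c1 \<noteq> c2" "c2 \<noteq> q^2 * c1" "c1 \<noteq> q^2 * c2"
    and r: "(c2 - q^2 * c1) * p21z = (q^2 * c2 - c1) * p12z"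
      "(c2 - q^2 * c1) * pz21 = (q^2 * c2 - c1) * pz12"
      "(w - c1 / q) * pz12 = (w / q - c1) * p1z2"
      "(w - c1 / q) * p2z1 = (w / q - c1) * p21z"
      "(w - c2 / q) * pz21 = (w / q - c2) * p2z1"
      "(w - c2 / q) * p1z2 = (w / q - c2) * p12z"
  shows "p12z + p21z + pz12 + pz21 = (q + 1/q) * (p1z2 + p2z1)"
proof -
  define A1 A2 B1 B2 D E where defs: "A1 = w - c1 / q" "A2 = w - c2 / q" "B1 = w / q - c1"
    "B2 = w / q - c2" "D = c2 - q^2 * c1" "E = q^2 * c2 - c1"
  note r' = r[folded defs]
  have DE: "D \<noteq> 0" "E \<noteq> 0" using c12 by (auto simp: defs)
  have key: "D * A1 * A2 + E * A1 * A2 + D * B1 * B2 + E * B1 * B2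
      = (q + 1/q) * (D * A1 * B2 + E * B1 * A2)"
    unfolding defs using q by (simp add: field_simps power2_eq_square)
  consider "A1 \<noteq> 0" "A2 \<noteq> 0" | "A1 = 0" | "A2 = 0" by auto
  then show ?thesis
  proof cases
    case 1
    have e1: "p21z = E / D * p12z" using r'(1) DE by (simp add: field_simps)
    have e2: "p1z2 = B2 / A2 * p12z" using r'(6) 1 by (simp add: field_simps)
    have e3: "p2z1 = B1 / A1 * (E / D * p12z)" unfolding e1[symmetric] using r'(4) 1 by (simp add: field_simps)
    have e4: "pz12 = B1 / A1 * (B2 / A2 * p12z)" unfolding e2[symmetric] using r'(3) 1 by (simp add: field_simps)
    have e5: "pz21 = B2 / A2 * (B1 / A1 * (E / D * p12z))" unfolding e3[symmetric] using r'(5) 1 by (simp add: field_simps)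
    have "D * A1 * A2 * (p12z + p21z + pz12 + pz21)
      = (D * A1 * A2 + E * A1 * A2 + D * B1 * B2 + E * B1 * B2) * p12z"
      unfolding e1 e2 e3 e4 e5 using 1 DE by (simp add: field_simps)
    also have "\<dots> = D * A1 * A2 * ((q + 1/q) * (p1z2 + p2z1))"
    proof -
      have "D * A1 * A2 * (p1z2 + p2z1) = (D * A1 * B2 + E * B1 * A2) * p12z"
        unfolding e2 e3 using 1 DE by (simp add: field_simps)
      then show ?thesis unfolding key by (metis mult.assoc mult.left_commute)
    qed
    finally show ?thesis using 1 DE by simp
  next
    case 2
    have w: "w = c1 / q" using 2 by (simp add: defs)
    have B: "B1 \<noteq> 0" unfolding defs w using q c by (simp add: field_simps power2_eq_square)
    have A: "A2 \<noteq> 0" unfolding defs w using q c12 by (simp add: field_simps)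
    have z: "p1z2 = 0" "p21z = 0" using r'(3,4) 2 B by auto
    then have z': "p12z = 0" using r'(1) DE by simp
    have e1: "pz21 = B2 / A2 * p2z1" using r'(5) A by (simp add: field_simps)
    have e2: "pz12 = D / E * (B2 / A2 * p2z1)" unfolding e1[symmetric] using r'(2) DE by (simp add: field_simps)
    have "D * A1 * A2 + E * A1 * A2 + D * B1 * B2 + E * B1 * B2
      = (q + 1/q) * (D * A1 * B2 + E * B1 * A2)" by (rule key)
    then have "B1 * (D * B2 + E * B2) = B1 * ((q + 1/q) * (E * A2))" using 2
      by (simp add: algebra_simps)
    then have k: "D * B2 + E * B2 = (q + 1/q) * (E * A2)" using B by simp
    have "E * A2 * (pz12 + pz21) = (D * B2 + E * B2) * p2z1"
      unfolding e1 e2 using DE A by (simp add: field_simps)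
    also have "\<dots> = E * A2 * ((q + 1/q) * p2z1)" unfolding k by (simp only: ac_simps)
    finally have "pz12 + pz21 = (q + 1/q) * p2z1" using DE A by simp
    then show ?thesis using z z' by simp
  next
    case 3
    have w: "w = c2 / q" using 3 by (simp add: defs)
    have B: "B2 \<noteq> 0" unfolding defs w using q c by (simp add: field_simps power2_eq_square)
    have A: "A1 \<noteq> 0" unfolding defs w using q c12 by (simp add: field_simps)
    have z: "p2z1 = 0" "p12z = 0" using r'(5,6) 3 B by auto
    then have z': "p21z = 0" using r'(1) DE by simp
    have e1: "pz12 = B1 / A1 * p1z2" using r'(3) A by (simp add: field_simps)
    have e2: "pz21 = E / D * (B1 / A1 * p1z2)" unfolding e1[symmetric] using r'(2) DE by (simp add: field_simps)
    have "D * A1 * A2 + E * A1 * A2 + D * B1 * B2 + E * B1 * B2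
      = (q + 1/q) * (D * A1 * B2 + E * B1 * A2)" by (rule key)
    then have "B2 * (D * B1 + E * B1) = B2 * ((q + 1/q) * (D * A1))" using 3
      by (simp add: algebra_simps)
    then have k: "D * B1 + E * B1 = (q + 1/q) * (D * A1)" using B by simp
    have "D * A1 * (pz12 + pz21) = (D * B1 + E * B1) * p1z2"
      unfolding e1 e2 using DE A by (simp add: field_simps)
    also have "\<dots> = D * A1 * ((q + 1/q) * p1z2)" unfolding k by (simp only: ac_simps)
    finally have "pz12 + pz21 = (q + 1/q) * p1z2" using DE A by simp
    then show ?thesis using z z' by simp
  qed
qed

text \<open>The ring identities behind \<open>box_series_step\<close>.  Here \<open>E\<close> is \<open>\<epsilon>\<close> and \<open>g\<close> is the expansion of
  \<open>Y / (Y - p Z)\<close>, with \<open>p\<close> the point \<open>c\<close>, \<open>c E\<close> or \<open>c F\<close> of an edge.  Each difference of the two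
  sides lies in the ideal generated by \<open>1 - E F\<close> and the equation for \<open>g\<close>.\<close>

lemma
  fixes E F Y Z c g :: "'a::idom"
  assumes EF: "E * F = 1"
  shows step_algebra_same: "(Y - c * Z) * g = Y \<Longrightarrow>
      (Y - E * E * c * Z) * (F + (E - F) * g) = (E * E * Y - c * Z) * (E + (F - E) * g)"
    and step_algebra_succ: "(Y - c * E * Z) * g = Y \<Longrightarrow>
      (Y - F * c * Z) * 1 = (F * Y - c * Z) * (F + (E - F) * g)"
    and step_algebra_pred: "(Y - c * F * Z) * g = Y \<Longrightarrow>
      (Y - F * c * Z) * (E + (F - E) * g) = (F * Y - c * Z) * 1"
proof -
  assume h: "(Y - c * Z) * g = Y"
  have "(Y - E * E * c * Z) * (F + (E - F) * g) - (E * E * Y - c * Z) * (E + (F - E) * g)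
    = E * (1 - E * F) * (Y + c * Z) + (F - E) * (1 + E * E) * (Y - (Y - c * Z) * g)"
    by (simp add: algebra_simps)
  then show "(Y - E * E * c * Z) * (F + (E - F) * g) = (E * E * Y - c * Z) * (E + (F - E) * g)"
    using EF h by simp
next
  assume h: "(Y - c * E * Z) * g = Y"
  have "(Y - F * c * Z) * 1 - (F * Y - c * Z) * (F + (E - F) * g)
    = (1 - E * F) * (Y + (E - F) * (c * Z * g)) + (E - F) * F * (Y - (Y - c * E * Z) * g)"
    by (simp add: algebra_simps)
  then show "(Y - F * c * Z) * 1 = (F * Y - c * Z) * (F + (E - F) * g)"
    using EF h by simp
next
  assume h: "(Y - c * F * Z) * g = Y"
  have "(Y - F * c * Z) * (E + (F - E) * g) - (F * Y - c * Z) * 1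
    = (1 - E * F) * (c * Z) + (F - E) * ((Y - c * F * Z) * g - Y)"
    by (simp add: algebra_simps)
  then show "(Y - F * c * Z) * (E + (F - E) * g) = (F * Y - c * Z) * 1"
    using EF h by simp
qed

section \<open>Roots of unity, classes and points in general position\<close>

locale toroidal_tensor =
  fixes n L k :: nat and \<tau> :: complex and a :: "nat \<Rightarrow> complex"
  assumes n2: "n \<ge> 2" and L1: "L \<ge> 1"
    and primitive: "primitive_root_of_unity ((n + 1) * L) (exp \<tau>)"
    and a_nonzero: "\<And>u. u < k \<Longrightarrow> a u \<noteq> 0"
    and ratio_ne: "\<And>u v. u < k \<Longrightarrow> v < k \<Longrightarrow> u \<noteq> v \<Longrightarrow> a u / a v \<notin> {exp \<tau> ^ ((n + 1) * l) | l. l < L}"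
    and ratio_ne_shifted: "\<And>u v. u < k \<Longrightarrow> v < k \<Longrightarrow> u \<noteq> v \<Longrightarrow>
      a u / a v \<notin> {exp \<tau> powi (s * 2 + int ((n + 1) * l)) | s l. s \<in> {1, -1} \<and> l < L}"
begin

definition e :: complex where "e = exp \<tau>"
definition N :: nat where "N = (n + 1) * L"

text \<open>\<open>pt u m\<close> is the point of the edge of factor \<open>u\<close> that joins \<open>m\<close> and \<open>m + 1\<close>.\<close>

definition pt :: "nat \<Rightarrow> int \<Rightarrow> complex" where "pt u m = a u * e powi m"

lemma e_nz [simp]: "e \<noteq> 0" by (simp add: e_def)

lemma N3: "N \<ge> 3"
proof -
  have "3 * 1 \<le> (n + 1) * L" using n2 L1 by (intro mult_le_mono) auto
  then show ?thesis by (simp add: N_def)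
qed

lemma N_pos: "int N > 0" using N3 by simp

lemma qpow_of_int: "qpow \<tau> (of_int m) = e powi m"
proof -
  have "qpow \<tau> (of_int m) = exp (\<tau> * of_int m)" by (simp add: qpow_def)
  then show ?thesis by (simp add: e_def exp_power_int mult.commute)
qed

lemma qpow_1 [simp]: "qpow \<tau> 1 = e" and qpow_m1 [simp]: "qpow \<tau> (-1) = 1 / e"
  using qpow_of_int[of 1] qpow_of_int[of "-1"] by (simp_all add: field_simps)

lemma e_pow_ne_1: "0 < m \<Longrightarrow> m < N \<Longrightarrow> e ^ m \<noteq> 1" and e_pow_N: "e ^ N = 1"
  using primitive by (auto simp: primitive_root_of_unity_def N_def e_def)

lemma e_powi_N: "e powi (int N * x) = 1"
  using e_pow_N by (simp add: power_int_mult)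

lemma e_powi_mod: "e powi (x mod int N) = e powi x"
proof -
  have "e powi (int N * (x div int N) + x mod int N) = e powi (x mod int N)"
    by (subst power_int_add) (simp_all add: e_powi_N)
  then show ?thesis by (simp only: mult_div_mod_eq)
qed

lemma e_powi_eq_iff: "e powi x = e powi y \<longleftrightarrow> x mod int N = y mod int N"
proof
  assume "x mod int N = y mod int N"
  then show "e powi x = e powi y" by (metis e_powi_mod)
next
  assume "e powi x = e powi y"
  then have "e powi (x - y) = 1" by (simp add: power_int_diff)
  then have 1: "e powi ((x - y) mod int N) = 1" by (simp add: e_powi_mod)
  define d where "d = nat ((x - y) mod int N)"
  have d: "int d = (x - y) mod int N" "d < N" using N_pos by (auto simp: d_def nat_less_iff)
  have "e ^ d = 1" using 1 unfolding d(1)[symmetric] by simp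
  then have "d = 0" using e_pow_ne_1[of d] d(2) by (cases "d = 0") auto
  then show "x mod int N = y mod int N" using d by (metis mod_eq_dvd_iff of_nat_0 mod_0_imp_dvd)
qed

lemma e_sq_ne_1: "e ^ 2 \<noteq> 1"
  using e_pow_ne_1[of 2] N3 by auto

lemma e_diff_nz: "e - 1 / e \<noteq> 0"
  using e_sq_ne_1 by (simp add: field_simps power2_eq_square)

lemma pt_nz: "u < k \<Longrightarrow> pt u m \<noteq> 0" by (simp add: pt_def a_nonzero)

lemma pt_mod: "pt u (m mod int N) = pt u m" by (simp add: pt_def e_powi_mod)

lemma pt_add: "pt u (m + d) = e powi d * pt u m" by (simp add: pt_def power_int_add)

lemma pt_inj: "u < k \<Longrightarrow> pt u m = pt u m' \<Longrightarrow> m mod int N = m' mod int N"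
  by (simp add: pt_def a_nonzero e_powi_eq_iff)

lemma cls_eq_iff: "cls n x = cls n y \<longleftrightarrow> (\<exists>z. x = y + (int n + 1) * z)"
proof -
  have "cls n x = cls n y \<longleftrightarrow> int n + 1 dvd x - y"
    by (simp add: cls_def mod_eq_dvd_iff)
  also have "\<dots> \<longleftrightarrow> (\<exists>z. x = y + (int n + 1) * z)"
    by (auto simp: dvd_def algebra_simps)
  finally show ?thesis .
qed

lemma cls_cls [simp]: "cls n (cls n x) = cls n x" by (simp add: cls_def)
lemma cls_cls_add [simp]: "cls n (cls n x + y) = cls n (x + y)" by (simp add: cls_def mod_simps)
lemma cls_cls_diff [simp]: "cls n (cls n x - y) = cls n (x - y)" by (simp add: cls_def mod_simps)

lemma cls_mod: "cls n (x mod int N) = cls n x"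
proof -
  have "int N = (int n + 1) * int L" by (simp add: N_def algebra_simps)
  then have "(int n + 1) dvd int N" by simp
  then show ?thesis unfolding cls_def by (rule mod_mod_cancel)
qed

lemma cls_mod_diff: "cls n (x mod int N - y) = cls n (x - y)"
  by (metis cls_cls_diff cls_mod)

lemma cls_index: "i \<in> index_set n \<longleftrightarrow> cls n i = i"
proof
  assume "i \<in> index_set n" then show "cls n i = i" by (simp add: index_set_def cls_def)
next
  assume "cls n i = i"
  moreover have "0 \<le> cls n i" "cls n i < int n + 1"
    unfolding cls_def by (rule pos_mod_sign, simp) (rule pos_mod_bound, simp)
  ultimately show "i \<in> index_set n" by (simp add: index_set_def)
qed

lemma cls_in_index [simp]: "cls n i \<in> index_set n" by (simp add: cls_index)

lemma cls_shift: "cls n (x + d) = cls n (y + d) \<longleftrightarrow> cls n x = cls n y"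
  by (auto simp: cls_eq_iff)

lemma cls_ne: assumes "0 < d" "d \<le> int n" shows "cls n (x + d) \<noteq> cls n x"
proof
  assume "cls n (x + d) = cls n x"
  then have "int n + 1 dvd d" by (auto simp: cls_eq_iff)
  then show False using assms zdvd_imp_le by fastforce
qed

lemma cartan_cls [simp]: "cartan n (cls n i) j = cartan n i j" "cartan n i (cls n j) = cartan n i j"
  by (simp_all add: cartan_def)

lemma cls_succ_iff: "cls n i = cls n (j + 1) \<longleftrightarrow> cls n j = cls n (i - 1)"
  "cls n i = cls n (j - 1) \<longleftrightarrow> cls n j = cls n (i + 1)"
  using cls_shift[of i "-1" "j + 1"] cls_shift[of i 1 "j - 1"] by auto

lemma cartan_sym: "cartan n i j = cartan n j i"
  unfolding cartan_def using cls_succ_iff[of i j] by auto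

lemma cartan_cases:
  obtains (same) "cls n i = cls n j" "cartan n i j = 2"
  | (succ) "cls n i = cls n (j + 1)" "cartan n i j = -1"
  | (pred) "cls n i = cls n (j - 1)" "cartan n i j = -1"
  | (far) "cls n i \<noteq> cls n j" "cls n i \<noteq> cls n (j + 1)" "cls n i \<noteq> cls n (j - 1)" "cartan n i j = 0"
proof -
  have "cls n (j + 1) \<noteq> cls n j" "cls n (j - 1) \<noteq> cls n j"
    using cls_ne[of 1 j] cls_ne[of 1 "j - 1"] n2 by auto
  then show ?thesis using that unfolding cartan_def by metis
qed

text \<open>The two hypotheses on the ratios in the form in which all later arguments use them: an
  equality would make \<open>a\<^sub>u / a\<^sub>v\<close> the product of \<open>\<epsilon>\<^sup>-\<^sup>d\<close> and a power of \<open>\<epsilon>\<^sup>n\<^sup>+\<^sup>1\<close>.\<close>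

lemma pt_ne:
  assumes uv: "u < k" "v < k" "u \<noteq> v" and d: "d \<in> {0, 2, -2}" and c: "cls n x = cls n (y + d)"
  shows "pt u x \<noteq> pt v y"
proof
  assume eq: "pt u x = pt v y"
  obtain z where z: "x = y + d + (int n + 1) * z" using c cls_eq_iff by blast
  \<comment> \<open>the power of \<open>\<epsilon>\<^sup>n\<^sup>+\<^sup>1\<close> has an exponent below \<open>L\<close> because \<open>\<epsilon>\<close> has order \<open>(n + 1) L\<close>\<close>
  define l where "l = nat ((- z) mod int L)"
  have l: "l < L" "int l = (- z) mod int L" using L1 by (auto simp: l_def nat_less_iff)
  have "int ((n + 1) * l) = (int n + 1) * ((- z) mod int L)" by (simp add: l algebra_simps)
  also have "\<dots> = ((int n + 1) * (- z)) mod ((int n + 1) * int L)" by (rule mult_mod_right)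
  also have "(int n + 1) * int L = int N" by (simp add: N_def algebra_simps)
  finally have "(- d + int ((n + 1) * l)) mod int N = (- d + (int n + 1) * (- z)) mod int N"
    by (simp only: mod_add_right_eq)
  also have "- d + (int n + 1) * (- z) = y - x" unfolding z by simp
  finally have "(- d + int ((n + 1) * l)) mod int N = (y - x) mod int N" .
  then have pw: "e powi (y - x) = e powi (- d + int ((n + 1) * l))"
    using e_powi_eq_iff by simp
  have "a u / a v = e powi (y - x)"
    using eq a_nonzero[OF uv(1)] a_nonzero[OF uv(2)] by (simp add: pt_def power_int_diff field_simps)
  then have r: "a u / a v = e powi (- d + int ((n + 1) * l))" using pw by simp
  show False
  proof (cases "d = 0")
    case True
    then have "a u / a v = exp \<tau> ^ ((n + 1) * l)" using r by (simp only: e_def minus_zero add_0 power_int_of_nat)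
    then show False using ratio_ne[OF uv] l by blast
  next
    case False
    then obtain s where s: "s \<in> {1, -1}" "- d = s * 2" using d by auto
    have "a u / a v = exp \<tau> powi (s * 2 + int ((n + 1) * l))" using r s(2) by (simp only: e_def)
    then show False using ratio_ne_shifted[OF uv] s(1) l(1) by blast
  qed
qed

section \<open>How one step changes the eigenvalue of a Cartan current\<close>

text \<open>The operator of sign \<open>s\<close> across the edge \<open>m\<close> moves the entry from \<open>src s m\<close> to \<open>tgt s m\<close>,
  up to multiples of \<open>N\<close>.\<close>

definition src :: "int \<Rightarrow> int \<Rightarrow> int" where "src s m = (if s = 1 then m + 1 else m)"
definition tgt :: "int \<Rightarrow> int \<Rightarrow> int" where "tgt s m = (if s = 1 then m else m + 1)"

text \<open>The rational function of the basis vector \<open>j\<close> of factor \<open>t\<close>, decomposed into partial fractions,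
  with \<open>G p\<close> in place of \<open>1 / (1 - p z)\<close>.  Its two nontrivial cases belong to the two edges
  at \<open>j\<close>.  The parameter \<open>G\<close> will be the expansion at 0, the expansion at infinity, or the constant
  series of a numerical value.\<close>

definition box_series :: "(complex \<Rightarrow> complex fps) \<Rightarrow> nat \<Rightarrow> int \<Rightarrow> int \<Rightarrow> complex fps"
  where "box_series G t i j =
    (if cls n i = cls n j then fps_const (1 / e) + fps_const (e - 1 / e) * G (pt t j)
     else if cls n i = cls n (j - 1) then fps_const e + fps_const (1 / e - e) * G (pt t (j - 1))
     else 1)"

lemma box_series_mod: "box_series G t i (j mod int N) = box_series G t i j"
proof -
  have "pt t (j mod int N - 1) = pt t (j - 1)"
    using pt_add[of t "j mod int N" "-1"] pt_add[of t j "-1"] pt_mod[of t j] by simp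
  then show ?thesis by (simp add: box_series_def cls_mod cls_mod_diff pt_mod)
qed

text \<open>Writing the argument as \<open>z = Z / Y\<close> treats the expansions in \<open>z\<close> and in its inverse
  alike.\<close>

lemma box_series_step_plus:
  fixes Y Z :: "complex fps"
  assumes G: "\<And>x. x \<in> {m - 1, m, m + 1} \<Longrightarrow> cls n x = cls n i \<Longrightarrow>
      (Y - fps_const (pt t x) * Z) * G (pt t x) = Y"
    and q: "q = e powi (cartan n i m)"
  shows "(Y - fps_const (q * pt t m) * Z) * box_series G t i m
       = (fps_const q * Y - fps_const (pt t m) * Z) * box_series G t i (m + 1)"
proof -
  define E where "E = fps_const e"
  define F where "F = fps_const (1 / e)"
  define c where "c = fps_const (pt t m)"
  have EF: "E * F = 1" by (simp add: E_def F_def)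
  have cE: "fps_const (pt t (m + 1)) = c * E" "fps_const (pt t (m - 1)) = c * F"
    using pt_add[of t m 1] pt_add[of t m "-1"] by (simp_all add: c_def E_def F_def mult.commute field_simps)
  have ne: "cls n (m + 1) \<noteq> cls n m" "cls n (m - 1) \<noteq> cls n m" "cls n (m + 1) \<noteq> cls n (m - 1)"
    using cls_ne[of 1 m] cls_ne[of 1 "m - 1"] cls_ne[of 2 "m - 1"] n2 by (auto simp: add.commute)
  show ?thesis
  proof (cases rule: cartan_cases[of i m])
    case same
    have "fps_const q = E * E" "fps_const (q * pt t m) = E * E * c"
      using same by (simp_all add: q E_def c_def power2_eq_square)
    moreover have "box_series G t i m = F + (E - F) * G (pt t m)"
      "box_series G t i (m + 1) = E + (F - E) * G (pt t m)"
      using same ne by (simp_all add: box_series_def E_def F_def)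
    moreover define g where "g = G (pt t m)"
    have "(Y - c * Z) * g = Y" using G[of m] same by (simp add: g_def c_def)
    have "(Y - E * E * c * Z) * (F + (E - F) * g) = (E * E * Y - c * Z) * (E + (F - E) * g)"
      by (rule step_algebra_same[OF EF]) fact
    ultimately show ?thesis by (simp only: g_def c_def)
  next
    case succ
    have "fps_const q = F" "fps_const (q * pt t m) = F * c"
      using succ by (simp_all add: q F_def c_def inverse_eq_divide)
    moreover define g where "g = G (pt t (m + 1))"
    have "box_series G t i m = 1" "box_series G t i (m + 1) = F + (E - F) * g"
      using succ ne by (simp_all add: box_series_def E_def F_def g_def)
    moreover have g: "(Y - c * E * Z) * g = Y" using G[of "m + 1"] succ by (simp add: g_def cE)
    have "(Y - F * c * Z) * 1 = (F * Y - c * Z) * (F + (E - F) * g)"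
      by (rule step_algebra_succ[OF EF]) fact
    ultimately show ?thesis by (simp only: c_def)
  next
    case pred
    have "fps_const q = F" "fps_const (q * pt t m) = F * c"
      using pred by (simp_all add: q F_def c_def inverse_eq_divide)
    moreover define g where "g = G (pt t (m - 1))"
    have "box_series G t i m = E + (F - E) * g" "box_series G t i (m + 1) = 1"
      using pred ne by (simp_all add: box_series_def E_def F_def g_def)
    moreover have g: "(Y - c * F * Z) * g = Y" using G[of "m - 1"] pred by (simp add: g_def cE)
    have "(Y - F * c * Z) * (E + (F - E) * g) = (F * Y - c * Z) * 1"
      by (rule step_algebra_pred[OF EF]) fact
    ultimately show ?thesis by (simp only: c_def)
  next
    case far
    then show ?thesis by (simp add: q box_series_def)
  qed
qed

text \<open>The sign -1 exchanges source and target and inverts \<open>q\<close>, so both signs state the same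
  equation.\<close>

lemma box_series_step:
  fixes Y Z :: "complex fps"
  assumes G: "\<And>x. cls n x = cls n i \<Longrightarrow> (Y - fps_const (pt t x) * Z) * G (pt t x) = Y"
    and s: "s \<in> {1, -1}" and q: "q = e powi (s * cartan n i m)"
  shows "(Y - fps_const (q * pt t m) * Z) * box_series G t i (tgt s m)
       = (fps_const q * Y - fps_const (pt t m) * Z) * box_series G t i (src s m)"
proof (cases "s = 1")
  case True
  then show ?thesis using box_series_step_plus[where G = G and Y = Y and Z = Z and t = t, OF G q[unfolded True mult_1]]
    by (simp add: src_def tgt_def)
next
  case False
  then have s: "s = -1" using s by auto
  define q' where "q' = e powi (cartan n i m)"
  have qq: "q * q' = 1" unfolding q q'_def s by (simp add: power_int_minus)
  define c where "c = fps_const (pt t m)"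
  have C: "fps_const q * fps_const q' = 1" by (simp add: qq)
  have "(Y - fps_const (q' * pt t m) * Z) * box_series G t i m
      = (fps_const q' * Y - fps_const (pt t m) * Z) * box_series G t i (m + 1)"
    by (rule box_series_step_plus[OF G q'_def])
  then have "fps_const q * ((Y - fps_const q' * c * Z) * box_series G t i m)
      = fps_const q * ((fps_const q' * Y - c * Z) * box_series G t i (m + 1))"
    by (simp add: c_def)
  then have "(fps_const q * Y - (fps_const q * fps_const q') * c * Z) * box_series G t i m
      = ((fps_const q * fps_const q') * Y - fps_const q * c * Z) * box_series G t i (m + 1)"
    by (simp only: algebra_simps)
  then have "(fps_const q * Y - c * Z) * box_series G t i m = (Y - fps_const q * c * Z) * box_series G t i (m + 1)"
    by (simp only: C mult_1)
  then show ?thesis using s by (simp add: src_def tgt_def c_def)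
qed

subsection \<open>Values of the rational functions\<close>

abbreviation ev :: "nat \<Rightarrow> int \<Rightarrow> int \<Rightarrow> complex \<Rightarrow> complex"
  where "ev t i j z \<equiv> box_phi n \<tau> (a t) i j z"

text \<open>Also in the second case, where the definition has an inverse, the formula needs no condition
  on \<open>z\<close>: with \<open>x / 0 = 0\<close>, the inverse of a quotient is always the reversed quotient.\<close>

lemma ev_eq:
  "i \<in> index_set n \<Longrightarrow> ev t i j z =
    (if cls n i = cls n j then (e - 1 / e * (pt t j * z)) / (1 - pt t j * z)
     else if cls n i = cls n (j - 1) then (1 / e - e * (pt t (j - 1) * z)) / (1 - pt t (j - 1) * z)
     else 1)"
proof -
  assume i: "i \<in> index_set n"
  have i': "cls n i = i" using i cls_index by blast
  have p: "a t * e powi (j + 1) = e^2 * pt t (j - 1)"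
    using pt_add[of t "j - 1" 2] by (simp add: pt_def algebra_simps)
  have "inverse (psi \<tau> (a t * qpow \<tau> (of_int (j + 1)) * z))
     = (1 / e - e * (pt t (j - 1) * z)) / (1 - pt t (j - 1) * z)"
    unfolding qpow_of_int p psi_def qpow_1 qpow_m1 inverse_divide
  proof -
    have "e - 1 / e * (e\<^sup>2 * pt t (j - 1) * z) = e * (1 - pt t (j - 1) * z)"
      "1 - e\<^sup>2 * pt t (j - 1) * z = e * (1 / e - e * (pt t (j - 1) * z))"
      by (simp_all add: field_simps power2_eq_square)
    then show "(1 - e\<^sup>2 * pt t (j - 1) * z) / (e - 1 / e * (e\<^sup>2 * pt t (j - 1) * z)) =
      (1 / e - e * (pt t (j - 1) * z)) / (1 - pt t (j - 1) * z)" by simp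
  qed
  then show ?thesis using i' unfolding box_phi_def psi_def qpow_of_int pt_def by (auto simp: mult.assoc)
qed

lemma ev_mod: "i \<in> index_set n \<Longrightarrow> ev t i (j mod int N) z = ev t i j z"
proof -
  have "pt t (j mod int N - 1) = pt t (j - 1)"
    using pt_add[of t "j mod int N" "-1"] pt_add[of t j "-1"] pt_mod[of t j] by simp
  then show "i \<in> index_set n \<Longrightarrow> ?thesis" by (simp add: ev_eq cls_mod cls_mod_diff pt_mod)
qed

lemma box_series_value:
  assumes "i \<in> index_set n" "\<And>x. cls n x = cls n i \<Longrightarrow> pt t x * z \<noteq> 1"
  shows "box_series (\<lambda>p. fps_const (1 / (1 - p * z))) t i j = fps_const (ev t i j z)"
proof -
  have "1 / e + (e - 1 / e) * (1 / (1 - x)) = (e - 1 / e * x) / (1 - x)"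
    "e + (1 / e - e) * (1 / (1 - x)) = (1 / e - e * x) / (1 - x)" if "x \<noteq> 1" for x
    using that by (simp_all add: field_simps)
  then show ?thesis using assms unfolding ev_eq[OF assms(1)]
    by (auto simp: box_series_def simp del: fps_const_sub)
qed

text \<open>The numerical form of \<open>box_series_step\<close>, at the inverse of the point of an edge in another
  factor; there the function has no pole.\<close>

lemma ev_step:
  assumes t: "t < k" "v < k" "t \<noteq> v" and s: "s \<in> {1, -1}" and q: "q = e powi (s * cartan n y m)"
  shows "(pt v y - q * pt t m) * ev t (cls n y) (tgt s m) (inverse (pt v y))
       = (q * pt v y - pt t m) * ev t (cls n y) (src s m) (inverse (pt v y))"
proof -
  define d where "d = pt v y"
  have d: "d \<noteq> 0" using pt_nz t by (simp add: d_def)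
  define z where "z = inverse d"
  have nz: "pt t x * z \<noteq> 1" if "cls n x = cls n (cls n y)" for x
    using pt_ne[of t v 0 x y] t that d by (simp add: z_def d_def field_simps)
  let ?G = "\<lambda>p. fps_const (1 / (1 - p * z))"
  have "(1 - fps_const (q * pt t m) * fps_const z) * box_series ?G t (cls n y) (tgt s m)
       = (fps_const q * 1 - fps_const (pt t m) * fps_const z) * box_series ?G t (cls n y) (src s m)"
  proof (rule box_series_step[OF _ s])
    show "q = e powi (s * cartan n (cls n y) m)" using q by simp
    fix x assume "cls n x = cls n (cls n y)"
    from nz[OF this] have "(1 - pt t x * z) * (1 / (1 - pt t x * z)) = 1" by simp
    then show "(1 - fps_const (pt t x) * fps_const z) * fps_const (1 / (1 - pt t x * z)) = 1"
      by (simp del: fps_const_sub add: fps_const_sub flip: fps_const_1_eq_1)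
  qed
  moreover have "box_series ?G t (cls n y) j = fps_const (ev t (cls n y) j z)" for j
    by (rule box_series_value[OF cls_in_index]) (rule nz)
  ultimately have "fps_const ((1 - q * pt t m * z) * ev t (cls n y) (tgt s m) z)
      = fps_const ((q - pt t m * z) * ev t (cls n y) (src s m) z)"
    by (simp del: fps_const_sub add: fps_const_sub flip: fps_const_1_eq_1)
  then have "(1 - q * pt t m * z) * ev t (cls n y) (tgt s m) z
      = (q - pt t m * z) * ev t (cls n y) (src s m) z" by simp
  then have "d * (1 - q * pt t m * z) * ev t (cls n y) (tgt s m) z
      = d * (q - pt t m * z) * ev t (cls n y) (src s m) z" by simp
  moreover have "d * (1 - q * pt t m * z) = d - q * pt t m" "d * (q - pt t m * z) = q * d - pt t m"
    using d by (simp_all add: z_def field_simps)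
  ultimately show ?thesis by (simp only: d_def z_def)
qed

text \<open>When \<open>i\<close> is neither equal nor adjacent to the class of the edge, \<open>ev_step\<close> gives nothing if the
  two points coincide; but for such \<open>i\<close> both functions are constant.\<close>

lemma ev_far:
  assumes "cartan n i m = 0"
  shows "ev t (cls n i) (tgt s m) z = ev t (cls n i) (src s m) z"
proof -
  have "ev t (cls n i) m z = 1" "ev t (cls n i) (m + 1) z = 1"
    using assms by (cases rule: cartan_cases[of i m]; simp add: ev_eq)+
  then show ?thesis by (simp add: src_def tgt_def)
qed

lemma ev_nz:
  assumes t: "t < k" "v < k" "t \<noteq> v"
  shows "ev t (cls n y) j (inverse (pt v y)) \<noteq> 0"
proof -
  define d where "d = pt v y"
  have d: "d \<noteq> 0" using pt_nz t by (simp add: d_def)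
  have 1: "pt t x \<noteq> d" "e * e * d \<noteq> pt t x" "d \<noteq> e * e * pt t x" if "cls n x = cls n y" for x
  proof -
    show "pt t x \<noteq> d" using pt_ne[of t v 0 x y] t that by (simp add: d_def)
    show "e * e * d \<noteq> pt t x"
      using pt_ne[of t v "-2" x "y + 2"] t that pt_add[of v y 2] by (auto simp: d_def power2_eq_square)
    show "d \<noteq> e * e * pt t x"
      using pt_ne[of t v 2 "x + 2" y] t that pt_add[of t x 2] cls_shift[of x 2 y]
      by (auto simp: d_def power2_eq_square)
  qed
  have "(e - 1 / e * (pt t x * inverse d)) / (1 - pt t x * inverse d) \<noteq> 0"
    "(1 / e - e * (pt t x * inverse d)) / (1 - pt t x * inverse d) \<noteq> 0" if "cls n x = cls n y" for x
    using 1[OF that] d by (auto simp: field_simps)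
  then show ?thesis unfolding ev_eq[OF cls_in_index] d_def[symmetric] by auto
qed

lemma ev_not_pole:
  assumes t: "t < k" "v < k" "t \<noteq> v"
  shows "\<not> is_pole (box_phi n \<tau> (a t) (cls n y) j) (inverse (pt v y))"
proof -
  define z where "z = inverse (pt v y)"
  have nz: "pt t x * z \<noteq> 1" if "cls n x = cls n y" for x
    using pt_ne[of t v 0 x y] t that pt_nz[of v y] by (simp add: z_def field_simps)
  have f: "box_phi n \<tau> (a t) (cls n y) j = (\<lambda>z.
    if cls n y = cls n j then (e - 1 / e * (pt t j * z)) / (1 - pt t j * z)
     else if cls n y = cls n (j - 1) then (1 / e - e * (pt t (j - 1) * z)) / (1 - pt t (j - 1) * z)
     else 1)"
    by (rule ext) (subst ev_eq; simp)
  have cont: "isCont (\<lambda>z. (e - 1 / e * (p * z)) / (1 - p * z)) z"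
    "isCont (\<lambda>z. (1 / e - e * (p * z)) / (1 - p * z)) z" if "p * z \<noteq> 1" for p
    using that by (auto intro!: continuous_intros)
  have "isCont (box_phi n \<tau> (a t) (cls n y) j) z"
  proof -
    consider "cls n y = cls n j" | "cls n y \<noteq> cls n j" "cls n y = cls n (j - 1)"
      | "cls n y \<noteq> cls n j" "cls n y \<noteq> cls n (j - 1)" by blast
    then show ?thesis
      unfolding f by cases (simp_all add: cont nz del: mult_cancel_right mult_cancel_left)
  qed
  then have "box_phi n \<tau> (a t) (cls n y) j \<midarrow>z\<rightarrow> box_phi n \<tau> (a t) (cls n y) j z" by (rule isContD)
  then show ?thesis unfolding z_def[symmetric] is_pole_def
    by (meson at_neq_bot not_tendsto_and_filterlim_at_infinity)
qed

section \<open>Edge operators and their exchange relations\<close>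

definition move_coeff :: "int \<Rightarrow> nat \<Rightarrow> int \<Rightarrow> int list \<Rightarrow> complex"
  where "move_coeff s u m js = (\<Prod>t\<in>other_factors k s u. ev t (cls n m) (js ! t) (inverse (pt u m)))"

text \<open>The operators act on coefficient functions.  The coefficient of a tensor after the move is read
  off at the tensor before the move, so the target is tested and the source is substituted.  The
  factor \<open>move_coeff\<close> does not depend on the entry \<open>u\<close>, so it may be evaluated before or after.\<close>

definition move :: "int \<Rightarrow> nat \<Rightarrow> int \<Rightarrow> (int list \<Rightarrow> complex) \<Rightarrow> int list \<Rightarrow> complex"
  where "move s u m w js = (if js ! u = tgt s m mod int N
    then move_coeff s u m js * w (js[u := src s m mod int N]) else 0)"

lemma other_factors_cases: "u < k \<Longrightarrow> t \<in> other_factors k s u \<Longrightarrow> t < k \<and> t \<noteq> u"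
  by (auto simp: other_factors_def split: if_splits)

lemma move_coeff_nz: "u < k \<Longrightarrow> move_coeff s u m js \<noteq> 0"
proof -
  assume u: "u < k"
  have fin: "finite (other_factors k s u)" by (simp add: other_factors_def)
  show "move_coeff s u m js \<noteq> 0"
    unfolding move_coeff_def prod_zero_iff[OF fin]
  proof
    assume "\<exists>t\<in>other_factors k s u. ev t (cls n m) (js ! t) (inverse (pt u m)) = 0"
    then obtain t where t: "t \<in> other_factors k s u"
      and z: "ev t (cls n m) (js ! t) (inverse (pt u m)) = 0" by blast
    from other_factors_cases[OF u t] have "t < k" "t \<noteq> u" by auto
    from ev_nz[OF this(1) u this(2)] z show False by simp
  qed
qed

lemma move_coeff_update_same: "t \<notin> other_factors k s u \<Longrightarrow> move_coeff s u m (js[t := x]) = move_coeff s u m js"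
  unfolding move_coeff_def by (intro prod.cong refl) (metis nth_list_update_neq)

lemma move_coeff_split:
  assumes "t \<in> other_factors k s u"
  shows "move_coeff s u m js = ev t (cls n m) (js ! t) (inverse (pt u m)) *
    (\<Prod>t\<in>other_factors k s u - {t}. ev t (cls n m) (js ! t) (inverse (pt u m)))"
proof -
  have "finite (other_factors k s u)" by (simp add: other_factors_def)
  then show ?thesis unfolding move_coeff_def using assms by (rule prod.remove)
qed

lemma move_coeff_update:
  assumes "t \<in> other_factors k s u" "u < k" "length js = k"
  shows "move_coeff s u m (js[t := x]) = ev t (cls n m) x (inverse (pt u m)) *
    (\<Prod>t\<in>other_factors k s u - {t}. ev t (cls n m) (js ! t) (inverse (pt u m)))"
proof -
  have "t < k" using assms other_factors_cases by blast
  then show ?thesis using assms(3) by (subst move_coeff_split[OF assms(1)]) (auto intro!: prod.cong)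
qed

text \<open>Moving the entry of a factor \<open>t\<close> that contributes to the coefficient of factor \<open>u\<close> multiplies
  this coefficient by a ratio of two linear forms in the points.\<close>

lemma move_coeff_step:
  assumes t: "t \<in> other_factors k s u" "u < k" "length js = k" "s' \<in> {1, -1}"
    and js: "js ! t = tgt s' m' mod int N" and q: "q = e powi (s' * cartan n m m')"
  shows "(pt u m - q * pt t m') * move_coeff s u m js
       = (q * pt u m - pt t m') * move_coeff s u m (js[t := src s' m' mod int N])"
proof -
  have tu: "t < k" "t \<noteq> u" using other_factors_cases t by auto
  show ?thesis
    unfolding move_coeff_update[OF t(1-3)]
    by (subst move_coeff_split[OF t(1)])
      (simp only: js ev_mod[OF cls_in_index] ev_step[OF tu(1) t(2) tu(2) t(4) q] mult.assoc[symmetric])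
qed

lemma move_coeff_far:
  assumes t: "t \<in> other_factors k s u" "u < k" "length js = k" "cartan n m m' = 0"
    and js: "js ! t = tgt s' m' mod int N"
  shows "move_coeff s u m js = move_coeff s u m (js[t := src s' m' mod int N])"
  unfolding move_coeff_update[OF t(1-3)]
  by (subst move_coeff_split[OF t(1)]) (simp only: js ev_mod[OF cls_in_index] ev_far[OF t(4)])

lemma other_factors_total: "u < k \<Longrightarrow> v < k \<Longrightarrow> u \<noteq> v \<Longrightarrow>
    (u \<in> other_factors k s v \<and> v \<notin> other_factors k s u)
    \<or> (v \<in> other_factors k s u \<and> u \<notin> other_factors k s v)"
  by (auto simp: other_factors_def)

lemma move_move:
  assumes "length js = k" "u < k" "v < k" "u \<noteq> v"
  shows "move s v m' (move s' u m w) js =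
    (if js ! v = tgt s m' mod int N \<and> js ! u = tgt s' m mod int N
     then move_coeff s v m' js * move_coeff s' u m (js[v := src s m' mod int N]) *
       w (js[v := src s m' mod int N, u := src s' m mod int N]) else 0)"
  using assms by (auto simp: move_def)

text \<open>Two operators of the same sign can be applied in succession to one factor only across
  consecutive edges, whose points differ by exactly the power of \<open>\<epsilon>\<close> that annihilates the coefficient
  in the exchange relation.\<close>

lemma same_site:
  assumes "src s m' mod int N = tgt s m mod int N" "s \<in> {1, -1}"
  shows "cartan n m m' = -1" "pt u m' = e powi (s * cartan n m m') * pt u m"
proof -
  have 1: "cls n (src s m') = cls n (tgt s m)" "pt u (src s m') = pt u (tgt s m)"
    using assms(1) cls_mod pt_mod by metis+
  have ne: "cls n (x + 1) \<noteq> cls n x" for x using cls_ne[of 1 x] n2 by simp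
  from assms(2) consider "s = 1" "cls n (m' + 1) = cls n m" "pt u (m' + 1) = pt u m"
    | "s = -1" "cls n m' = cls n (m + 1)" "pt u m' = pt u (m + 1)"
    using 1 by (auto simp: src_def tgt_def)
  then have "cartan n m m' = -1 \<and> pt u m' = e powi (s * cartan n m m') * pt u m"
  proof cases
    case 1
    have "cartan n m m' = -1" using 1 ne[of m'] by (auto simp: cartan_def)
    moreover have "e * pt u m' = pt u m" using 1 pt_add[of u m' 1] by simp
    ultimately show ?thesis using 1 by (auto simp: field_simps)
  next
    case 2
    have "cartan n m' m = -1" using 2 ne[of m] by (auto simp: cartan_def)
    moreover have "e * pt u m = pt u m'" using 2 pt_add[of u m 1] by simp
    ultimately show ?thesis using 2 by (simp add: cartan_sym)
  qed
  then show "cartan n m m' = -1" "pt u m' = e powi (s * cartan n m m') * pt u m" by auto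
qed

text \<open>For different factors exactly one of the two moves changes the coefficient of the other, by
  \<open>move_coeff_step\<close>.  For equal factors both sides vanish, by \<open>same_site\<close>.\<close>

lemma move_exchange:
  assumes js: "length js = k" and u: "u < k" "v < k" and s: "s \<in> {1, -1}"
    and q: "q = e powi (s * cartan n m m')"
  shows "(pt v m' - q * pt u m) * move s v m' (move s u m w) js
       = (q * pt v m' - pt u m) * move s u m (move s v m' w) js"
proof (cases "u = v")
  case True
  have "(pt v m' - q * pt u m) * move s v m' (move s u m w) js = 0"
  proof (cases "src s m' mod int N = tgt s m mod int N")
    case eq: True
    then show ?thesis using same_site(2)[OF eq s, of u] True q by simp
  next
    case False
    then show ?thesis using True js u by (simp add: move_def)
  qed
  moreover have "(q * pt v m' - pt u m) * move s u m (move s v m' w) js = 0"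
  proof (cases "src s m mod int N = tgt s m' mod int N")
    case eq: True
    then show ?thesis using same_site(2)[OF eq s, of u] True q cartan_sym[of m m'] by simp
  next
    case False
    then show ?thesis using True js u by (simp add: move_def)
  qed
  ultimately show ?thesis by (simp only:)
next
  case False
  let ?jv = "js[v := src s m' mod int N]" and ?ju = "js[u := src s m mod int N]"
  let ?P = "js ! v = tgt s m' mod int N \<and> js ! u = tgt s m mod int N"
  have sw: "?jv[u := src s m mod int N] = ?ju[v := src s m' mod int N]"
    using False by (simp add: list_update_swap)
  have "(pt v m' - q * pt u m) * (move_coeff s v m' js * move_coeff s u m ?jv)
      = (q * pt v m' - pt u m) * (move_coeff s u m js * move_coeff s v m' ?ju)" if P: ?P
    using other_factors_total[OF u False, of s]
  proof
    assume o: "u \<in> other_factors k s v \<and> v \<notin> other_factors k s u"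
    have "(pt v m' - q * pt u m) * move_coeff s v m' js = (q * pt v m' - pt u m) * move_coeff s v m' ?ju"
      by (rule move_coeff_step) (use o u js s P q cartan_sym[of m m'] in auto)
    moreover have "move_coeff s u m ?jv = move_coeff s u m js" using o by (simp add: move_coeff_update_same)
    ultimately show ?thesis by simp
  next
    assume o: "v \<in> other_factors k s u \<and> u \<notin> other_factors k s v"
    have "(pt u m - q * pt v m') * move_coeff s u m js = (q * pt u m - pt v m') * move_coeff s u m ?jv"
      by (rule move_coeff_step) (use o u js s P q in auto)
    moreover have "move_coeff s v m' ?ju = move_coeff s v m' js" using o by (simp add: move_coeff_update_same)
    moreover have "pt v m' - q * pt u m = - (q * pt u m - pt v m')"
      "q * pt v m' - pt u m = - (pt u m - q * pt v m')" by simp_all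
    ultimately show ?thesis by (simp only: mult_minus_left mult.assoc[symmetric]) (simp only: ac_simps)
  qed
  then show ?thesis using u False js by (auto simp: move_move sw)
qed

lemma move_commute:
  assumes js: "length js = k" and u: "u < k" "v < k" and s: "s \<in> {1, -1}"
    and c: "cartan n m m' = 0"
  shows "move s v m' (move s u m w) js = move s u m (move s v m' w) js"
proof (cases "u = v")
  case True
  have "src s m' mod int N \<noteq> tgt s m mod int N" "src s m mod int N \<noteq> tgt s m' mod int N"
    using same_site(1)[of s m' m] same_site(1)[of s m m'] s c cartan_sym[of m m'] by auto
  then show ?thesis using True js u by (simp add: move_def)
next
  case False
  let ?jv = "js[v := src s m' mod int N]" and ?ju = "js[u := src s m mod int N]"
  let ?P = "js ! v = tgt s m' mod int N \<and> js ! u = tgt s m mod int N"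
  have sw: "?jv[u := src s m mod int N] = ?ju[v := src s m' mod int N]"
    using False by (simp add: list_update_swap)
  have "move_coeff s v m' js * move_coeff s u m ?jv = move_coeff s u m js * move_coeff s v m' ?ju" if P: ?P
    using other_factors_total[OF u False, of s]
  proof
    assume o: "u \<in> other_factors k s v \<and> v \<notin> other_factors k s u"
    have "move_coeff s v m' js = move_coeff s v m' ?ju"
      by (rule move_coeff_far) (use o u js P c cartan_sym[of m m'] in auto)
    moreover have "move_coeff s u m ?jv = move_coeff s u m js" using o by (simp add: move_coeff_update_same)
    ultimately show ?thesis by simp
  next
    assume o: "v \<in> other_factors k s u \<and> u \<notin> other_factors k s v"
    have "move_coeff s u m js = move_coeff s u m ?jv"
      by (rule move_coeff_far) (use o u js P c in auto)
    moreover have "move_coeff s v m' ?ju = move_coeff s v m' js" using o by (simp add: move_coeff_update_same)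
    ultimately show ?thesis by simp
  qed
  then show ?thesis using u False js by (auto simp: move_move sw)
qed

lemma cartan_pt_ne:
  assumes u: "u < k" "v < k" "u \<noteq> v" and c: "cartan n m m' \<noteq> 0"
  shows "e powi (cartan n m m') * pt u m \<noteq> pt v m'"
proof (cases rule: cartan_cases[of m m'])
  case same
  then show ?thesis using pt_ne[of u v 2 "m + 2" m'] u pt_add[of u m 2] cls_shift[of m 2 m'] by simp
next
  case succ
  then show ?thesis using pt_ne[of u v 0 "m - 1" m'] u pt_add[of u m "-1"] cls_succ_iff(1)[of m m']
    by simp
next
  case pred
  then have "cls n (m - 1) = cls n (m' + -2)" using cls_shift[of m "-1" "m' - 1"] by simp
  then show ?thesis using pt_ne[of u v "-2" "m - 1" m'] u pt_add[of u m "-1"] pred by simp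
next
  case far
  then show ?thesis using c by simp
qed

text \<open>If the raising operator acts to the right of the lowering operator, each move changes the
  coefficient of the other, and the two ratios agree; in the other order neither does.\<close>

lemma move_mixed:
  assumes js: "length js = k" and u: "u < k" "v < k" "u \<noteq> v"
  shows "move 1 u m (move (-1) v m' w) js = move (-1) v m' (move 1 u m w) js"
proof -
  let ?jv = "js[v := src (-1) m' mod int N]" and ?ju = "js[u := src 1 m mod int N]"
  let ?P = "js ! v = tgt (-1) m' mod int N \<and> js ! u = tgt 1 m mod int N"
  have sw: "?jv[u := src 1 m mod int N] = ?ju[v := src (-1) m' mod int N]"
    using u by (simp add: list_update_swap)
  have "move_coeff (-1) v m' js * move_coeff 1 u m ?jv = move_coeff 1 u m js * move_coeff (-1) v m' ?ju" if P: ?P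
  proof (cases "v < u")
    case False
    then have "u \<notin> other_factors k (-1) v" "v \<notin> other_factors k 1 u" by (auto simp: other_factors_def)
    then show ?thesis by (simp add: move_coeff_update_same)
  next
    case True
    then have o: "u \<in> other_factors k (-1) v" "v \<in> other_factors k 1 u" using u by (auto simp: other_factors_def)
    show ?thesis
    proof (cases "cartan n m m' = 0")
      case c: True
      have "move_coeff (-1) v m' js = move_coeff (-1) v m' ?ju"
        by (rule move_coeff_far) (use o u js P c cartan_sym[of m m'] in auto)
      moreover have "move_coeff 1 u m js = move_coeff 1 u m ?jv"
        by (rule move_coeff_far) (use o u js P c in auto)
      ultimately show ?thesis by simp
    next
      case c: False
      define q where "q = e powi (cartan n m m')"
      define q' where "q' = e powi (- cartan n m m')"
      have qq: "q' = 1 / q" "q \<noteq> 0" by (auto simp: q_def q'_def power_int_minus field_simps)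
      have 1: "(pt v m' - q * pt u m) * move_coeff (-1) v m' js = (q * pt v m' - pt u m) * move_coeff (-1) v m' ?ju"
        by (rule move_coeff_step) (use o u js P q_def cartan_sym[of m m'] in auto)
      have 2: "(pt u m - q' * pt v m') * move_coeff 1 u m js = (q' * pt u m - pt v m') * move_coeff 1 u m ?jv"
        by (rule move_coeff_step) (use o u js P q'_def in auto)
      have ne: "pt v m' - q * pt u m \<noteq> 0" "q * pt v m' - pt u m \<noteq> 0"
        using cartan_pt_ne[OF u c] cartan_pt_ne[of v u m' m] u c cartan_sym[of m m']
        by (auto simp: q_def)
      define A B C D where "A = pt v m' - q * pt u m" "B = q * pt v m' - pt u m"
        "C = move_coeff (-1) v m' js" "D = move_coeff 1 u m js"
      have e1: "move_coeff (-1) v m' ?ju = A / B * C" using 1 ne by (simp add: A_B_C_D_def field_simps)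
      have "q * (pt u m - q' * pt v m') = - A" "q * (q' * pt u m - pt v m') = - B"
        using qq by (simp_all add: A_B_C_D_def algebra_simps)
      then have "- A * D = - B * move_coeff 1 u m ?jv"
        using arg_cong[OF 2, of "\<lambda>x. q * x"] unfolding mult.assoc[symmetric] by (simp add: A_B_C_D_def)
      then have e2: "move_coeff 1 u m ?jv = A / B * D" using ne by (simp add: A_B_C_D_def field_simps)
      show ?thesis unfolding e1 e2 by (simp add: A_B_C_D_def)
    qed
  qed
  then show ?thesis using u js by (auto simp: move_move sw)
qed

text \<open>The factors to the left and to the right of \<open>u\<close> together are all other factors.\<close>

lemma move_mixed_same_site:
  assumes js: "length js = k" and u: "u < k"
  shows "move 1 u m (move (-1) u m' w) js =
      (if m mod int N = m' mod int N \<and> js ! u = m mod int N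
       then (\<Prod>t\<in>{..<k}-{u}. ev t (cls n m) (js ! t) (inverse (pt u m))) * w js else 0)"
    and "move (-1) u m' (move 1 u m w) js =
      (if m mod int N = m' mod int N \<and> js ! u = (m + 1) mod int N
       then (\<Prod>t\<in>{..<k}-{u}. ev t (cls n m) (js ! t) (inverse (pt u m))) * w js else 0)"
proof -
  have un: "{..<k} - {u} = other_factors k 1 u \<union> other_factors k (-1) u"
    "other_factors k 1 u \<inter> other_factors k (-1) u = {}" "finite (other_factors k s u)" for s
    using u by (auto simp: other_factors_def)
  have P: "move_coeff 1 u m js * move_coeff (-1) u m js = (\<Prod>t\<in>{..<k}-{u}. ev t (cls n m) (js ! t) (inverse (pt u m)))"
    unfolding un(1) move_coeff_def by (subst prod.union_disjoint) (use un in auto)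
  have nu: "u \<notin> other_factors k s u" for s by (simp add: other_factors_def)
  have c: "move_coeff s u m' x = move_coeff s u m x" if "m mod int N = m' mod int N" for s x
  proof -
    have "pt u m' = pt u m" "cls n m' = cls n m" using that pt_mod[of u] cls_mod by metis+
    then show ?thesis by (simp add: move_coeff_def)
  qed
  have sh: "(m + 1) mod int N = (m' + 1) mod int N \<longleftrightarrow> m mod int N = m' mod int N"
    by (simp add: mod_eq_dvd_iff)
  have id: "js[u := x] = js" if "js ! u = x" for x using that by (metis list_update_id)
  show "move 1 u m (move (-1) u m' w) js =
      (if m mod int N = m' mod int N \<and> js ! u = m mod int N
       then (\<Prod>t\<in>{..<k}-{u}. ev t (cls n m) (js ! t) (inverse (pt u m))) * w js else 0)"
  proof -
    have "move 1 u m (move (-1) u m' w) js =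
      (if js ! u = m mod int N \<and> (m + 1) mod int N = (m' + 1) mod int N
       then move_coeff 1 u m js * (move_coeff (-1) u m' js * w (js[u := m' mod int N])) else 0)"
      using js u nu by (simp add: move_def src_def tgt_def move_coeff_update_same)
    also have "\<dots> = (if m mod int N = m' mod int N \<and> js ! u = m mod int N
       then move_coeff 1 u m js * move_coeff (-1) u m js * w js else 0)"
      unfolding sh using c[of "-1" js] id[of "m' mod int N"] by auto
    finally show ?thesis unfolding P .
  qed
  show "move (-1) u m' (move 1 u m w) js =
      (if m mod int N = m' mod int N \<and> js ! u = (m + 1) mod int N
       then (\<Prod>t\<in>{..<k}-{u}. ev t (cls n m) (js ! t) (inverse (pt u m))) * w js else 0)"
  proof -
    have "move (-1) u m' (move 1 u m w) js =
      (if js ! u = (m' + 1) mod int N \<and> m' mod int N = m mod int N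
       then move_coeff (-1) u m' js * (move_coeff 1 u m js * w (js[u := (m + 1) mod int N])) else 0)"
      using js u nu by (simp add: move_def src_def tgt_def move_coeff_update_same)
    also have "\<dots> = (if m mod int N = m' mod int N \<and> js ! u = (m + 1) mod int N
       then move_coeff 1 u m js * move_coeff (-1) u m js * w js else 0)"
    proof (cases "m mod int N = m' mod int N")
      case True
      then have "(m' + 1) mod int N = (m + 1) mod int N" using sh by metis
      then show ?thesis using True c[of "-1" js] id[of "(m + 1) mod int N"] by simp
    next
      case False
      then have "m' mod int N \<noteq> m mod int N" by metis
      then show ?thesis using False by (simp only: simp_thms if_False)
    qed
    finally show ?thesis unfolding P .
  qed
qed

section \<open>The eigenvalues of the Cartan currents\<close>

text \<open>The expansions of \<open>1 / (1 - p z)\<close> in powers of \<open>z\<close> (for \<open>\<sigma> = 1\<close>) and in powers of the inverse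
  of \<open>z\<close> (otherwise).  The second has no constant term.  In both cases the argument \<open>z\<close> is the
  quotient of \<open>denom \<sigma>\<close> by \<open>numer \<sigma>\<close>.\<close>

definition geom :: "int \<Rightarrow> complex \<Rightarrow> complex fps"
  where "geom \<sigma> p = Abs_fps (\<lambda>m. if \<sigma> = 1 then p ^ m else if m = 0 then 0 else - ((1 / p) ^ m))"

definition numer :: "int \<Rightarrow> complex fps" where "numer \<sigma> = (if \<sigma> = 1 then 1 else fps_X)"
definition denom :: "int \<Rightarrow> complex fps" where "denom \<sigma> = (if \<sigma> = 1 then fps_X else 1)"

lemma geom_eq:
  assumes "p \<noteq> 0"
  shows "(numer \<sigma> - fps_const p * denom \<sigma>) * geom \<sigma> p = numer \<sigma>"
proof (rule fps_ext)
  fix m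
  show "fps_nth ((numer \<sigma> - fps_const p * denom \<sigma>) * geom \<sigma> p) m = fps_nth (numer \<sigma>) m"
  proof (cases "\<sigma> = 1")
    case True
    then show ?thesis
      by (cases m) (simp_all add: numer_def denom_def left_diff_distrib mult.assoc geom_def)
  next
    case False
    have "m = 0 \<or> m = 1 \<or> (\<exists>l. m = Suc (Suc l))" by (metis One_nat_def not0_implies_Suc)
    then show ?thesis using False assms
      by (auto simp: numer_def denom_def left_diff_distrib geom_def)
  qed
qed

lemma numer_denom_nz: "p \<noteq> 0 \<Longrightarrow> numer \<sigma> - fps_const p * denom \<sigma> \<noteq> 0"
  using geom_eq[of p \<sigma>] by (auto simp: numer_def split: if_splits)

lemma geom_mult:
  assumes "p \<noteq> 0" "p' \<noteq> 0"
  shows "fps_const (p - p') * (geom \<sigma> p * geom \<sigma> p') = fps_const p * geom \<sigma> p - fps_const p' * geom \<sigma> p'"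
proof -
  define P Q g h Y Z A B where d: "P = fps_const p" "Q = fps_const p'" "g = geom \<sigma> p" "h = geom \<sigma> p'"
    "Y = numer \<sigma>" "Z = denom \<sigma>" "A = Y - P * Z" "B = Y - Q * Z"
  have A: "A * g = Y" "A \<noteq> 0" and B: "B * h = Y" "B \<noteq> 0"
    using geom_eq numer_denom_nz assms by (simp_all add: d)
  have "A * B * ((P - Q) * (g * h)) = (P - Q) * ((A * g) * (B * h))" by (simp only: ac_simps)
  also have "\<dots> = (P - Q) * (Y * Y)" by (simp only: A B)
  also have "\<dots> = P * Y * B - Q * Y * A"
    unfolding d(7,8) by (simp add: algebra_simps)
  also have "\<dots> = P * (A * g) * B - Q * (B * h) * A" by (simp only: A B)
  also have "\<dots> = A * B * (P * g - Q * h)" by (simp add: algebra_simps)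
  finally have "(P - Q) * (g * h) = P * g - Q * h"
    using mult_left_cancel[of "A * B"] A(2) B(2) by (metis mult_eq_0_iff)
  then show ?thesis by (simp add: d)
qed

definition phi_series :: "int \<Rightarrow> int \<Rightarrow> int list \<Rightarrow> complex fps"
  where "phi_series \<sigma> i js = (\<Prod>t<k. box_series (geom \<sigma>) t i (js ! t))"

text \<open>The coefficient of \<open>z\<^sup>m\<close> for any integer \<open>m\<close>.\<close>

definition phi_coeff :: "int \<Rightarrow> int \<Rightarrow> int list \<Rightarrow> int \<Rightarrow> complex"
  where "phi_coeff \<sigma> i js m = (if \<sigma> * m \<ge> 0 then fps_nth (phi_series \<sigma> i js) (nat (\<sigma> * m)) else 0)"

lemma phi_series_step:
  assumes js: "length js = k" "u < k" "js ! u = tgt s m mod int N"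
    and s: "s \<in> {1, -1}" and q: "q = e powi (s * cartan n i m)"
  shows "(numer \<sigma> - fps_const (q * pt u m) * denom \<sigma>) * phi_series \<sigma> i js
    = (fps_const q * numer \<sigma> - fps_const (pt u m) * denom \<sigma>) * phi_series \<sigma> i (js[u := src s m mod int N])"
proof -
  let ?js' = "js[u := src s m mod int N]"
  let ?R = "\<Prod>t\<in>{..<k} - {u}. box_series (geom \<sigma>) t i (js ! t)"
  have 1: "phi_series \<sigma> i js = box_series (geom \<sigma>) u i (tgt s m) * ?R"
    unfolding phi_series_def using js by (subst prod.remove[of _ u]) (auto simp: box_series_mod)
  have 2: "phi_series \<sigma> i ?js' = box_series (geom \<sigma>) u i (src s m) * ?R"
    unfolding phi_series_def using js by (subst prod.remove[of _ u]) (auto simp: box_series_mod intro!: prod.cong)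
  have "(numer \<sigma> - fps_const (q * pt u m) * denom \<sigma>) * box_series (geom \<sigma>) u i (tgt s m)
    = (fps_const q * numer \<sigma> - fps_const (pt u m) * denom \<sigma>) * box_series (geom \<sigma>) u i (src s m)"
    by (rule box_series_step[OF _ s q]) (rule geom_eq[OF pt_nz[OF js(2)]])
  then show ?thesis unfolding 1 2 by (simp only: mult.assoc[symmetric])
qed

lemma phi_coeff_step:
  assumes js: "length js = k" "u < k" "js ! u = tgt s m0 mod int N"
    and s: "s \<in> {1, -1}" "\<sigma> \<in> {1, -1}" and q: "q = e powi (s * cartan n i m0)"
  shows "phi_coeff \<sigma> i js m - q * pt u m0 * phi_coeff \<sigma> i js (m - 1)
    = q * phi_coeff \<sigma> i (js[u := src s m0 mod int N]) m
      - pt u m0 * phi_coeff \<sigma> i (js[u := src s m0 mod int N]) (m - 1)"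
proof -
  define f g c where d: "f = phi_series \<sigma> i js" "g = phi_series \<sigma> i (js[u := src s m0 mod int N])" "c = pt u m0"
  have eq: "fps_nth ((numer \<sigma> - fps_const (q * c) * denom \<sigma>) * f) l
      = fps_nth ((fps_const q * numer \<sigma> - fps_const c * denom \<sigma>) * g) l" for l
    using phi_series_step[OF js s(1) q] by (simp add: d)
  from s(2) consider "\<sigma> = 1" | "\<sigma> = -1" by auto
  then show ?thesis
  proof cases
    case 1
    have eq': "fps_nth f l - q * c * (if l = 0 then 0 else fps_nth f (l - 1))
      = q * fps_nth g l - c * (if l = 0 then 0 else fps_nth g (l - 1))" for l
      using eq[of l] 1 by (simp add: numer_def denom_def left_diff_distrib mult.assoc split: if_splits)
    consider "m < 0" | "m = 0" | l where "m = int (Suc l)"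
      by (metis linorder_cases zero_less_imp_eq_int gr0_conv_Suc)
    then show ?thesis
    proof cases
      case (3 l)
      then show ?thesis using eq'[of "Suc l"] 1 by (simp add: phi_coeff_def d nat_add_distrib)
    qed (use eq'[of 0] 1 in \<open>auto simp: phi_coeff_def d\<close>)
  next
    case 2
    have eq': "(if l = 0 then 0 else fps_nth f (l - 1)) - q * c * fps_nth f l
      = q * (if l = 0 then 0 else fps_nth g (l - 1)) - c * fps_nth g l" for l
      using eq[of l] 2 by (simp add: numer_def denom_def left_diff_distrib mult.assoc split: if_splits)
    \<comment> \<open>the coefficient of \<open>z\<^sup>m\<close> in the relation is that of degree \<open>1 - m\<close> in the inverse of \<open>z\<close>\<close>
    consider "m > 1" | "m = 1" | l where "m = - int l"
    proof -
      have "m > 1 \<or> m = 1 \<or> m = - int (nat (- m))" by linarith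
      then show thesis using that by blast
    qed
    then show ?thesis
    proof cases
      case (3 l)
      then have "nat (1 - m) = Suc l" "nat (- m) = l" by auto
      then show ?thesis using eq'[of "Suc l"] 2 3 by (simp add: phi_coeff_def d)
    qed (use eq'[of 0] 2 in \<open>auto simp: phi_coeff_def d\<close>)
  qed
qed

subsection \<open>The difference of the two expansions\<close>

text \<open>By partial fractions, each pole contributes a geometric series whose expansions at 0 and at
  infinity differ by a multiple of the delta function at the pole; the constant terms cancel.  The
  residue carries the product of the values of the other factors, which is the coefficient that the
  composition of two opposite moves produces.\<close>

lemma phi_coeff_diff:
  assumes i: "i \<in> index_set n" and js: "length js = k"
  shows "phi_coeff 1 i js M - phi_coeff (-1) i js M = (e - 1 / e) * (\<Sum>u<k.
     (if cls n (js ! u) = i then pt u (js ! u) powi M *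
        (\<Prod>t\<in>{..<k}-{u}. ev t i (js ! t) (inverse (pt u (js ! u)))) else 0)
   - (if cls n (js ! u - 1) = i then pt u (js ! u - 1) powi M *
        (\<Prod>t\<in>{..<k}-{u}. ev t i (js ! t) (inverse (pt u (js ! u - 1)))) else 0))"
proof -
  have ci: "cls n i = i" using i cls_index by blast
  \<comment> \<open>the factors in T have one simple pole each, and these poles are distinct\<close>
  define up where "up = (\<lambda>u. cls n (js ! u) = i)"
  define T where "T = {u. u < k \<and> (cls n (js ! u) = i \<or> cls n (js ! u - 1) = i)}"
  define p where "p = (\<lambda>u. if up u then pt u (js ! u) else pt u (js ! u - 1))"
  define \<kappa> where "\<kappa> = (\<lambda>u. if up u then 1 / e else e)"
  define \<rho> where "\<rho> = (\<lambda>u. if up u then e - 1 / e else 1 / e - e)"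
  have T: "finite T" "T \<subseteq> {..<k}" by (auto simp: T_def)
  have not_both: "cls n (j - 1) \<noteq> cls n j" for j using cls_ne[of 1 "j - 1"] n2 by simp
  have pnz: "p t \<noteq> 0" if "t \<in> T" for t using that pt_nz by (simp add: T_def p_def)
  have pne: "p t \<noteq> p t'" if "t \<in> T" "t' \<in> T" "t \<noteq> t'" for t t'
    using that pt_ne[of t t' 0] by (auto simp: T_def p_def up_def)
  have inj: "inj_on p T" using pne by (auto simp: inj_on_def)
  have series_T: "box_series G t i (js ! t) = fps_const (\<kappa> t) + fps_const (\<rho> t) * G (p t)" if "t \<in> T" for G t
    using that ci unfolding box_series_def \<kappa>_def \<rho>_def p_def up_def T_def by (auto simp del: fps_const_sub)
  have series_nT: "box_series G t i (js ! t) = 1" if "t \<in> {..<k} - T" for G t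
    using that ci unfolding box_series_def T_def by auto
  have ev_T: "ev t i (js ! t) z = \<kappa> t + \<rho> t / (1 - p t * z)" if "t \<in> T" "p t * z \<noteq> 1" for t z
  proof -
    have "1 / e + (e - 1 / e) / (1 - x) = (e - 1 / e * x) / (1 - x)"
      "e + (1 / e - e) / (1 - x) = (1 / e - e * x) / (1 - x)" if "x \<noteq> 1" for x
      using that by (simp_all add: field_simps)
    note id = this[OF that(2)]
    show ?thesis
    proof (cases "up t")
      case True
      then have "ev t i (js ! t) z = (e - 1 / e * (p t * z)) / (1 - p t * z)"
        unfolding ev_eq[OF i] ci p_def up_def by simp
      then show ?thesis using id(1) True by (simp only: \<kappa>_def \<rho>_def if_True)
    next
      case False
      then have "cls n (js ! t - 1) = i" using that(1) by (simp add: T_def up_def)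
      then have "ev t i (js ! t) z = (1 / e - e * (p t * z)) / (1 - p t * z)"
        using False unfolding ev_eq[OF i] ci p_def up_def by simp
      then show ?thesis using id(2) False by (simp only: \<kappa>_def \<rho>_def if_False)
    qed
  qed
  have ev_nT: "ev t i (js ! t) z = 1" if "t \<in> {..<k} - T" for t z
    using that unfolding ev_eq[OF i] T_def ci by auto
  define R where "R = (\<lambda>t. \<rho> t * (\<Prod>t'\<in>{..<k}-{t}. ev t' i (js ! t') (inverse (p t))))"
  have R: "\<rho> t * (\<Prod>t'\<in>T-{t}. \<kappa> t' + \<rho> t' / (1 - p t' / p t)) = R t" if t: "t \<in> T" for t
  proof -
    have "(\<Prod>t'\<in>{..<k}-{t}. ev t' i (js ! t') (inverse (p t)))
        = (\<Prod>t'\<in>T-{t}. ev t' i (js ! t') (inverse (p t)))"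
      by (rule prod.mono_neutral_right) (use T ev_nT in auto)
    also have "\<dots> = (\<Prod>t'\<in>T-{t}. \<kappa> t' + \<rho> t' / (1 - p t' / p t))"
    proof (rule prod.cong[OF refl])
      fix t' assume t': "t' \<in> T - {t}"
      then have "p t' * inverse (p t) \<noteq> 1" using pne[of t' t] pnz[OF t] t by (auto simp: field_simps)
      then show "ev t' i (js ! t') (inverse (p t)) = \<kappa> t' + \<rho> t' / (1 - p t' / p t)"
        using t' ev_T by (simp add: divide_inverse)
    qed
    finally show ?thesis by (simp add: R_def)
  qed
  define K where "K = (\<Prod>t\<in>T. \<kappa> t)"
  have phi_series: "phi_series \<sigma> i js = fps_const K + (\<Sum>t\<in>T. fps_const (R t) * geom \<sigma> (p t))" for \<sigma>
  proof -
    have "phi_series \<sigma> i js = (\<Prod>t\<in>T. box_series (geom \<sigma>) t i (js ! t))"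
      unfolding phi_series_def by (rule prod.mono_neutral_right) (use T series_nT in auto)
    also have "\<dots> = (\<Prod>t\<in>T. fps_const (\<kappa> t) + fps_const (\<rho> t) * geom \<sigma> (p t))"
      by (rule prod.cong) (simp_all add: series_T)
    also have "\<dots> = fps_const (\<Prod>t\<in>T. \<kappa> t)
      + (\<Sum>t\<in>T. fps_const (\<rho> t * (\<Prod>t'\<in>T-{t}. \<kappa> t' + \<rho> t' / (1 - p t' / p t))) * geom \<sigma> (p t))"
      by (rule partial_fractions) (use T inj pnz geom_mult in auto)
    finally show ?thesis by (simp add: K_def R)
  qed
  have nth: "fps_nth (phi_series \<sigma> i js) m = (if m = 0 then K else 0) + (\<Sum>t\<in>T. R t * fps_nth (geom \<sigma> (p t)) m)"
    for \<sigma> m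
    unfolding phi_series by (simp add: fps_sum_nth)
  have "phi_coeff 1 i js M - phi_coeff (-1) i js M = (\<Sum>t\<in>T. R t * p t powi M)"
  proof -
    consider "M < 0" | "M = 0" | "M > 0" by linarith
    then show ?thesis
    proof cases
      case 1
      then show ?thesis
        by (auto simp: phi_coeff_def nth geom_def power_int_def divide_inverse simp flip: sum_negf intro!: sum.cong)
    next
      case 2
      then show ?thesis by (simp add: phi_coeff_def nth geom_def)
    next
      case 3
      then show ?thesis by (simp add: phi_coeff_def nth geom_def power_int_def)
    qed
  qed
  also have "\<dots> = (\<Sum>u<k. if u \<in> T then R u * p u powi M else 0)"
    using T by (simp add: sum.inter_restrict[symmetric] Int_absorb1)
  also have "\<dots> = (e - 1 / e) * (\<Sum>u<k.
     (if cls n (js ! u) = i then pt u (js ! u) powi M *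
        (\<Prod>t\<in>{..<k}-{u}. ev t i (js ! t) (inverse (pt u (js ! u)))) else 0)
   - (if cls n (js ! u - 1) = i then pt u (js ! u - 1) powi M *
        (\<Prod>t\<in>{..<k}-{u}. ev t i (js ! t) (inverse (pt u (js ! u - 1)))) else 0))"
    unfolding sum_distrib_left
  proof (rule sum.cong[OF refl])
    fix u assume "u \<in> {..<k}"
    then consider "cls n (js ! u) = i" "cls n (js ! u - 1) \<noteq> i" "u \<in> T"
      | "cls n (js ! u) \<noteq> i" "cls n (js ! u - 1) = i" "u \<in> T"
      | "cls n (js ! u) \<noteq> i" "cls n (js ! u - 1) \<noteq> i" "u \<notin> T"
      using not_both[of "js ! u"] by (auto simp: T_def)
    then show "(if u \<in> T then R u * p u powi M else 0) = (e - 1 / e) * (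
     (if cls n (js ! u) = i then pt u (js ! u) powi M *
        (\<Prod>t\<in>{..<k}-{u}. ev t i (js ! t) (inverse (pt u (js ! u)))) else 0)
   - (if cls n (js ! u - 1) = i then pt u (js ! u - 1) powi M *
        (\<Prod>t\<in>{..<k}-{u}. ev t i (js ! t) (inverse (pt u (js ! u - 1)))) else 0))"
      by cases (simp_all add: R_def p_def up_def \<rho>_def algebra_simps)
  qed
  finally show ?thesis .
qed

subsection \<open>Constant terms and logarithms\<close>

definition K_eigenvalue :: "(int \<Rightarrow> rat) \<Rightarrow> int list \<Rightarrow> complex"
  where "K_eigenvalue h js = (\<Prod>t<k. qpow \<tau> (h (cls n (js ! t)) - h (cls n (js ! t - 1))))"

lemma qpow_add: "qpow \<tau> (x + y) = qpow \<tau> x * qpow \<tau> y"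
  by (simp add: qpow_def of_rat_add distrib_left exp_add)

lemma qpow_0 [simp]: "qpow \<tau> 0 = 1" by (simp add: qpow_def)

text \<open>The value of a rational function at 0 or at infinity is the eigenvalue of \<open>k\<^sub>i\<close> or of its
  inverse, so what remains of the series has constant term 1 and a logarithm.\<close>

lemma K_eigenvalue_unit:
  assumes i: "i \<in> index_set n" and s: "\<sigma> \<in> {1, -1}"
  shows "K_eigenvalue (\<lambda>j. if j = i then of_int \<sigma> else 0) js = fps_nth (phi_series \<sigma> i js) 0"
proof -
  have ci: "cls n i = i" using i cls_index by blast
  have "qpow \<tau> ((if cls n j = i then of_int \<sigma> else 0) - (if cls n (j - 1) = i then of_int \<sigma> else 0))
     = fps_nth (box_series (geom \<sigma>) t i j) 0" for j t
    using s ci cls_ne[of 1 "j - 1"] n2 by (auto simp: box_series_def geom_def)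
  then show ?thesis unfolding K_eigenvalue_def phi_series_def fps_prod_nth_0 by simp
qed

lemma K_eigenvalue_nz: "K_eigenvalue h js \<noteq> 0" by (simp add: K_eigenvalue_def qpow_def)

definition log_phi_series :: "int \<Rightarrow> int \<Rightarrow> int list \<Rightarrow> complex fps"
  where "log_phi_series \<sigma> i js = (SOME S. fps_nth S 0 = 0 \<and>
    fps_compose (fps_exp 1) S = fps_const (1 / fps_nth (phi_series \<sigma> i js) 0) * phi_series \<sigma> i js)"

lemma log_phi_series:
  assumes "i \<in> index_set n" "\<sigma> \<in> {1, -1}"
  shows "fps_nth (log_phi_series \<sigma> i js) 0 = 0"
    and "phi_series \<sigma> i js = fps_const (fps_nth (phi_series \<sigma> i js) 0) * fps_compose (fps_exp 1) (log_phi_series \<sigma> i js)"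
proof -
  have nz: "fps_nth (phi_series \<sigma> i js) 0 \<noteq> 0" using K_eigenvalue_unit[OF assms] K_eigenvalue_nz by metis
  then have "\<exists>S. fps_nth S 0 = 0 \<and>
    fps_compose (fps_exp 1) S = fps_const (1 / fps_nth (phi_series \<sigma> i js) 0) * phi_series \<sigma> i js"
    by (intro fps_exp_surj) simp
  from someI_ex[OF this, folded log_phi_series_def]
  show "fps_nth (log_phi_series \<sigma> i js) 0 = 0"
    and "phi_series \<sigma> i js = fps_const (fps_nth (phi_series \<sigma> i js) 0) * fps_compose (fps_exp 1) (log_phi_series \<sigma> i js)"
    using nz by (simp_all flip: mult.assoc)
qed

definition H_eigenvalue :: "int \<Rightarrow> int \<Rightarrow> int list \<Rightarrow> complex"
  where "H_eigenvalue i m js = (if m > 0 then fps_nth (log_phi_series 1 i js) (nat m) / (e - 1 / e)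
    else - fps_nth (log_phi_series (-1) i js) (nat (- m)) / (e - 1 / e))"

section \<open>The action of the generators\<close>

definition edges :: "int \<Rightarrow> (nat \<times> int) set"
  where "edges i = {..<k} \<times> {m \<in> {0..<int N}. cls n m = i}"

abbreviation mv :: "int \<Rightarrow> nat \<times> int \<Rightarrow> (int list \<Rightarrow> complex) \<Rightarrow> int list \<Rightarrow> complex"
  where "mv s x \<equiv> move s (fst x) (snd x)"
abbreviation cc :: "nat \<times> int \<Rightarrow> complex" where "cc x \<equiv> pt (fst x) (snd x)"

definition X_op :: "int \<Rightarrow> int \<Rightarrow> int \<Rightarrow> (int list \<Rightarrow> complex) \<Rightarrow> int list \<Rightarrow> complex"
  where "X_op s i r v js = (\<Sum>x\<in>edges i. cc x powi r * mv s x v js)"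

text \<open>Symbols that are not generators act by zero, as the first relators demand.\<close>

fun ops :: "tor_gen \<Rightarrow> (int list \<Rightarrow> complex) \<Rightarrow> int list \<Rightarrow> complex" where
  "ops (X s i r) v = (\<lambda>js. if is_generator n (X s i r) then X_op s i r v js else 0)"
| "ops (K h) v = (\<lambda>js. if is_generator n (K h) then K_eigenvalue h js * v js else 0)"
| "ops (H i m) v = (\<lambda>js. if is_generator n (H i m) then H_eigenvalue i m js * v js else 0)"

definition act :: "tor_gen free_algebra \<Rightarrow> (int list \<Rightarrow> complex) \<Rightarrow> int list \<Rightarrow> complex"
  where "act = lift_ops ops"

lemma finite_edges [simp]: "finite (edges i)"
  by (rule finite_subset[of _ "{..<k} \<times> {0..<int N}"]) (auto simp: edges_def)

lemma edgesD: "x \<in> edges i \<Longrightarrow> fst x < k \<and> snd x \<in> {0..<int N} \<and> cls n (snd x) = i"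
  by (auto simp: edges_def)

lemma move_add: "move s u m (v + w) js = move s u m v js + move s u m w js"
  by (simp add: move_def distrib_left)

lemma move_scale: "move s u m (fscale c v) js = c * move s u m v js"
  by (simp add: move_def)

lemma move_sum:
  "move s u m (\<lambda>js. \<Sum>y\<in>A. g y * f y js) = (\<lambda>js. \<Sum>y\<in>A. g y * move s u m (f y) js)"
  by (rule ext) (auto simp: move_def sum_distrib_left mult.left_commute)

lemma linear_ops: "linear_on UNIV (ops g)"
proof (cases g)
  case (X s i r)
  have 1: "X_op s i r (v + w) js = X_op s i r v js + X_op s i r w js" for v w js
    by (simp only: X_op_def move_add distrib_left sum.distrib)
  have 2: "X_op s i r (fscale c v) js = c * X_op s i r v js" for c v js
    by (simp only: X_op_def move_scale sum_distrib_left mult.left_commute)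
  show ?thesis unfolding X linear_on_UNIV_iff ops.simps fun_eq_iff plus_fun_apply fscale_apply 1 2
    by simp
next
  case (K h)
  show ?thesis unfolding K linear_on_UNIV_iff ops.simps fun_eq_iff plus_fun_apply fscale_apply
    by (simp del: is_generator.simps add: distrib_left)
next
  case (H i m)
  show ?thesis unfolding H linear_on_UNIV_iff ops.simps fun_eq_iff plus_fun_apply fscale_apply
    by (simp del: is_generator.simps add: distrib_left)
qed

abbreviation tensors :: "(int list \<Rightarrow> complex) set" where "tensors \<equiv> tensor_space N k"

lemma src_range: "src s m mod int N \<in> {0..<int N}" "tgt s m mod int N \<in> {0..<int N}"
  using N_pos by auto

lemma states_update:
  assumes "js ! u \<in> {0..<int N}" "x \<in> {0..<int N}" "u < k"
  shows "js[u := x] \<in> states N k \<longleftrightarrow> js \<in> states N k"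
proof -
  have "set js \<subseteq> {0..<int N} \<longleftrightarrow> (\<forall>t<k. js ! t \<in> {0..<int N})" if "length js = k" for js
    using that by (auto simp: set_conv_nth)
  then show ?thesis using assms unfolding states_def mem_Collect_eq
    by (smt (verit) length_list_update nth_list_update_eq nth_list_update_neq)
qed

lemma move_in_tensors:
  assumes "v \<in> tensors" "u < k"
  shows "move s u m v \<in> tensors"
  unfolding tensor_space_iff
proof (intro allI impI)
  fix js assume js: "js \<notin> states N k"
  have "v (js[u := src s m mod int N]) = 0" if "js ! u = tgt s m mod int N"
  proof -
    have "js[u := src s m mod int N] \<notin> states N k"
      using states_update[of js u "src s m mod int N"] src_range that assms(2) js by metis
    then show ?thesis using assms(1) by (simp add: tensor_space_iff)
  qed
  then show "move s u m v js = 0" by (simp add: move_def)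
qed

lemma ops_in_tensors:
  assumes v: "v \<in> tensors"
  shows "ops g v \<in> tensors"
proof -
  have "X_op s i r v js = 0" if "js \<notin> states N k" for s i r js
    unfolding X_op_def
  proof (rule sum.neutral, rule ballI)
    fix x assume "x \<in> edges i"
    then have "mv s x v \<in> tensors" using edgesD v by (intro move_in_tensors) auto
    then show "cc x powi r * mv s x v js = 0" using that by (simp add: tensor_space_iff)
  qed
  then show ?thesis using v by (cases g) (auto simp: tensor_space_iff)
qed

lemma act_add: "act (p + q) v = act p v + act q v" by (simp add: act_def lift_ops_add)
lemma act_mult: "act (p * q) v = act p (act q v)"
  unfolding act_def by (rule lift_ops_mult) (rule linear_ops)
lemma act_scalar: "act (scalar c) v = fscale c v" by (simp add: act_def lift_ops_scalar)
lemma act_gen: "act (gen g) v = ops g v" by (simp add: act_def lift_ops_gen)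
lemma act_0: "act 0 v = 0" by (simp add: act_def)
lemma act_1: "act 1 v = v"
proof -
  have "(1 :: tor_gen free_algebra) = scalar 1" by (simp add: scalar_def)
  then show ?thesis using act_scalar[of 1 v] by simp
qed
lemma act_diff: "act (p - q) v = act p v - act q v"
proof -
  have "act p v = act ((p - q) + q) v" by simp
  also have "\<dots> = act (p - q) v + act q v" by (rule act_add)
  finally show ?thesis by (simp only: add_diff_cancel)
qed

lemma act_at:
  "act (p + q) v js = act p v js + act q v js"
  "act (p - q) v js = act p v js - act q v js"
  "act (p * q) v js = act p (act q v) js"
  "act (scalar c) v js = c * v js"
  "act 0 v js = 0" "act 1 v js = v js"
  by (simp_all add: act_add act_diff act_mult act_scalar act_0 act_1)

lemma act_X: "i \<in> index_set n \<Longrightarrow> s \<in> {1, -1} \<Longrightarrow> act (gen (X s i r)) v = X_op s i r v"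
  by (auto simp: act_gen)

subsection \<open>Diagonal elements\<close>

text \<open>Diagonal elements are closed under the operations that build \<open>\<phi>\<close> from \<open>k\<close> and the \<open>h\<^sub>i\<^sub>,\<^sub>m\<close>, and
  they commute; this settles all relations among Cartan elements.\<close>

definition diag :: "tor_gen free_algebra \<Rightarrow> (int list \<Rightarrow> complex) \<Rightarrow> bool"
  where "diag p d \<longleftrightarrow> (\<forall>v js. act p v js = d js * v js)"

lemma diag_scalar: "diag (scalar c) (\<lambda>js. c)"
  and diag_0: "diag 0 (\<lambda>js. 0)" and diag_1: "diag 1 (\<lambda>js. 1)"
  by (simp_all add: diag_def act_at)

lemma diag_add: "diag p d \<Longrightarrow> diag q d' \<Longrightarrow> diag (p + q) (\<lambda>js. d js + d' js)"
  by (simp add: diag_def act_at distrib_right)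

lemma diag_mult: "diag p d \<Longrightarrow> diag q d' \<Longrightarrow> diag (p * q) (\<lambda>js. d js * d' js)"
  by (simp add: diag_def act_at mult.assoc)

lemma diag_sum: "(\<And>x. x \<in> A \<Longrightarrow> diag (p x) (d x)) \<Longrightarrow> diag (\<Sum>x\<in>A. p x) (\<lambda>js. \<Sum>x\<in>A. d x js)"
  by (induction A rule: infinite_finite_induct) (auto intro: diag_0 diag_add)

lemma diag_K: "h \<in> cartan_space n \<Longrightarrow> diag (gen (K h)) (K_eigenvalue h)"
  by (simp add: diag_def act_gen)

lemma diag_H: "i \<in> index_set n \<Longrightarrow> m \<noteq> 0 \<Longrightarrow> diag (gen (H i m)) (H_eigenvalue i m)"
  by (simp add: diag_def act_gen)

lemma diag_fps_power:
  assumes "\<And>m. diag (fps_nth S m) (\<lambda>js. fps_nth (T js) m)"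
  shows "diag (fps_nth (S ^ p) m) (\<lambda>js. fps_nth (T js ^ p) m)"
proof (induction p arbitrary: m)
  case 0
  show ?case using diag_0 diag_1 by (cases m) simp_all
next
  case (Suc p)
  show ?case unfolding power_Suc fps_mult_nth by (intro diag_sum diag_mult assms Suc)
qed

lemma diag_fps_exp:
  assumes "\<And>m. diag (fps_nth S m) (\<lambda>js. fps_nth (T js) m)"
  shows "diag (fps_nth (fps_exp_nc S) m) (\<lambda>js. fps_nth (fps_compose (fps_exp 1) (T js)) m)"
proof -
  have "diag (\<Sum>p\<le>m. scalar (1 / fact p) * fps_nth (S ^ p) m)
    (\<lambda>js. \<Sum>p\<le>m. 1 / fact p * fps_nth (T js ^ p) m)"
    by (intro diag_sum diag_mult diag_scalar diag_fps_power assms)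
  then show ?thesis by (simp add: fps_exp_nc_def fps_compose_nth atLeast0AtMost)
qed

lemma unit_in_cartan_space: "i \<in> index_set n \<Longrightarrow> (\<lambda>j. if j = i then c else 0) \<in> cartan_space n"
  by (auto simp: cartan_space_def)

lemma diag_phi:
  assumes i: "i \<in> index_set n" and s: "\<sigma> \<in> {1, -1}"
  shows "diag (phi \<tau> \<sigma> i m) (\<lambda>js. phi_coeff \<sigma> i js m)"
proof -
  have H: "diag (fps_nth (h_series \<tau> \<sigma> i) l) (\<lambda>js. fps_nth (log_phi_series \<sigma> i js) l)" for l
  proof (cases "l = 0")
    case True
    then show ?thesis using log_phi_series(1)[OF i s] diag_0 by (simp add: h_series_def)
  next
    case False
    have "diag (scalar (of_int \<sigma> * (e - 1 / e)) * gen (H i (\<sigma> * int l)))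
        (\<lambda>js. of_int \<sigma> * (e - 1 / e) * H_eigenvalue i (\<sigma> * int l) js)"
      by (intro diag_mult diag_scalar diag_H i) (use False s in auto)
    moreover have "of_int \<sigma> * (e - 1 / e) * H_eigenvalue i (\<sigma> * int l) js = fps_nth (log_phi_series \<sigma> i js) l" for js
      using False s e_diff_nz by (auto simp: H_eigenvalue_def)
    ultimately show ?thesis using False by (simp add: h_series_def)
  qed
  let ?h = "\<lambda>j. if j = i then of_int \<sigma> else (0 :: rat)"
  have "diag (gen (K ?h) * fps_nth (fps_exp_nc (h_series \<tau> \<sigma> i)) l)
     (\<lambda>js. K_eigenvalue ?h js * fps_nth (fps_compose (fps_exp 1) (log_phi_series \<sigma> i js)) l)" for l
    by (intro diag_mult diag_K unit_in_cartan_space i diag_fps_exp H)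
  moreover have "K_eigenvalue ?h js * fps_nth (fps_compose (fps_exp 1) (log_phi_series \<sigma> i js)) l = fps_nth (phi_series \<sigma> i js) l" for js l
  proof -
    have "fps_nth (phi_series \<sigma> i js) l
      = fps_nth (fps_const (fps_nth (phi_series \<sigma> i js) 0) * fps_compose (fps_exp 1) (log_phi_series \<sigma> i js)) l"
      using log_phi_series(2)[OF i s, of js] by simp
    then show ?thesis by (simp add: K_eigenvalue_unit[OF i s])
  qed
  ultimately show ?thesis using diag_0 by (simp add: phi_def phi_coeff_def)
qed

lemma diag_commuting: "p \<in> commuting_elements n \<tau> \<Longrightarrow> \<exists>d. diag p d"
  by (induction rule: commuting_elements.induct) (blast intro: diag_K diag_phi)+

section \<open>Verification of the relations\<close>

lemma X_op_X_op: "X_op s i m (X_op s' j r v) js =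
    (\<Sum>x\<in>edges i. \<Sum>y\<in>edges j. cc x powi m * cc y powi r * mv s x (mv s' y v) js)"
proof -
  have "X_op s' j r v = (\<lambda>js. \<Sum>y\<in>edges j. cc y powi r * mv s' y v js)"
    by (rule ext) (rule X_op_def)
  then have "X_op s i m (X_op s' j r v) js
    = (\<Sum>x\<in>edges i. cc x powi m * (\<Sum>y\<in>edges j. cc y powi r * mv s x (mv s' y v) js))"
    by (simp only: X_op_def move_sum)
  then show ?thesis by (simp only: sum_distrib_left mult.assoc)
qed

lemma X_op_X_op_X_op: "X_op s i m (X_op s' j l (X_op s'' p r v)) js =
    (\<Sum>x\<in>edges i. \<Sum>y\<in>edges j. \<Sum>z\<in>edges p.
      cc x powi m * cc y powi l * cc z powi r * mv s x (mv s' y (mv s'' z v)) js)"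
proof -
  have "X_op s'' p r v = (\<lambda>js. \<Sum>y\<in>edges p. cc y powi r * mv s'' y v js)"
    by (rule ext) (rule X_op_def)
  then have "mv s x (mv s' y (X_op s'' p r v)) js
     = (\<Sum>z\<in>edges p. cc z powi r * mv s x (mv s' y (mv s'' z v)) js)" for x y
    by (simp only: move_sum)
  then show ?thesis by (simp only: X_op_X_op sum_distrib_left mult.assoc)
qed

text \<open>Up to a monomial in the two points, the contribution of each pair of edges is the difference of
  the two sides of \<open>move_exchange\<close>.\<close>

lemma relation_x_x:
  assumes js: "length js = k" and s: "s \<in> {1, -1}" and q: "q = e powi (s * cartan n i j)"
  shows "X_op s i m (X_op s j (r - 1) v) js - q * X_op s i (m - 1) (X_op s j r v) js
    - (q * X_op s j (r - 1) (X_op s i m v) js - X_op s j r (X_op s i (m - 1) v) js) = 0"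
proof -
  let ?A = "\<lambda>x y. mv s x (mv s y v) js"
  have sw: "X_op s j r (X_op s i m v) js
     = (\<Sum>x\<in>edges i. \<Sum>y\<in>edges j. cc y powi r * cc x powi m * ?A y x)" for m r
    unfolding X_op_X_op by (rule sum.swap)
  have "X_op s i m (X_op s j (r - 1) v) js - q * X_op s i (m - 1) (X_op s j r v) js
    - (q * X_op s j (r - 1) (X_op s i m v) js - X_op s j r (X_op s i (m - 1) v) js)
    = (\<Sum>x\<in>edges i. \<Sum>y\<in>edges j.
        cc x powi m * cc y powi (r - 1) * ?A x y - q * (cc x powi (m - 1) * cc y powi r * ?A x y)
        - (q * (cc y powi (r - 1) * cc x powi m * ?A y x) - cc y powi r * cc x powi (m - 1) * ?A y x))"
    unfolding sw unfolding X_op_X_op by (simp only: sum_subtractf sum_distrib_left)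
  also have "\<dots> = 0"
  proof (intro sum.neutral ballI)
    fix x y assume x: "x \<in> edges i" and y: "y \<in> edges j"
    note xD = edgesD[OF x] and yD = edgesD[OF y]
    have "cc x \<noteq> 0" "cc y \<noteq> 0" using xD yD pt_nz by auto
    then have pw: "cc x powi m = cc x * cc x powi (m - 1)" "cc y powi r = cc y * cc y powi (r - 1)"
      using power_int_minus_mult[of "cc x" m] power_int_minus_mult[of "cc y" r] by (simp_all add: mult.commute)
    have "q = e powi (s * cartan n (snd y) (snd x))"
      using xD yD cartan_cls[of "snd y" "snd x"] cartan_sym q by (metis cartan_cls)
    then have "(cc x - q * cc y) * ?A x y = (q * cc x - cc y) * ?A y x"
      by (intro move_exchange js s) (use xD yD in auto)
    then have "cc x powi (m - 1) * cc y powi (r - 1) * ((cc x - q * cc y) * ?A x y)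
      = cc x powi (m - 1) * cc y powi (r - 1) * ((q * cc x - cc y) * ?A y x)" by simp
    then show "cc x powi m * cc y powi (r - 1) * ?A x y - q * (cc x powi (m - 1) * cc y powi r * ?A x y)
        - (q * (cc y powi (r - 1) * cc x powi m * ?A y x) - cc y powi r * cc x powi (m - 1) * ?A y x) = 0"
      unfolding pw by (simp add: algebra_simps)
  qed
  finally show ?thesis .
qed

lemma relation_x_commute:
  assumes js: "length js = k" and s: "s \<in> {1, -1}" and c: "cartan n i j = 0"
  shows "X_op s i m (X_op s j r v) js = X_op s j r (X_op s i m v) js"
proof -
  have "X_op s j r (X_op s i m v) js
     = (\<Sum>x\<in>edges i. \<Sum>y\<in>edges j. cc y powi r * cc x powi m * mv s y (mv s x v) js)"
    unfolding X_op_X_op by (rule sum.swap)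
  also have "\<dots> = X_op s i m (X_op s j r v) js"
    unfolding X_op_X_op
  proof (intro sum.cong refl)
    fix x y assume x: "x \<in> edges i" and y: "y \<in> edges j"
    note xD = edgesD[OF x] and yD = edgesD[OF y]
    have "cartan n (snd x) (snd y) = 0" using xD yD c by (metis cartan_cls)
    then have "mv s y (mv s x v) js = mv s x (mv s y v) js"
      by (intro move_commute js s) (use xD yD in auto)
    then show "cc y powi r * cc x powi m * mv s y (mv s x v) js = cc x powi m * cc y powi r * mv s x (mv s y v) js"
      by simp
  qed
  finally show ?thesis by simp
qed

subsection \<open>The Serre relation\<close>

lemma move_cong:
  assumes "\<And>js. length js = k \<Longrightarrow> \<alpha> * f js = \<beta> * g js" "length js = k"
  shows "\<alpha> * move s u m f js = \<beta> * move s u m g js"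
  using assms(1)[of "js[u := src s m mod int N]"] assms(2) by (simp add: move_def)

lemma tgt_ne_src: "s \<in> {1, -1} \<Longrightarrow> src s m mod int N \<noteq> tgt s m mod int N"
proof -
  assume s: "s \<in> {1, -1}"
  have "(m + 1) mod int N \<noteq> m mod int N"
  proof
    assume "(m + 1) mod int N = m mod int N"
    then have "int N dvd 1" by (simp add: mod_eq_dvd_iff)
    then show False using N3 by simp
  qed
  then show ?thesis using s by (auto simp: src_def tgt_def)
qed

lemma move_twice:
  assumes "length js = k" "u < k" "s \<in> {1, -1}"
  shows "move s u m (move s u m v) js = 0"
  using assms tgt_ne_src[of s m] by (simp add: move_def)

text \<open>For two edges in the same cycle, equality would identify them, or classes that differ by 2; the
  latter differ because \<open>n \<ge> 2\<close>.\<close>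

lemma edge_points_ne:
  assumes x: "x \<in> edges i" and y: "y \<in> edges i" and xy: "x \<noteq> y" and d: "d \<in> {0, 2, -2}"
  shows "cc y \<noteq> e powi d * cc x"
proof (cases "fst x = fst y")
  case False
  then show ?thesis using pt_ne[of "fst y" "fst x" "- d" "snd y" "snd x + d"] edgesD[OF x] edgesD[OF y] d
    pt_add[of "fst x" "snd x" d] by auto
next
  case True
  show ?thesis
  proof
    assume "cc y = e powi d * cc x"
    then have "snd y mod int N = (snd x + d) mod int N"
      using True pt_add[of "fst x" "snd x" d] edgesD[OF x] pt_inj[of "fst x" "snd y" "snd x + d"] by simp
    moreover from this have "cls n (snd y) = cls n (snd x + d)" by (metis cls_mod)
    then have "d = 0"
      using edgesD[OF x] edgesD[OF y] cls_ne[of 2 "snd x"] cls_ne[of 2 "snd x - 2"] n2 d by auto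
    ultimately have "snd y = snd x" using edgesD[OF x] edgesD[OF y] by simp
    then show False using xy True by (simp add: prod_eq_iff)
  qed
qed

text \<open>Distinct edges of class \<open>i\<close> are covered by \<open>serre_scalar\<close>.  If they coincide, every term
  vanishes: no entry can cross the same edge twice in a row, and the product with the move of class
  \<open>j\<close> in the middle is annihilated by two coefficients that cannot both be zero.\<close>

lemma serre_edges:
  assumes js: "length js = k" and s: "s \<in> {1, -1}" and c: "cartan n i j = -1"
    and x: "x \<in> edges i" and y: "y \<in> edges i" and z: "z \<in> edges j"
  shows "mv s x (mv s y (mv s z v)) js + mv s y (mv s x (mv s z v)) js
      + mv s z (mv s x (mv s y v)) js + mv s z (mv s y (mv s x v)) js
    = (e + 1 / e) * (mv s x (mv s z (mv s y v)) js + mv s y (mv s z (mv s x v)) js)"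
proof -
  note xD = edgesD[OF x] and yD = edgesD[OF y] and zD = edgesD[OF z]
  define q where "q = e powi s"
  have q: "q \<noteq> 0" "q + 1 / q = e + 1 / e" "q ^ 2 \<noteq> 1"
    using s e_sq_ne_1 by (auto simp: q_def field_simps)
  have c2: "cartan n (snd x) (snd y) = 2" "cartan n (snd y) (snd x) = 2"
    using xD yD by (simp_all add: cartan_def)
  have cz: "cartan n (snd x) (snd z) = -1" "cartan n (snd y) (snd z) = -1"
    using xD yD zD c by (metis cartan_cls)+
  have ep: "e powi (s * 2) = q ^ 2" "e powi (s * -1) = 1 / q"
    using s by (auto simp: q_def power_int_minus field_simps power2_eq_square)
  have xy: "(cc y - q^2 * cc x) * mv s y (mv s x w) js' = (q^2 * cc y - cc x) * mv s x (mv s y w) js'"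
    if "length js' = k" for w js'
    by (rule move_exchange) (use that s xD yD c2 ep in auto)
  have xz: "(cc z - cc x / q) * mv s z (mv s x w) js' = (cc z / q - cc x) * mv s x (mv s z w) js'"
    if "length js' = k" for w js'
  proof -
    have "(cc z - 1 / q * cc x) * mv s z (mv s x w) js' = (1 / q * cc z - cc x) * mv s x (mv s z w) js'"
      by (rule move_exchange) (use that s xD zD cz ep in auto)
    then show ?thesis by simp
  qed
  have yz: "(cc z - cc y / q) * mv s z (mv s y w) js' = (cc z / q - cc y) * mv s y (mv s z w) js'"
    if "length js' = k" for w js'
  proof -
    have "(cc z - 1 / q * cc y) * mv s z (mv s y w) js' = (1 / q * cc z - cc y) * mv s y (mv s z w) js'"
      by (rule move_exchange) (use that s yD zD cz ep in auto)
    then show ?thesis by simp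
  qed
  show ?thesis
  proof (cases "x = y")
    case True
    have 0: "mv s x (mv s x w) js' = 0" if "length js' = k" for w js'
      using move_twice that s xD by auto
    have z0: "mv s z (mv s x (mv s x v)) js = 0"
      using move_cong[of 1 "mv s x (mv s x v)" 0 "\<lambda>_. 0" js] 0 js by simp
    have "(cc z - cc x / q) * mv s x (mv s z (mv s x v)) js
        = (cc z / q - cc x) * mv s x (mv s x (mv s z v)) js"
      by (rule move_cong[OF xz js])
    then have a: "(cc z - cc x / q) * mv s x (mv s z (mv s x v)) js = 0" using 0[OF js] by simp
    have b: "(cc z / q - cc x) * mv s x (mv s z (mv s x v)) js = 0"
      using xz[OF js, of "mv s x v"] z0 by simp
    have "mv s x (mv s z (mv s x v)) js = 0"
    proof (rule ccontr)
      assume "mv s x (mv s z (mv s x v)) js \<noteq> 0"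
      with a b have "cc z = cc x / q" "cc z / q = cc x" by auto
      then have "cc x = q^2 * cc x" using q by (auto simp: field_simps power2_eq_square)
      then show False using q(3) pt_nz xD by auto
    qed
    then show ?thesis using True z0 0[OF js] by simp
  next
    case False
    have nz: "cc x \<noteq> 0" "cc y \<noteq> 0" using pt_nz xD yD by auto
    have s2: "s * 2 \<in> {0, 2, -2}" using s by auto
    have ne: "cc x \<noteq> cc y" "cc y \<noteq> q^2 * cc x" "cc x \<noteq> q^2 * cc y"
      using edge_points_ne[OF x y False, of 0] edge_points_ne[OF x y False s2]
        edge_points_ne[OF y x _ s2] False ep by auto
    have "mv s x (mv s y (mv s z v)) js + mv s y (mv s x (mv s z v)) js
      + mv s z (mv s x (mv s y v)) js + mv s z (mv s y (mv s x v)) js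
      = (q + 1 / q) * (mv s x (mv s z (mv s y v)) js + mv s y (mv s z (mv s x v)) js)"
    proof (rule serre_scalar[OF q(1,3) nz ne, where w = "cc z"])
      show "(cc y - q\<^sup>2 * cc x) * mv s y (mv s x (mv s z v)) js = (q\<^sup>2 * cc y - cc x) * mv s x (mv s y (mv s z v)) js"
        by (rule xy[OF js])
      show "(cc y - q\<^sup>2 * cc x) * mv s z (mv s y (mv s x v)) js = (q\<^sup>2 * cc y - cc x) * mv s z (mv s x (mv s y v)) js"
        by (rule move_cong[OF xy js])
      show "(cc z - cc x / q) * mv s z (mv s x (mv s y v)) js = (cc z / q - cc x) * mv s x (mv s z (mv s y v)) js"
        by (rule xz[OF js])
      show "(cc z - cc x / q) * mv s y (mv s z (mv s x v)) js = (cc z / q - cc x) * mv s y (mv s x (mv s z v)) js"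
        by (rule move_cong[OF xz js])
      show "(cc z - cc y / q) * mv s z (mv s y (mv s x v)) js = (cc z / q - cc y) * mv s y (mv s z (mv s x v)) js"
        by (rule yz[OF js])
      show "(cc z - cc y / q) * mv s x (mv s z (mv s y v)) js = (cc z / q - cc y) * mv s x (mv s y (mv s z v)) js"
        by (rule move_cong[OF yz js])
    qed
    then show ?thesis by (simp only: q(2))
  qed
qed

lemma relation_serre:
  assumes js: "length js = k" and s: "s \<in> {1, -1}" and c: "cartan n i j = -1" and Q: "Q = e + 1 / e"
  shows "(X_op s i m (X_op s i l (X_op s j r v)) js - Q * X_op s i m (X_op s j r (X_op s i l v)) js
      + X_op s j r (X_op s i m (X_op s i l v)) js)
    + (X_op s i l (X_op s i m (X_op s j r v)) js - Q * X_op s i l (X_op s j r (X_op s i m v)) js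
      + X_op s j r (X_op s i l (X_op s i m v)) js) = 0"
proof -
  let ?T = "\<lambda>x y z. mv s x (mv s y (mv s z v)) js"
  have 2: "X_op s i m (X_op s j r (X_op s i l v)) js
     = (\<Sum>x\<in>edges i. \<Sum>y\<in>edges i. \<Sum>z\<in>edges j. cc x powi m * cc z powi r * cc y powi l * ?T x z y)" for m l
    unfolding X_op_X_op_X_op by (rule sum.cong[OF refl sum.swap])
  have 3: "X_op s j r (X_op s i m (X_op s i l v)) js
     = (\<Sum>x\<in>edges i. \<Sum>y\<in>edges i. \<Sum>z\<in>edges j. cc z powi r * cc x powi m * cc y powi l * ?T z x y)" for m l
    unfolding X_op_X_op_X_op by (rule trans[OF sum.swap sum.cong[OF refl sum.swap]])
  let ?h = "\<lambda>m l x y z. cc x powi m * cc y powi l * cc z powi r * (?T x y z - Q * ?T x z y + ?T z x y)"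
  have half: "X_op s i m (X_op s i l (X_op s j r v)) js - Q * X_op s i m (X_op s j r (X_op s i l v)) js
      + X_op s j r (X_op s i m (X_op s i l v)) js
    = (\<Sum>x\<in>edges i. \<Sum>y\<in>edges i. \<Sum>z\<in>edges j. ?h m l x y z)" for m l
    unfolding 2 3 unfolding X_op_X_op_X_op sum_distrib_left sum_subtractf[symmetric] sum.distrib[symmetric]
    by (intro sum.cong refl) (simp add: algebra_simps)
  \<comment> \<open>renaming the two edges of class \<open>i\<close> in the second half makes the monomials agree\<close>
  have "(\<Sum>x\<in>edges i. \<Sum>y\<in>edges i. \<Sum>z\<in>edges j. ?h l m x y z)
     = (\<Sum>x\<in>edges i. \<Sum>y\<in>edges i. \<Sum>z\<in>edges j. ?h l m y x z)"
    by (rule sum.swap)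
  then have "(\<Sum>x\<in>edges i. \<Sum>y\<in>edges i. \<Sum>z\<in>edges j. ?h m l x y z)
     + (\<Sum>x\<in>edges i. \<Sum>y\<in>edges i. \<Sum>z\<in>edges j. ?h l m x y z)
     = (\<Sum>x\<in>edges i. \<Sum>y\<in>edges i. \<Sum>z\<in>edges j. ?h m l x y z + ?h l m y x z)"
    by (simp only: sum.distrib)
  also have "\<dots> = 0"
  proof (intro sum.neutral ballI)
    fix x y z assume xyz: "x \<in> edges i" "y \<in> edges i" "z \<in> edges j"
    have "?h m l x y z + ?h l m y x z = cc x powi m * cc y powi l * cc z powi r *
       ((?T x y z + ?T y x z + ?T z x y + ?T z y x) - Q * (?T x z y + ?T y z x))"
      by (simp add: algebra_simps)
    then show "?h m l x y z + ?h l m y x z = 0"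
      using serre_edges[OF js s c xyz, of v] Q by simp
  qed
  finally show ?thesis unfolding half .
qed

subsection \<open>The relation between raising and lowering operators\<close>

lemma sum_edges: "(\<Sum>x\<in>edges i. g x) = (\<Sum>u<k. \<Sum>m | m \<in> {0..<int N} \<and> cls n m = i. g (u, m))"
  unfolding edges_def by (simp add: sum.cartesian_product)

lemma mod_succ_eq_iff:
  "j \<in> {0..<int N} \<Longrightarrow> m \<in> {0..<int N} \<Longrightarrow> j = (m + 1) mod int N \<longleftrightarrow> m = (j - 1) mod int N"
proof -
  assume j: "j \<in> {0..<int N}" and m: "m \<in> {0..<int N}"
  have "j = (m + 1) mod int N \<longleftrightarrow> j mod int N = (m + 1) mod int N" using j by simp
  also have "\<dots> \<longleftrightarrow> m mod int N = (j - 1) mod int N"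
    unfolding mod_eq_dvd_iff by (simp add: dvd_diff_commute[of _ j] algebra_simps)
  finally show ?thesis using m by simp
qed

text \<open>Only opposite moves across one and the same edge survive in the commutator.  Summed over the two
  edges at each entry they give the right hand side of \<open>phi_coeff_diff\<close>.\<close>

lemma relation_plus_minus:
  assumes js: "js \<in> states N k" and i: "i \<in> index_set n"
  shows "X_op 1 i m (X_op (-1) j r v) js - X_op (-1) j r (X_op 1 i m v) js
    = (if i = j then 1 / (e - 1 / e) * (phi_coeff 1 i js (m + r) - phi_coeff (-1) i js (m + r)) * v js else 0)"
proof -
  have len: "length js = k" using js by (simp add: states_def)
  have rng: "js ! u \<in> {0..<int N}" if "u < k" for u
    using js that len nth_mem[of u js] unfolding states_def by blast
  define P where "P = (\<lambda>u m. \<Prod>t\<in>{..<k}-{u}. ev t i (js ! t) (inverse (pt u m)))"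
  have P_mod: "P u (m mod int N) = P u m" for u m by (simp add: P_def pt_mod)
  \<comment> \<open>the diagonal entry that the commutator has at the edge x\<close>
  define D where "D = (\<lambda>x. (if js ! fst x = snd x then P (fst x) (snd x) else 0)
     - (if js ! fst x = (snd x + 1) mod int N then P (fst x) (snd x) else 0))"
  have pair: "mv 1 x (mv (-1) y v) js - mv (-1) y (mv 1 x v) js = (if x = y then D x * v js else 0)"
    if x: "x \<in> edges i" and y: "y \<in> edges j" for x y
  proof (cases "fst x = fst y")
    case False
    then show ?thesis using move_mixed[OF len, of "fst x" "fst y"] edgesD[OF x] edgesD[OF y] by auto
  next
    case True
    have u: "fst x < k" "snd x mod int N = snd x" "snd y mod int N = snd y" "cls n (snd x) = i"
      using edgesD[OF x] edgesD[OF y] by auto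
    have eq: "x = y \<longleftrightarrow> snd x = snd y" using True by (simp add: prod_eq_iff)
    show ?thesis
      unfolding True[symmetric] move_mixed_same_site(1)[OF len u(1)] move_mixed_same_site(2)[OF len u(1)]
      unfolding u eq by (auto simp: D_def P_def left_diff_distrib)
  qed
  have "X_op (-1) j r (X_op 1 i m v) js
     = (\<Sum>x\<in>edges i. \<Sum>y\<in>edges j. cc y powi r * cc x powi m * mv (-1) y (mv 1 x v) js)"
    unfolding X_op_X_op by (rule sum.swap)
  then have "X_op 1 i m (X_op (-1) j r v) js - X_op (-1) j r (X_op 1 i m v) js
    = (\<Sum>x\<in>edges i. \<Sum>y\<in>edges j. cc x powi m * cc y powi r *
        (mv 1 x (mv (-1) y v) js - mv (-1) y (mv 1 x v) js))"
    unfolding X_op_X_op right_diff_distrib sum_subtractf by (simp only: ac_simps)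
  also have "\<dots> = (\<Sum>x\<in>edges i. \<Sum>y\<in>edges j. if x = y then cc x powi m * cc x powi r * (D x * v js) else 0)"
    by (intro sum.cong refl) (simp add: pair)
  also have "\<dots> = (\<Sum>x\<in>edges i. if x \<in> edges j then cc x powi m * cc x powi r * (D x * v js) else 0)"
    by (intro sum.cong refl) (simp add: sum.delta)
  also have "\<dots> = (if i = j then (\<Sum>x\<in>edges i. cc x powi (m + r) * (D x * v js)) else 0)"
  proof (cases "i = j")
    case True
    have "cc x powi m * cc x powi r = cc x powi (m + r)" if "x \<in> edges i" for x
      using pt_nz edgesD[OF that] by (simp add: power_int_add)
    then show ?thesis using True by simp
  next
    case False
    then have "x \<notin> edges j" if "x \<in> edges i" for x using edgesD[OF that] edgesD[of x j] by auto
    then show ?thesis using False by simp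
  qed
  also have "(\<Sum>x\<in>edges i. cc x powi (m + r) * (D x * v js))
    = 1 / (e - 1 / e) * (phi_coeff 1 i js (m + r) - phi_coeff (-1) i js (m + r)) * v js"
  proof -
    have div: "S = 1 / E * T" if "E * S = T" "E \<noteq> 0" for E S T :: complex
      using that by auto
    define M where "M = m + r"
    let ?S = "{m. m \<in> {0..<int N} \<and> cls n m = i}"
    have fin: "finite ?S" by (rule finite_subset[of _ "{0..<int N}"]) auto
    have "(\<Sum>m\<in>?S. pt u m powi M * D (u, m))
       = (if cls n (js ! u) = i then pt u (js ! u) powi M * P u (js ! u) else 0)
         - (if cls n (js ! u - 1) = i then pt u (js ! u - 1) powi M * P u (js ! u - 1) else 0)"
      if u: "u < k" for u
    proof -
      define j' where "j' = (js ! u - 1) mod int N"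
      have j': "j' \<in> ?S \<longleftrightarrow> cls n (js ! u - 1) = i" "js ! u \<in> ?S \<longleftrightarrow> cls n (js ! u) = i"
        using N_pos rng[OF u] by (auto simp: j'_def cls_mod)
      have "(\<Sum>m\<in>?S. pt u m powi M * D (u, m))
        = (\<Sum>m\<in>?S. if m = js ! u then pt u (js ! u) powi M * P u (js ! u) else 0)
          - (\<Sum>m\<in>?S. if m = j' then pt u j' powi M * P u j' else 0)"
        unfolding sum_subtractf[symmetric]
      proof (rule sum.cong[OF refl])
        fix m assume "m \<in> ?S"
        then have "js ! u = (m + 1) mod int N \<longleftrightarrow> m = j'"
          unfolding j'_def using mod_succ_eq_iff rng[OF u] by blast
        then show "pt u m powi M * D (u, m) = (if m = js ! u then pt u (js ! u) powi M * P u (js ! u) else 0)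
            - (if m = j' then pt u j' powi M * P u j' else 0)"
          by (auto simp: D_def algebra_simps)
      qed
      also have "\<dots> = (if js ! u \<in> ?S then pt u (js ! u) powi M * P u (js ! u) else 0)
          - (if j' \<in> ?S then pt u j' powi M * P u j' else 0)"
        using fin by (simp only: sum.delta)
      also have "\<dots> = (if cls n (js ! u) = i then pt u (js ! u) powi M * P u (js ! u) else 0)
         - (if cls n (js ! u - 1) = i then pt u (js ! u - 1) powi M * P u (js ! u - 1) else 0)"
        unfolding j' unfolding j'_def pt_mod P_mod ..
      finally show ?thesis .
    qed
    then have "(\<Sum>x\<in>edges i. cc x powi M * D x) = (\<Sum>u<k.
         (if cls n (js ! u) = i then pt u (js ! u) powi M * P u (js ! u) else 0)
         - (if cls n (js ! u - 1) = i then pt u (js ! u - 1) powi M * P u (js ! u - 1) else 0))"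
      unfolding sum_edges by simp
    then have "(e - 1 / e) * (\<Sum>x\<in>edges i. cc x powi M * D x) = phi_coeff 1 i js M - phi_coeff (-1) i js M"
      unfolding phi_coeff_diff[OF i len] P_def by simp
    then have "(\<Sum>x\<in>edges i. cc x powi M * D x) = 1 / (e - 1 / e) * (phi_coeff 1 i js M - phi_coeff (-1) i js M)"
      using e_diff_nz div by blast
    then show ?thesis unfolding M_def[symmetric] mult.assoc[symmetric] sum_distrib_right[symmetric] by simp
  qed
  finally show ?thesis .
qed

subsection \<open>The relations with the Cartan currents\<close>

lemma move_diag:
  "move s u m (\<lambda>js. d js * v js) js = d (js[u := src s m mod int N]) * move s u m v js"
  by (simp add: move_def)

lemma relation_phi_x:
  assumes js: "length js = k" and s: "s \<in> {1, -1}" "\<sigma> \<in> {1, -1}" and q: "q = e powi (s * cartan n i j)"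
  shows "phi_coeff \<sigma> i js m * X_op s j (r - 1) v js - q * (phi_coeff \<sigma> i js (m - 1) * X_op s j r v js)
    - (q * X_op s j (r - 1) (\<lambda>js. phi_coeff \<sigma> i js m * v js) js - X_op s j r (\<lambda>js. phi_coeff \<sigma> i js (m - 1) * v js) js) = 0"
proof -
  have "phi_coeff \<sigma> i js m * (cc x powi (r - 1) * mv s x v js) - q * (phi_coeff \<sigma> i js (m - 1) * (cc x powi r * mv s x v js))
    - (q * (cc x powi (r - 1) * mv s x (\<lambda>js. phi_coeff \<sigma> i js m * v js) js)
      - cc x powi r * mv s x (\<lambda>js. phi_coeff \<sigma> i js (m - 1) * v js) js) = 0" if x: "x \<in> edges j" for x
  proof (cases "js ! fst x = tgt s (snd x) mod int N")
    case False
    then show ?thesis by (simp add: move_def)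
  next
    case True
    note xD = edgesD[OF x]
    let ?js = "js[fst x := src s (snd x) mod int N]"
    have "cc x \<noteq> 0" using xD pt_nz by auto
    then have pw: "cc x powi r = cc x * cc x powi (r - 1)"
      using power_int_minus_mult[of "cc x" r] by (simp add: mult.commute)
    have "q = e powi (s * cartan n i (snd x))" using xD q by (metis cartan_cls(2))
    then have "phi_coeff \<sigma> i js m - q * cc x * phi_coeff \<sigma> i js (m - 1) = q * phi_coeff \<sigma> i ?js m - cc x * phi_coeff \<sigma> i ?js (m - 1)"
      by (intro phi_coeff_step) (use js xD True s in auto)
    then have "cc x powi (r - 1) * mv s x v js * (phi_coeff \<sigma> i js m - q * cc x * phi_coeff \<sigma> i js (m - 1)
      - (q * phi_coeff \<sigma> i ?js m - cc x * phi_coeff \<sigma> i ?js (m - 1))) = 0" by simp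
    then show ?thesis unfolding pw move_diag by (simp add: algebra_simps)
  qed
  then have "(\<Sum>x\<in>edges j. phi_coeff \<sigma> i js m * (cc x powi (r - 1) * mv s x v js)
    - q * (phi_coeff \<sigma> i js (m - 1) * (cc x powi r * mv s x v js))
    - (q * (cc x powi (r - 1) * mv s x (\<lambda>js. phi_coeff \<sigma> i js m * v js) js)
      - cc x powi r * mv s x (\<lambda>js. phi_coeff \<sigma> i js (m - 1) * v js) js)) = 0"
    by (intro sum.neutral ballI)
  then show ?thesis unfolding X_op_def sum_distrib_left sum_subtractf .
qed

lemma simple_root_eq:
  assumes h: "h \<in> cartan_space n"
  shows "simple_root n j h = 2 * h (cls n j) - h (cls n (j + 1)) - h (cls n (j - 1))"
proof -
  have ne: "cls n (j + 1) \<noteq> cls n j" "cls n (j - 1) \<noteq> cls n j" "cls n (j + 1) \<noteq> cls n (j - 1)"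
    using cls_ne[of 1 j] cls_ne[of 1 "j - 1"] cls_ne[of 2 "j - 1"] n2 by (auto simp: add.commute)
  let ?T = "{cls n j, cls n (j + 1), cls n (j - 1)}"
  have "simple_root n j h = (\<Sum>i\<in>?T. h i * of_int (cartan n i j))"
    unfolding simple_root_def
  proof (rule sum.mono_neutral_right)
    show "finite (index_set n)" by (simp add: index_set_def)
    show "?T \<subseteq> index_set n" by simp
    show "\<forall>i\<in>index_set n - ?T. h i * of_int (cartan n i j) = 0"
      by (auto simp: cartan_def cls_index)
  qed
  also have "\<dots> = 2 * h (cls n j) - h (cls n (j + 1)) - h (cls n (j - 1))"
    using ne by (auto simp: cartan_def)
  finally show ?thesis .
qed

lemma K_eigenvalue_update:
  assumes "length js = k" "u < k"
  shows "K_eigenvalue h (js[u := x]) = qpow \<tau> (h (cls n x) - h (cls n (x - 1))) *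
    (\<Prod>t\<in>{..<k}-{u}. qpow \<tau> (h (cls n (js ! t)) - h (cls n (js ! t - 1))))"
  unfolding K_eigenvalue_def using assms by (subst prod.remove[of _ u]) (auto intro!: prod.cong)

text \<open>The move changes the weight by plus or minus the simple root.\<close>

lemma relation_K_x:
  assumes js: "length js = k" and s: "s \<in> {1, -1}" and h: "h \<in> cartan_space n"
  shows "K_eigenvalue h js * X_op s j r (\<lambda>js. K_eigenvalue (- h) js * v js) js
    = qpow \<tau> (of_int s * simple_root n j h) * X_op s j r v js"
proof -
  have "K_eigenvalue h js * (cc x powi r * mv s x (\<lambda>js. K_eigenvalue (- h) js * v js) js)
    = qpow \<tau> (of_int s * simple_root n j h) * (cc x powi r * mv s x v js)" if x: "x \<in> edges j" for x
  proof (cases "js ! fst x = tgt s (snd x) mod int N")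
    case False
    then show ?thesis by (simp add: move_def)
  next
    case True
    define u m where um: "u = fst x" "m = snd x"
    have u: "u < k" "cls n m = j" using edgesD[OF x] by (auto simp: um)
    have js': "js = js[u := tgt s m mod int N]" using True by (metis um list_update_id)
    define d where "d = (\<lambda>y. h (cls n y) - h (cls n (y - 1)))"
    let ?R = "\<lambda>h. (\<Prod>t\<in>{..<k}-{u}. qpow \<tau> (h (cls n (js ! t)) - h (cls n (js ! t - 1))))"
    have 1: "K_eigenvalue h js = qpow \<tau> (d (tgt s m)) * ?R h"
      by (subst js') (simp add: K_eigenvalue_update[OF js u(1)] d_def cls_mod cls_mod_diff)
    have 2: "K_eigenvalue (- h) (js[u := src s m mod int N]) = qpow \<tau> (- d (src s m)) * ?R (- h)"
      by (simp add: K_eigenvalue_update[OF js u(1)] d_def cls_mod cls_mod_diff)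
    have 3: "?R h * ?R (- h) = 1"
      unfolding prod.distrib[symmetric] qpow_add[symmetric] by simp
    have c: "cls n (j + 1) = cls n (m + 1)" "cls n (j - 1) = cls n (m - 1)" "cls n j = cls n m"
      using u(2) by auto
    have "d (tgt s m) - d (src s m) = of_int s * simple_root n j h"
      unfolding simple_root_eq[OF h] c using s by (auto simp: d_def src_def tgt_def)
    then have "qpow \<tau> (d (tgt s m)) * qpow \<tau> (- d (src s m)) = qpow \<tau> (of_int s * simple_root n j h)"
      by (simp flip: qpow_add)
    moreover have "K_eigenvalue h js * K_eigenvalue (- h) (js[u := src s m mod int N])
      = (qpow \<tau> (d (tgt s m)) * qpow \<tau> (- d (src s m))) * (?R h * ?R (- h))"
      unfolding 1 2 by (simp only: ac_simps)
    ultimately have K: "K_eigenvalue h js * K_eigenvalue (- h) (js[u := src s m mod int N]) = qpow \<tau> (of_int s * simple_root n j h)"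
      unfolding 3 by simp
    show ?thesis unfolding move_diag um[symmetric] K[symmetric] by (simp only: ac_simps)
  qed
  then show ?thesis unfolding X_op_def sum_distrib_left by (intro sum.cong refl)
qed

section \<open>The module structure\<close>

lemma act_diag: "diag p d \<Longrightarrow> act p v = (\<lambda>js. d js * v js)"
  by (simp add: diag_def fun_eq_iff)

lemma act_in_tensors: "v \<in> tensors \<Longrightarrow> act p v \<in> tensors"
proof (induction p arbitrary: v rule: free_algebra_induct)
  case (scalar c)
  then show ?case unfolding act_scalar by (rule fs.subspace_scale[OF subspace_tensor_space])
next
  case (gen g)
  then show ?case by (simp only: act_gen ops_in_tensors)
next
  case (add p q)
  then show ?case unfolding act_add by (intro fs.subspace_add[OF subspace_tensor_space]) auto
next
  case (mult p q)
  then show ?case by (simp only: act_mult)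
qed

lemma act_zeroI:
  assumes "v \<in> tensors" "\<And>js. js \<in> states N k \<Longrightarrow> act p v js = 0"
  shows "act p v = 0"
proof
  fix js
  show "act p v js = 0 js"
    using assms act_in_tensors[OF assms(1), of p] by (cases "js \<in> states N k") (simp_all add: tensor_space_iff)
qed

lemma uminus_cartan_space: "h \<in> cartan_space n \<Longrightarrow> - h \<in> cartan_space n"
  and plus_cartan_space: "h \<in> cartan_space n \<Longrightarrow> h' \<in> cartan_space n \<Longrightarrow> h + h' \<in> cartan_space n"
  and zero_cartan_space: "0 \<in> cartan_space n"
  by (simp_all add: cartan_space_def)

lemma K_eigenvalue_add: "K_eigenvalue (h + h') js = K_eigenvalue h js * K_eigenvalue h' js"
  unfolding K_eigenvalue_def prod.distrib[symmetric] qpow_add[symmetric] by (simp add: algebra_simps)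

lemma K_eigenvalue_0: "K_eigenvalue 0 js = 1" by (simp add: K_eigenvalue_def)

lemma qpow_cartan: "qpow \<tau> (of_int (s * cartan n i j)) = e powi (s * cartan n i j)"
  by (rule qpow_of_int)

lemma act_relator:
  assumes "x \<in> toroidal_relators n \<tau>" and v: "v \<in> tensors"
  shows "act x v = 0"
proof (rule act_zeroI[OF v])
  fix js assume st: "js \<in> states N k"
  then have js: "length js = k" by (simp add: states_def)
  note at = act_at act_mult
  from assms(1) show "act x v js = 0"
  proof cases
    case (no_generator g)
    then show ?thesis unfolding no_generator(1) act_gen by (cases g) auto
  next
    case (K_add h h')
    then show ?thesis
      by (simp add: at act_diag[OF diag_K] plus_cartan_space K_eigenvalue_add)
  next
    case K_zero
    then show ?thesis by (simp add: at act_diag[OF diag_K] zero_cartan_space K_eigenvalue_0)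
  next
    case (commute p q)
    then obtain d d' where "diag p d" "diag q d'" using diag_commuting by blast
    then show ?thesis unfolding commute(1) by (simp add: at act_diag)
  next
    case (K_x h j s r)
    show ?thesis unfolding K_x(1) at act_diag[OF diag_K[OF K_x(2)]]
        act_diag[OF diag_K[OF uminus_cartan_space[OF K_x(2)]]] act_X[OF K_x(3,4)]
      using relation_K_x[OF js K_x(4,2), of j r v] by simp
  next
    case (phi_x i j s \<sigma> q m r)
    show ?thesis
      unfolding phi_x(1) phi_x(6) at act_diag[OF diag_phi[OF phi_x(2,5)]] act_X[OF phi_x(3,4)] qpow_cartan
      by (rule relation_phi_x[OF js phi_x(4,5) refl])
  next
    case (x_plus_x_minus i j m r)
    have pm: "(1::int) \<in> {1, -1}" "(-1::int) \<in> {1, -1}" by auto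
    show ?thesis
    proof (cases "i = j")
      case True
      show ?thesis
        unfolding x_plus_x_minus(1) if_P[OF True] at act_X[OF x_plus_x_minus(2) pm(1)] act_X[OF x_plus_x_minus(3) pm(2)]
          act_diag[OF diag_phi[OF x_plus_x_minus(2) pm(1)]] act_diag[OF diag_phi[OF x_plus_x_minus(2) pm(2)]]
          relation_plus_minus[OF st x_plus_x_minus(2)] qpow_1 qpow_m1
        by (simp add: left_diff_distrib mult.assoc)
    next
      case False
      show ?thesis
        unfolding x_plus_x_minus(1) if_not_P[OF False] at act_X[OF x_plus_x_minus(2) pm(1)] act_X[OF x_plus_x_minus(3) pm(2)]
          relation_plus_minus[OF st x_plus_x_minus(2)]
        by simp
    qed
  next
    case (x_x i j s q m r)
    show ?thesis unfolding x_x(1) x_x(5) at act_X[OF x_x(2,4)] act_X[OF x_x(3,4)] qpow_cartan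
      by (rule relation_x_x[OF js x_x(4) refl])
  next
    case (serre i j s q m l r)
    have "cls n i \<noteq> cls n (i + 1)" "cls n i \<noteq> cls n (i - 1)"
      using cls_ne[of 1 i] cls_ne[of 1 "i - 1"] n2 by auto
    then have "cartan n i (i + 1) = -1" "cartan n i (i - 1) = -1" by (simp_all add: cartan_def)
    then have "cartan n i j = -1" using serre(5) by (metis cartan_cls(2))
    from relation_serre[OF js serre(4) this refl]
    show ?thesis unfolding serre(1) serre(6) at act_X[OF serre(2,4)] act_X[OF serre(3,4)] qpow_1 qpow_m1 .
  next
    case (x_commute i j s m r)
    have "cartan n i j = 0" using x_commute(2,3,5) by (auto simp: cartan_def cls_index)
    then show ?thesis unfolding x_commute(1) at act_X[OF x_commute(2,4)] act_X[OF x_commute(3,4)]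
      using relation_x_commute[OF js x_commute(4)] by simp
  qed
qed

lemma presented_module_act: "presented_module (toroidal_relators n \<tau>) tensors act"
  unfolding act_def
proof (rule presented_module_lift_ops)
  show "linear_on UNIV (ops g)" for g by (rule linear_ops)
  show "module.subspace fscale tensors" by (rule subspace_tensor_space)
  show "v \<in> tensors \<Longrightarrow> ops g v \<in> tensors" for g v by (rule ops_in_tensors)
  show "x \<in> toroidal_relators n \<tau> \<Longrightarrow> v \<in> tensors \<Longrightarrow> lift_ops ops x v = 0" for x v
    using act_relator by (simp add: act_def)
qed

section \<open>The action on tensors of basis vectors\<close>

text \<open>The index of the basis tensor given by arbitrary integers, which are read modulo \<open>N\<close>.\<close>

definition residues :: "(nat \<Rightarrow> int) \<Rightarrow> int list"
  where "residues js = map (\<lambda>t. js t mod int N) [0..<k]"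

lemma length_residues [simp]: "length (residues js) = k"
  and nth_residues: "t < k \<Longrightarrow> residues js ! t = js t mod int N"
  by (simp_all add: residues_def)

lemma residues_in_states: "residues js \<in> states N k"
  using N_pos by (auto simp: residues_def states_def)

lemma residues_nth: "ls \<in> states N k \<Longrightarrow> residues ((!) ls) = ls"
proof (rule nth_equalityI)
  fix t assume ls: "ls \<in> states N k" and t: "t < length (residues ((!) ls))"
  then have "ls ! t \<in> set ls" "set ls \<subseteq> {0..<int N}" by (auto simp: states_def)
  then have "ls ! t \<in> {0..<int N}" by blast
  then show "residues ((!) ls) ! t = ls ! t" using t by (simp add: nth_residues)
qed (simp add: states_def)

lemma pure_tensor_box: "pure_tensor k (\<lambda>t. box N (js t)) = unit_vec (residues js)"
proof
  fix ls
  show "pure_tensor k (\<lambda>t. box N (js t)) ls = unit_vec (residues js) ls"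
  proof (cases "length ls = k")
    case True
    have "ls = residues js \<longleftrightarrow> (\<forall>t<k. ls ! t = js t mod int N)"
      using True by (metis length_residues nth_equalityI nth_residues)
    then show ?thesis using True
      by (auto simp: pure_tensor_def box_def unit_vec_def prod_zero_iff)
  qed (auto simp: pure_tensor_def unit_vec_def)
qed

lemma pure_tensor_scale:
  assumes "u < k"
  shows "pure_tensor k (b(u := fscale c w)) = fscale c (pure_tensor k (b(u := w)))"
proof
  fix ls
  have "(\<Prod>t<k. (b(u := x)) t (ls ! t)) = x (ls ! u) * (\<Prod>t\<in>{..<k}-{u}. b t (ls ! t))" for x
    using assms by (subst prod.remove[of _ u]) (auto intro!: prod.cong)
  then show "pure_tensor k (b(u := fscale c w)) ls = fscale c (pure_tensor k (b(u := w))) ls"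
    by (simp add: pure_tensor_def)
qed

lemma pure_tensor_zero: "u < k \<Longrightarrow> pure_tensor k (b(u := 0)) = 0"
  using pure_tensor_scale[of u b 0 0] by simp

lemma move_unit_vec:
  assumes ls: "ls \<in> states N k" and u: "u < k"
  shows "move s u m (unit_vec ls) = (if ls ! u = src s m mod int N
    then fscale (move_coeff s u m ls) (unit_vec (ls[u := tgt s m mod int N])) else 0)"
proof
  fix js
  have len: "length ls = k" using ls by (simp add: states_def)
  have nu: "u \<notin> other_factors k s u" by (simp add: other_factors_def)
  let ?S = "src s m mod int N" and ?T = "tgt s m mod int N"
  have iff: "js ! u = ?T \<and> js[u := ?S] = ls \<longleftrightarrow> ls ! u = ?S \<and> js = ls[u := ?T]"
  proof
    assume a: "js ! u = ?T \<and> js[u := ?S] = ls"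
    then have "length js = k" using len by auto
    then show "ls ! u = ?S \<and> js = ls[u := ?T]" using a u by (metis nth_list_update_eq list_update_overwrite list_update_id)
  next
    assume a: "ls ! u = ?S \<and> js = ls[u := ?T]"
    then show "js ! u = ?T \<and> js[u := ?S] = ls" using u len by (metis nth_list_update_eq list_update_overwrite list_update_id)
  qed
  have "move s u m (unit_vec ls) js = (if js ! u = ?T \<and> js[u := ?S] = ls then move_coeff s u m js else 0)"
    by (simp add: move_def unit_vec_def)
  also have "\<dots> = (if ls ! u = ?S \<and> js = ls[u := ?T] then move_coeff s u m ls else 0)"
    unfolding iff using nu by (auto simp: move_coeff_update_same)
  finally show "move s u m (unit_vec ls) js = (if ls ! u = ?S
    then fscale (move_coeff s u m ls) (unit_vec (ls[u := ?T])) else 0) js"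
    by (simp add: unit_vec_def)
qed

lemma move_coeff_residues:
  assumes "u < k" "cls n m = i" "pt u m = c"
  shows "move_coeff s u m (residues js) = (\<Prod>t\<in>other_factors k s u. ev t i (js t) (inverse c))"
  unfolding move_coeff_def assms(2,3)
proof (rule prod.cong[OF refl])
  fix t assume "t \<in> other_factors k s u"
  then have "t < k" using other_factors_cases assms(1) by blast
  then show "ev t i (residues js ! t) (inverse c) = ev t i (js t) (inverse c)"
    using ev_mod[of i] assms(2) cls_in_index by (auto simp: nth_residues)
qed

text \<open>At a basis tensor exactly one edge operator per factor is nonzero, namely the one across the
  edge that starts at the entry, and it occurs if this edge has class \<open>i\<close>.\<close>

lemma act_X_pure_tensor:
  fixes js :: "nat \<Rightarrow> int"
  assumes i: "i \<in> index_set n" and s: "s \<in> {1, -1}"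
  defines "b \<equiv> \<lambda>t. box N (js t)"
  shows "act (gen (X s i r)) (pure_tensor k b) =
     (\<Sum>u<k. fscale
        (\<Prod>t\<in>other_factors k s u. ev t i (js t) (inverse (box_delta \<tau> s (a u) (js u))))
        (pure_tensor k (b(u := box_x n L \<tau> (a u) s i r (js u)))))"
proof -
  let ?ls = "residues js"
  define m0 where "m0 = (\<lambda>u. if s = 1 then js u - 1 else js u)"
  have st: "src s (m0 u) = js u" "tgt s (m0 u) = (if s = 1 then js u - 1 else js u + 1)" for u
    by (auto simp: m0_def src_def tgt_def)
  let ?S = "{m. m \<in> {0..<int N} \<and> cls n m = i}"
  have fin: "finite ?S" by (rule finite_subset[of _ "{0..<int N}"]) auto
  have ci: "cls n i = i" using i cls_index by blast
  have srciff: "src s m mod int N = src s m' mod int N \<longleftrightarrow> m mod int N = m' mod int N" for m m'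
    by (simp add: src_def mod_eq_dvd_iff)
  have summand: "(\<Sum>m\<in>?S. pt u m powi r * move s u m (unit_vec ?ls) x)
    = fscale (\<Prod>t\<in>other_factors k s u. ev t i (js t) (inverse (box_delta \<tau> s (a u) (js u))))
        (pure_tensor k (b(u := box_x n L \<tau> (a u) s i r (js u)))) x" if u: "u < k" for u x
  proof -
    define m1 where "m1 = m0 u mod int N"
    have m1: "m1 \<in> ?S \<longleftrightarrow> cls n (m0 u) = i" using N_pos by (simp add: m1_def cls_mod)
    have supp: "box_supp n s i (js u) \<longleftrightarrow> cls n (m0 u) = i"
      by (auto simp: box_supp_def m0_def)
    have delta: "box_delta \<tau> s (a u) (js u) = pt u m1"
      by (simp add: box_delta_def qpow_of_int m1_def pt_mod) (simp add: pt_def m0_def)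
    have tgt1: "tgt s m1 mod int N = tgt s (m0 u) mod int N"
      by (simp add: m1_def tgt_def mod_simps)
    have mv: "move s u m (unit_vec ?ls) x = (if m = m1 then move_coeff s u m1 ?ls * unit_vec (?ls[u := tgt s m1 mod int N]) x else 0)"
      if "m \<in> ?S" for m
    proof -
      have "?ls ! u = src s m mod int N \<longleftrightarrow> src s (m0 u) mod int N = src s m mod int N"
        using u st by (simp add: nth_residues)
      also have "\<dots> \<longleftrightarrow> m = m1" unfolding srciff m1_def using that by auto
      finally show ?thesis unfolding move_unit_vec[OF residues_in_states u] by auto
    qed
    have "(\<Sum>m\<in>?S. pt u m powi r * move s u m (unit_vec ?ls) x)
      = (\<Sum>m\<in>?S. if m = m1 then pt u m1 powi r * (move_coeff s u m1 ?ls * unit_vec (?ls[u := tgt s m1 mod int N]) x) else 0)"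
      by (intro sum.cong refl) (simp add: mv)
    also have "\<dots> = (if cls n (m0 u) = i
        then pt u m1 powi r * (move_coeff s u m1 ?ls * unit_vec (?ls[u := tgt s m1 mod int N]) x) else 0)"
      using fin m1 by (simp only: sum.delta)
    also have "\<dots> = fscale (\<Prod>t\<in>other_factors k s u. ev t i (js t) (inverse (box_delta \<tau> s (a u) (js u))))
        (pure_tensor k (b(u := box_x n L \<tau> (a u) s i r (js u)))) x"
    proof (cases "cls n (m0 u) = i")
      case True
      have "b(u := box N (tgt s (m0 u))) = (\<lambda>t. box N ((js(u := tgt s (m0 u))) t))"
        by (auto simp: b_def)
      moreover have "residues (js(u := tgt s (m0 u))) = ?ls[u := tgt s m1 mod int N]"
        unfolding tgt1 by (rule nth_equalityI) (use u in \<open>auto simp: nth_residues nth_list_update\<close>)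
      ultimately have p: "pure_tensor k (b(u := box N (tgt s (m0 u)))) = unit_vec (?ls[u := tgt s m1 mod int N])"
        by (simp only: pure_tensor_box)
      have bx: "box_x n L \<tau> (a u) s i r (js u) = fscale (pt u m1 powi r) (box N (tgt s (m0 u)))"
        using True by (simp add: box_x_def supp delta st(2) N_def)
      have "cls n m1 = i" using True by (simp add: m1_def cls_mod)
      then have "move_coeff s u m1 ?ls = (\<Prod>t\<in>other_factors k s u. ev t i (js t) (inverse (box_delta \<tau> s (a u) (js u))))"
        using move_coeff_residues[OF u _ delta[symmetric]] by simp
      then show ?thesis unfolding bx pure_tensor_scale[OF u] p using True
        by (simp add: mult.left_commute)
    next
      case False
      then have "box_x n L \<tau> (a u) s i r (js u) = 0" by (simp add: box_x_def supp)
      then show ?thesis using False pure_tensor_zero[OF u] by simp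
    qed
    finally show ?thesis .
  qed
  show ?thesis
  proof
    fix x
    have "act (gen (X s i r)) (pure_tensor k b) x
      = (\<Sum>u<k. \<Sum>m\<in>?S. pt u m powi r * move s u m (unit_vec ?ls) x)"
      unfolding act_X[OF i s] b_def pure_tensor_box X_op_def sum_edges by simp
    also have "\<dots> = (\<Sum>u<k. fscale
        (\<Prod>t\<in>other_factors k s u. ev t i (js t) (inverse (box_delta \<tau> s (a u) (js u))))
        (pure_tensor k (b(u := box_x n L \<tau> (a u) s i r (js u)))) x)"
      by (intro sum.cong refl) (simp only: lessThan_iff summand)
    finally show "act (gen (X s i r)) (pure_tensor k b) x = (\<Sum>u<k. fscale
        (\<Prod>t\<in>other_factors k s u. ev t i (js t) (inverse (box_delta \<tau> s (a u) (js u))))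
        (pure_tensor k (b(u := box_x n L \<tau> (a u) s i r (js u))))) x"
      by (simp only: sum_fun_apply)
  qed
qed

lemma act_diag_unit_vec: "diag p d \<Longrightarrow> act p (unit_vec ls) = fscale (d ls) (unit_vec ls)"
  by (rule ext) (simp add: act_diag unit_vec_def)

lemma K_eigenvalue_residues: "K_eigenvalue h (residues js) =
    (\<Prod>t<k. qpow \<tau> (fund_weight (cls n (js t)) h - fund_weight (cls n (js t - 1)) h))"
  by (simp add: K_eigenvalue_def nth_residues fund_weight_def cls_mod cls_mod_diff)

subsection \<open>Expansions at zero and at infinity\<close>

text \<open>The functions that \<open>geom\<close> expands at 0; for \<open>\<sigma> \<noteq> 1\<close> the variable is the inverse of the
  original one, and the formula removes the singularity.\<close>

definition geom_fun :: "int \<Rightarrow> complex \<Rightarrow> complex \<Rightarrow> complex"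
  where "geom_fun \<sigma> p z = (if \<sigma> = 1 then 1 / (1 - p * z) else z / (z - p))"

lemma geom_fun_expansion:
  assumes p: "p \<noteq> 0"
  shows "geom_fun \<sigma> p has_fps_expansion geom \<sigma> p"
proof (cases "\<sigma> = 1")
  case True
  have "(1 - fps_const p * fps_X) * geom \<sigma> p = 1"
    using geom_eq[OF p, of \<sigma>] True by (simp add: numer_def denom_def)
  then have "geom \<sigma> p = inverse (1 - fps_const p * fps_X)"
    by (metis fps_inverse_unique)
  then show ?thesis using True has_fps_expansion_geometric[of p] by (simp add: geom_fun_def[abs_def])
next
  case False
  have "(fps_X - fps_const p) * geom \<sigma> p = fps_X"
    using geom_eq[OF p, of \<sigma>] False by (simp add: numer_def denom_def)
  moreover have u: "fps_nth (fps_X - fps_const p) 0 \<noteq> 0" using p by simp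
  ultimately have "geom \<sigma> p = fps_X * inverse (fps_X - fps_const p)"
    by (metis inverse_mult_eq_1 mult.assoc mult.commute mult.right_neutral)
  moreover have "(\<lambda>z. z * inverse (z - p)) has_fps_expansion fps_X * inverse (fps_X - fps_const p)"
    using u by (intro fps_expansion_intros) auto
  ultimately show ?thesis using False by (simp add: geom_fun_def[abs_def] divide_inverse)
qed

definition box_fun :: "int \<Rightarrow> nat \<Rightarrow> int \<Rightarrow> int \<Rightarrow> complex \<Rightarrow> complex"
  where "box_fun \<sigma> t i j z =
    (if cls n i = cls n j then 1 / e + (e - 1 / e) * geom_fun \<sigma> (pt t j) z
     else if cls n i = cls n (j - 1) then e + (1 / e - e) * geom_fun \<sigma> (pt t (j - 1)) z
     else 1)"

lemma box_fun_expansion: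
  assumes "t < k"
  shows "box_fun \<sigma> t i j has_fps_expansion box_series (geom \<sigma>) t i j"
proof -
  have A: "(\<lambda>z. c + d * geom_fun \<sigma> (pt t m) z) has_fps_expansion fps_const c + fps_const d * geom \<sigma> (pt t m)"
    for c d m
    by (intro fps_expansion_intros geom_fun_expansion pt_nz assms)
  consider "cls n i = cls n j" | "cls n i \<noteq> cls n j" "cls n i = cls n (j - 1)"
    | "cls n i \<noteq> cls n j" "cls n i \<noteq> cls n (j - 1)" by blast
  then show ?thesis
  proof cases
    case 1
    show ?thesis unfolding box_fun_def[abs_def] box_series_def if_P[OF 1] by (rule A)
  next
    case 2
    show ?thesis unfolding box_fun_def[abs_def] box_series_def if_not_P[OF 2(1)] if_P[OF 2(2)] by (rule A)
  next
    case 3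
    then show ?thesis by (simp add: box_fun_def[abs_def] box_series_def)
  qed
qed

lemma ev_eq_box_fun:
  assumes i: "i \<in> index_set n"
    and z: "\<And>m. m \<in> {j, j - 1} \<Longrightarrow> pt t m * z \<noteq> 1 \<and> pt t m \<noteq> z" "z \<noteq> 0"
  shows "\<sigma> = 1 \<Longrightarrow> ev t i j z = box_fun \<sigma> t i j z"
    and "\<sigma> \<noteq> 1 \<Longrightarrow> ev t i j (inverse z) = box_fun \<sigma> t i j z"
proof -
  have A: "(e - 1 / e * x) / (1 - x) = 1 / e + (e - 1 / e) * (1 / (1 - x))"
    "(1 / e - e * x) / (1 - x) = e + (1 / e - e) * (1 / (1 - x))" if "x \<noteq> 1" for x
    using that by (simp_all add: field_simps)
  have B: "1 / (1 - p * inverse z) = z / (z - p)" for p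
    using z(2) by (simp add: field_simps)
  have ne: "pt t j * z \<noteq> 1" "pt t (j - 1) * z \<noteq> 1" "pt t j * inverse z \<noteq> 1" "pt t (j - 1) * inverse z \<noteq> 1"
    using z(1)[of j] z(1)[of "j - 1"] z(2) by (auto simp: field_simps)
  show "ev t i j z = box_fun \<sigma> t i j z" if "\<sigma> = 1"
    unfolding ev_eq[OF i] box_fun_def geom_fun_def if_P[OF that] A[OF ne(1)] A[OF ne(2)] ..
  show "ev t i j (inverse z) = box_fun \<sigma> t i j z" if "\<sigma> \<noteq> 1"
    unfolding ev_eq[OF i] box_fun_def geom_fun_def if_not_P[OF that] A[OF ne(3)] A[OF ne(4)] B ..
qed

lemma eventually_ne: "\<forall>\<^sub>F z in at 0. p * z \<noteq> 1 \<and> p \<noteq> z \<and> z \<noteq> 0" if "p \<noteq> 0" for p :: complex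
proof -
  have "\<forall>\<^sub>F z in at 0. p * z \<noteq> 1"
  proof -
    have "((\<lambda>z. p * z) \<longlongrightarrow> p * 0) (at 0)" by (intro tendsto_intros)
    then show ?thesis by (rule tendsto_imp_eventually_ne) simp
  qed
  moreover have "\<forall>\<^sub>F z in at 0. z \<noteq> p"
    by (rule tendsto_imp_eventually_ne[OF tendsto_ident_at]) (use that in auto)
  moreover have "\<forall>\<^sub>F z::complex in at 0. z \<noteq> 0" by (rule eventually_neq_at_within)
  ultimately show ?thesis by eventually_elim auto
qed

lemma phi_series_residues: "phi_series \<sigma> i (residues js) = (\<Prod>t<k. box_series (geom \<sigma>) t i (js t))"
  by (simp add: phi_series_def nth_residues box_series_mod)

text \<open>A Laurent expansion depends only on the values near, and not at, the centre, where each
  factor agrees with a function \<open>box_fun\<close> that is analytic there.\<close>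

lemma laurent_expansion_phi_series:
  assumes i: "i \<in> index_set n"
  shows "\<sigma> = 1 \<Longrightarrow> (\<lambda>z. \<Prod>t<k. ev t i (js t) z) has_laurent_expansion fps_to_fls (phi_series \<sigma> i (residues js))"
    and "\<sigma> \<noteq> 1 \<Longrightarrow> (\<lambda>z. \<Prod>t<k. ev t i (js t) (inverse z)) has_laurent_expansion fps_to_fls (phi_series \<sigma> i (residues js))"
proof -
  have ex: "(\<lambda>z. \<Prod>t<k. box_fun \<sigma> t i (js t) z) has_laurent_expansion fps_to_fls (phi_series \<sigma> i (residues js))"
    unfolding phi_series_residues by (intro has_laurent_expansion_fps has_fps_expansion_prod box_fun_expansion) simp
  have "\<forall>\<^sub>F z in at 0. \<forall>t\<in>{..<k}. \<forall>m\<in>{js t, js t - 1}. pt t m * z \<noteq> 1 \<and> pt t m \<noteq> z \<and> z \<noteq> 0"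
    by (intro eventually_ball_finite ballI eventually_ne pt_nz) auto
  moreover have "\<forall>\<^sub>F z::complex in at 0. z \<noteq> 0" by (rule eventually_neq_at_within)
  ultimately have ev: "\<forall>\<^sub>F z in at 0. z \<noteq> 0 \<and> (\<forall>t\<in>{..<k}. \<forall>m\<in>{js t, js t - 1}. pt t m * z \<noteq> 1 \<and> pt t m \<noteq> z)"
    by eventually_elim blast
  show "(\<lambda>z. \<Prod>t<k. ev t i (js t) z) has_laurent_expansion fps_to_fls (phi_series \<sigma> i (residues js))" if "\<sigma> = 1"
  proof -
    have "\<forall>\<^sub>F z in at 0. (\<Prod>t<k. ev t i (js t) z) = (\<Prod>t<k. box_fun \<sigma> t i (js t) z)"
      using ev by eventually_elim (intro prod.cong refl ev_eq_box_fun(1)[OF i _ _ that]; blast)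
    from has_laurent_expansion_cong[OF this refl] ex show ?thesis by (rule iffD2)
  qed
  show "(\<lambda>z. \<Prod>t<k. ev t i (js t) (inverse z)) has_laurent_expansion fps_to_fls (phi_series \<sigma> i (residues js))" if "\<sigma> \<noteq> 1"
  proof -
    have "\<forall>\<^sub>F z in at 0. (\<Prod>t<k. ev t i (js t) (inverse z)) = (\<Prod>t<k. box_fun \<sigma> t i (js t) z)"
      using ev by eventually_elim (intro prod.cong refl ev_eq_box_fun(2)[OF i _ _ that]; blast)
    from has_laurent_expansion_cong[OF this refl] ex show ?thesis by (rule iffD2)
  qed
qed

lemma drinfeld_action_act: "drinfeld_action n L \<tau> k a act"
proof -
  have phi1: "act (phi \<tau> 1 i (int m)) (unit_vec ls) = fscale (fps_nth (phi_series 1 i ls) m) (unit_vec ls)"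
    if "i \<in> index_set n" for i m ls
    using act_diag_unit_vec[OF diag_phi[OF that, of 1 "int m"]] by (simp add: phi_coeff_def)
  have phi2: "act (phi \<tau> (-1) i (- int m)) (unit_vec ls) = fscale (fps_nth (phi_series (-1) i ls) m) (unit_vec ls)"
    if "i \<in> index_set n" for i m ls
    using act_diag_unit_vec[OF diag_phi[OF that, of "-1" "- int m"]] by (simp add: phi_coeff_def)
  show ?thesis
    unfolding drinfeld_action_def Let_def N_def[symmetric]
  proof (intro allI conjI ballI)
    fix js :: "nat \<Rightarrow> int" and i s r :: int assume "i \<in> index_set n" "s \<in> {1, -1}"
    then show "act (gen (X s i r)) (pure_tensor k (\<lambda>t. box N (js t))) =
       (\<Sum>u<k. fscale
          (\<Prod>t\<in>other_factors k s u. ev t i (js t) (inverse (box_delta \<tau> s (a u) (js u))))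
          (pure_tensor k ((\<lambda>t. box N (js t))(u := box_x n L \<tau> (a u) s i r (js u)))))"
      by (rule act_X_pure_tensor)
  next
    fix js :: "nat \<Rightarrow> int" and h :: "int \<Rightarrow> rat" assume "h \<in> cartan_space n"
    then show "act (gen (K h)) (pure_tensor k (\<lambda>t. box N (js t))) = fscale
           (\<Prod>t<k. qpow \<tau> (fund_weight (cls n (js t)) h - fund_weight (cls n (js t - 1)) h))
           (pure_tensor k (\<lambda>t. box N (js t)))"
      unfolding pure_tensor_box K_eigenvalue_residues[symmetric] by (intro act_diag_unit_vec diag_K)
  next
    fix js :: "nat \<Rightarrow> int" and i :: int assume i: "i \<in> index_set n"
    show "\<exists>A. (\<lambda>z. \<Prod>t<k. ev t i (js t) z) has_laurent_expansion fps_to_fls A \<and>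
            (\<forall>m. act (phi \<tau> 1 i (int m)) (pure_tensor k (\<lambda>t. box N (js t))) =
                 fscale (fps_nth A m) (pure_tensor k (\<lambda>t. box N (js t))))"
      unfolding pure_tensor_box using laurent_expansion_phi_series(1)[OF i, of 1 js] phi1[OF i] by blast
    show "\<exists>A. (\<lambda>z. \<Prod>t<k. ev t i (js t) (inverse z)) has_laurent_expansion fps_to_fls A \<and>
            (\<forall>m. act (phi \<tau> (-1) i (- int m)) (pure_tensor k (\<lambda>t. box N (js t))) =
                 fscale (fps_nth A m) (pure_tensor k (\<lambda>t. box N (js t))))"
      unfolding pure_tensor_box using laurent_expansion_phi_series(2)[OF i, of "-1" js] phi2[OF i] by force
  qed
qed

lemma drinfeld_pole_free: "drinfeld_pole_free n \<tau> k a"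
  unfolding drinfeld_pole_free_def
proof (intro allI ballI impI)
  fix js :: "nat \<Rightarrow> int" and i s u t
  assume u: "u < k" and t: "t \<in> other_factors k s u" and supp: "box_supp n s i (js u)"
  define m where "m = (if s = 1 then js u - 1 else js u)"
  have "i = cls n m" using supp by (auto simp: box_supp_def m_def)
  moreover have "box_delta \<tau> s (a u) (js u) = pt u m"
    by (simp add: box_delta_def qpow_of_int pt_def m_def)
  moreover have "t < k" "t \<noteq> u" using other_factors_cases[OF u t] by auto
  ultimately show "\<not> is_pole (box_phi n \<tau> (a t) i (js t)) (inverse (box_delta \<tau> s (a u) (js u)))"
    using ev_not_pole u by simp
qed

section \<open>Uniqueness of the module structure\<close>

definition agree :: "(tor_gen free_algebra \<Rightarrow> (int list \<Rightarrow> complex) \<Rightarrow> int list \<Rightarrow> complex) \<Rightarrow>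
    tor_gen free_algebra \<Rightarrow> bool"
  where "agree act' p \<longleftrightarrow> (\<forall>v\<in>tensors. act' p v = act p v)"

context
  fixes act' :: "tor_gen free_algebra \<Rightarrow> (int list \<Rightarrow> complex) \<Rightarrow> int list \<Rightarrow> complex"
  assumes pm': "presented_module (toroidal_relators n \<tau>) tensors act'"
    and da': "drinfeld_action n L \<tau> k a act'"
begin

lemma act'_simps:
  assumes "v \<in> tensors"
  shows "act' (scalar c) v = fscale c v" "act' (p + q) v = act' p v + act' q v"
    "act' (p * q) v = act' p (act' q v)" "p \<in> two_sided_ideal (toroidal_relators n \<tau>) \<Longrightarrow> act' p v = 0"
  using pm' assms unfolding presented_module_def by blast+

lemma act'_linear:
  assumes "v \<in> tensors" "w \<in> tensors"
  shows "act' p v \<in> tensors" "act' p (v + w) = act' p v + act' p w" "act' p (fscale c v) = fscale c (act' p v)"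
  using pm' assms unfolding presented_module_def linear_on_def by blast+

lemma agree_scalar: "agree act' (scalar c)"
  by (simp add: agree_def act'_simps(1) act_scalar)

lemma agree_add: "agree act' p \<Longrightarrow> agree act' q \<Longrightarrow> agree act' (p + q)"
  by (simp add: agree_def act'_simps(2) act_add)

lemma agree_mult: "agree act' p \<Longrightarrow> agree act' q \<Longrightarrow> agree act' (p * q)"
  by (simp add: agree_def act'_simps(3) act_mult act_in_tensors)

lemma agree_0: "agree act' 0" and agree_1: "agree act' 1"
  using agree_scalar[of 0] agree_scalar[of 1] by (simp_all add: scalar_def)

lemma agree_sum: "(\<And>x. x \<in> A \<Longrightarrow> agree act' (f x)) \<Longrightarrow> agree act' (\<Sum>x\<in>A. f x)"
  by (induction A rule: infinite_finite_induct) (auto intro: agree_0 agree_add)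

lemma agree_diff: "agree act' p \<Longrightarrow> agree act' q \<Longrightarrow> agree act' (p - q)"
proof -
  assume p: "agree act' p" and q: "agree act' q"
  have "p - q = p + scalar (-1) * q"
  proof -
    have "scalar (-1) = (- 1 :: tor_gen free_algebra)" by (simp only: scalar_def single_uminus single_one)
    then show ?thesis by simp
  qed
  then show ?thesis using agree_add[OF p agree_mult[OF agree_scalar[of "-1"] q]] by (simp only:)
qed

text \<open>Both actions are linear and the basis tensors span.\<close>

lemma agree_unit_vec:
  assumes "\<And>ls. ls \<in> states N k \<Longrightarrow> act' p (unit_vec ls) = act p (unit_vec ls)"
  shows "agree act' p"
  unfolding agree_def
proof
  fix v assume v: "v \<in> tensors"
  have pm: "presented_module (toroidal_relators n \<tau>) tensors act" by (rule presented_module_act)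
  let ?W = "{v \<in> tensors. act' p v = act p v}"
  have lin: "act p (v + w) = act p v + act p w" "act p (fscale c v) = fscale c (act p v)"
    if "v \<in> tensors" "w \<in> tensors" for v w c
    using pm that unfolding presented_module_def linear_on_def by blast+
  have V: "fs.subspace tensors" by (rule subspace_tensor_space)
  have zero: "0 \<in> tensors" by (rule fs.subspace_0[OF V])
  have "fs.subspace ?W"
  proof (rule fs.subspaceI)
    have "act' p (fscale 0 0) = act p (fscale 0 0)"
      using act'_linear(3)[OF zero zero, of p 0] lin(2)[OF zero zero, of 0] by (metis fs.scale_zero_left)
    then show "0 \<in> ?W" using zero by (simp only: mem_Collect_eq fs.scale_zero_left)
  next
    fix x y assume "x \<in> ?W" "y \<in> ?W"
    then show "x + y \<in> ?W"
      using fs.subspace_add[OF V] act'_linear(2)[of x y p] lin(1)[of x y] by simp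
  next
    fix c x assume "x \<in> ?W"
    then show "fscale c x \<in> ?W"
      using fs.subspace_scale[OF V] act'_linear(3)[of x x p c] lin(2)[of x x c] by simp
  qed
  then have "fs.span (unit_vec ` states N k) \<subseteq> ?W"
    by (intro fs.span_minimal) (auto intro: unit_vec_in_tensor_space assms)
  then show "act' p v = act p v" using v unfolding span_unit_vec by blast
qed

lemma agree_X:
  assumes "i \<in> index_set n" "s \<in> {1, -1}"
  shows "agree act' (gen (X s i r))"
proof (rule agree_unit_vec)
  fix ls assume ls: "ls \<in> states N k"
  let ?b = "\<lambda>t. box N (ls ! t)"
  have b: "pure_tensor k ?b = unit_vec ls" using pure_tensor_box[of "(!) ls"] residues_nth[OF ls] by simp
  have "f (gen (X s i r)) (pure_tensor k ?b) =
       (\<Sum>u<k. fscale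
          (\<Prod>t\<in>other_factors k s u. ev t i (ls ! t) (inverse (box_delta \<tau> s (a u) (ls ! u))))
          (pure_tensor k (?b(u := box_x n L \<tau> (a u) s i r (ls ! u)))))"
    if "drinfeld_action n L \<tau> k a f" for f
    using that[unfolded drinfeld_action_def Let_def N_def[symmetric], rule_format, of "(!) ls"] assms by blast
  from this[OF da'] this[OF drinfeld_action_act]
  show "act' (gen (X s i r)) (unit_vec ls) = act (gen (X s i r)) (unit_vec ls)"
    unfolding b by simp
qed

lemma agree_K:
  assumes "h \<in> cartan_space n"
  shows "agree act' (gen (K h))"
proof (rule agree_unit_vec)
  fix ls assume ls: "ls \<in> states N k"
  let ?b = "\<lambda>t. box N (ls ! t)"
  have b: "pure_tensor k ?b = unit_vec ls" using pure_tensor_box[of "(!) ls"] residues_nth[OF ls] by simp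
  have "f (gen (K h)) (pure_tensor k ?b) = fscale
           (\<Prod>t<k. qpow \<tau> (fund_weight (cls n (ls ! t)) h - fund_weight (cls n (ls ! t - 1)) h))
           (pure_tensor k ?b)"
    if "drinfeld_action n L \<tau> k a f" for f
    using that[unfolded drinfeld_action_def Let_def N_def[symmetric], rule_format, of "(!) ls"] assms by blast
  from this[OF da'] this[OF drinfeld_action_act]
  show "act' (gen (K h)) (unit_vec ls) = act (gen (K h)) (unit_vec ls)"
    unfolding b by simp
qed

text \<open>Both actions prescribe the eigenvalues by a Laurent expansion of one and the same function, and
  such expansions are unique.\<close>

lemma agree_phi:
  assumes i: "i \<in> index_set n" and s: "\<sigma> \<in> {1, -1}"
  shows "agree act' (phi \<tau> \<sigma> i (\<sigma> * int m))"
proof (rule agree_unit_vec)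
  fix ls assume ls: "ls \<in> states N k"
  let ?b = "\<lambda>t. box N (ls ! t)"
  have b: "pure_tensor k ?b = unit_vec ls" using pure_tensor_box[of "(!) ls"] residues_nth[OF ls] by simp
  let ?F = "\<lambda>z. \<Prod>t<k. ev t i (ls ! t) z"
  have ex: "\<exists>A. ?F has_laurent_expansion fps_to_fls A \<and>
        (\<forall>m. f (phi \<tau> 1 i (int m)) (unit_vec ls) = fscale (fps_nth A m) (unit_vec ls))"
     "\<exists>A. (\<lambda>z. ?F (inverse z)) has_laurent_expansion fps_to_fls A \<and>
        (\<forall>m. f (phi \<tau> (-1) i (- int m)) (unit_vec ls) = fscale (fps_nth A m) (unit_vec ls))"
    if "drinfeld_action n L \<tau> k a f" for f
    using that[unfolded drinfeld_action_def Let_def N_def[symmetric], rule_format, of "(!) ls", unfolded b] i by blast+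
  from s consider "\<sigma> = 1" | "\<sigma> = -1" by auto
  then show "act' (phi \<tau> \<sigma> i (\<sigma> * int m)) (unit_vec ls) = act (phi \<tau> \<sigma> i (\<sigma> * int m)) (unit_vec ls)"
  proof cases
    case 1
    obtain A B where A: "?F has_laurent_expansion fps_to_fls A"
      "\<And>m. act' (phi \<tau> 1 i (int m)) (unit_vec ls) = fscale (fps_nth A m) (unit_vec ls)"
      and B: "?F has_laurent_expansion fps_to_fls B"
      "\<And>m. act (phi \<tau> 1 i (int m)) (unit_vec ls) = fscale (fps_nth B m) (unit_vec ls)"
      using ex(1)[OF da'] ex(1)[OF drinfeld_action_act] by blast
    from has_laurent_expansion_unique[OF A(1) B(1)] have "A = B" by simp
    then show ?thesis using A(2) B(2) 1 by simp
  next
    case 2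
    obtain A B where A: "(\<lambda>z. ?F (inverse z)) has_laurent_expansion fps_to_fls A"
      "\<And>m. act' (phi \<tau> (-1) i (- int m)) (unit_vec ls) = fscale (fps_nth A m) (unit_vec ls)"
      and B: "(\<lambda>z. ?F (inverse z)) has_laurent_expansion fps_to_fls B"
      "\<And>m. act (phi \<tau> (-1) i (- int m)) (unit_vec ls) = fscale (fps_nth B m) (unit_vec ls)"
      using ex(2)[OF da'] ex(2)[OF drinfeld_action_act] by blast
    from has_laurent_expansion_unique[OF A(1) B(1)] have "A = B" by simp
    then show ?thesis using A(2) B(2) 2 by simp
  qed
qed

lemma agree_power:
  assumes "\<And>j. j < l \<Longrightarrow> agree act' (fps_nth S j)"
  shows "j < l \<Longrightarrow> agree act' (fps_nth (S ^ p) j)"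
proof (induction p arbitrary: j)
  case 0
  then show ?case using agree_0 agree_1 by (cases j) simp_all
next
  case (Suc p)
  show ?case unfolding power_Suc fps_mult_nth
    using Suc assms by (intro agree_sum agree_mult) auto
qed

text \<open>For a series without constant term, a coefficient of degree \<open>l\<close> of any power except the first
  involves only coefficients of degree below \<open>l\<close>.\<close>

lemma agree_power_top:
  assumes S: "\<And>j. j < l \<Longrightarrow> agree act' (fps_nth S j)" and S0: "fps_nth S 0 = 0" and p: "p \<noteq> 1"
  shows "agree act' (fps_nth (S ^ p) l)"
proof (cases p)
  case 0
  then show ?thesis using agree_0 agree_1 by (cases l) simp_all
next
  case (Suc p')
  then have p': "p' > 0" using p by simp
  have "agree act' (fps_nth S j * fps_nth (S ^ p') (l - j))" if "j \<le> l" for j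
  proof -
    consider "j = 0" | "j = l" | "0 < j" "j < l" using \<open>j \<le> l\<close> by linarith
    then show ?thesis
    proof cases
      case 1
      then show ?thesis using S0 agree_0 by simp
    next
      case 2
      obtain p'' where "p' = Suc p''" using p' gr0_implies_Suc by blast
      then have "fps_nth (S ^ p') 0 = 0" using S0 by simp
      then show ?thesis using 2 agree_0 by simp
    next
      case 3
      then show ?thesis using agree_power[OF S] S by (intro agree_mult) auto
    qed
  qed
  then show ?thesis unfolding Suc power_Suc fps_mult_nth by (intro agree_sum) auto
qed

text \<open>The coefficient of degree \<open>l\<close> of \<open>\<phi>\<^sub>i\<close> is \<open>k\<^sub>i\<close>, or its inverse, times the sum of the
  \<open>l\<close>-th coefficient of the exponent and a polynomial in the lower ones.  Cancelling the invertible
  element and subtracting the polynomial gives the recursion.\<close>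

lemma agree_h_series:
  assumes i: "i \<in> index_set n" and s: "\<sigma> \<in> {1, -1}"
  shows "agree act' (fps_nth (h_series \<tau> \<sigma> i) l)"
proof (induction l rule: less_induct)
  case (less l)
  let ?S = "h_series \<tau> \<sigma> i"
  have S0: "fps_nth ?S 0 = 0" by (simp add: h_series_def)
  show ?case
  proof (cases "l = 0")
    case True
    then show ?thesis using S0 agree_0 by simp
  next
    case False
    let ?h = "\<lambda>j. if j = i then of_int \<sigma> else (0 :: rat)"
    have h: "?h \<in> cartan_space n" by (rule unit_in_cartan_space[OF i])
    let ?E = "fps_nth (fps_exp_nc ?S) l"
    have phi: "phi \<tau> \<sigma> i (\<sigma> * int l) = gen (K ?h) * ?E"
      using s by (auto simp: phi_def)
    \<comment> \<open>the eigenvalues of the leading element are nonzero, so it can be cancelled\<close>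
    have E: "agree act' ?E" unfolding agree_def
    proof
      fix v assume v: "v \<in> tensors"
      have in1: "act' ?E v \<in> tensors" by (rule act'_linear(1)[OF v v])
      have "act' (gen (K ?h)) (act' ?E v) = act' (phi \<tau> \<sigma> i (\<sigma> * int l)) v"
        unfolding phi by (simp only: act'_simps(3)[OF v])
      also have "\<dots> = act (phi \<tau> \<sigma> i (\<sigma> * int l)) v"
        using agree_phi[OF i s] v by (simp add: agree_def)
      also have "\<dots> = act (gen (K ?h)) (act ?E v)" unfolding phi by (simp only: act_mult)
      finally have "act (gen (K ?h)) (act' ?E v) = act (gen (K ?h)) (act ?E v)"
        using agree_K[OF h] in1 by (simp add: agree_def)
      then have "K_eigenvalue ?h js * act' ?E v js = K_eigenvalue ?h js * act ?E v js" for js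
        unfolding act_diag[OF diag_K[OF h]] by (rule fun_cong)
      then show "act' ?E v = act ?E v" using K_eigenvalue_nz by (intro ext) (metis mult_left_cancel)
    qed
    let ?t = "\<lambda>p. scalar (1 / fact p) * fps_nth (?S ^ p) l"
    have "{..l} = insert 1 ({..l} - {1})" using False by auto
    then have "?E = (\<Sum>p\<in>insert 1 ({..l} - {1}). ?t p)" by (simp add: fps_exp_nc_def)
    also have "\<dots> = ?t 1 + (\<Sum>p\<in>{..l} - {1}. ?t p)" by (rule sum.insert) auto
    also have "?t 1 = fps_nth ?S l"
    proof -
      have "(scalar 1 :: tor_gen free_algebra) = 1" by (simp add: scalar_def)
      then show ?thesis by simp
    qed
    finally have "fps_nth ?S l = ?E - (\<Sum>p\<in>{..l} - {1}. ?t p)" by simp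
    moreover have "agree act' (\<Sum>p\<in>{..l} - {1}. ?t p)"
      by (intro agree_sum agree_mult agree_scalar agree_power_top less S0) auto
    ultimately show ?thesis using agree_diff[OF E] by (simp only:)
  qed
qed

lemma agree_H:
  assumes i: "i \<in> index_set n" and m: "m \<noteq> 0"
  shows "agree act' (gen (H i m))"
proof -
  define \<sigma> where "\<sigma> = (if m > 0 then 1 else -1 :: int)"
  define l where "l = nat \<bar>m\<bar>"
  have s: "\<sigma> \<in> {1, -1}" and l: "l \<noteq> 0" "\<sigma> * int l = m" using m by (auto simp: \<sigma>_def l_def)
  define c where "c = of_int \<sigma> * (e - 1 / e)"
  have c: "c \<noteq> 0" using e_diff_nz s by (auto simp: c_def)
  have "fps_nth (h_series \<tau> \<sigma> i) l = scalar c * gen (H i m)"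
    using l by (simp add: h_series_def c_def)
  then have "scalar (1 / c) * fps_nth (h_series \<tau> \<sigma> i) l = scalar (1 / c) * scalar c * gen (H i m)"
    by (simp add: mult.assoc)
  also have "scalar (1 / c) * scalar c = (1 :: tor_gen free_algebra)"
    using c by (simp add: scalar_def mult_single)
  finally have "gen (H i m) = scalar (1 / c) * fps_nth (h_series \<tau> \<sigma> i) l" by simp
  then show ?thesis using agree_mult[OF agree_scalar agree_h_series[OF i s]] by metis
qed

lemma agree_gen: "agree act' (gen g)"
proof (cases "is_generator n g")
  case True
  then show ?thesis by (cases g) (auto intro: agree_K agree_H agree_X)
next
  case False
  then have R: "gen g \<in> toroidal_relators n \<tau>" by (rule toroidal_relators.no_generator)
  have "1 * gen g * 1 \<in> two_sided_ideal (toroidal_relators n \<tau>)" by (rule two_sided_ideal.mult[OF R])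
  then have "gen g \<in> two_sided_ideal (toroidal_relators n \<tau>)" by simp
  then show ?thesis unfolding agree_def using act'_simps(4) act_relator[OF R] by simp
qed

lemma agree_all: "agree act' p"
  by (induction p rule: free_algebra_induct) (auto intro: agree_scalar agree_gen agree_add agree_mult)

end

section \<open>Irreducibility\<close>

context
  fixes W :: "(int list \<Rightarrow> complex) set"
  assumes WV: "W \<subseteq> tensors" and sub: "module.subspace fscale W"
    and stable: "\<And>p w. w \<in> W \<Longrightarrow> act p w \<in> W"
begin

lemma W_support: "w \<in> W \<Longrightarrow> w js \<noteq> 0 \<Longrightarrow> js \<in> states N k"
  using subsetD[OF WV] tensor_space_iff by blast

lemma W_unscale: "c \<noteq> 0 \<Longrightarrow> fscale c w \<in> W \<Longrightarrow> w \<in> W"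
  using fs.subspace_scale[OF sub, of "fscale c w" "1 / c"] by simp

lemma act_sum: "act (\<Sum>x\<in>A. f x) v js = (\<Sum>x\<in>A. act (f x) v js)"
  by (induction A rule: infinite_finite_induct) (auto simp: act_at)

text \<open>Interpolation: a polynomial that vanishes at the points of all edges of the class except one
  gives a combination of the \<open>x\<^sub>i\<^sub>,\<^sub>r\<close> that acts as a nonzero multiple of one edge operator.\<close>

lemma W_move:
  assumes u: "u < k" and s: "s \<in> {1, -1}" and w: "w \<in> W"
  shows "move s u m w \<in> W"
proof -
  define i where "i = cls n m"
  define x where "x = (u, m mod int N)"
  have x: "x \<in> edges i" using u N_pos by (auto simp: x_def edges_def i_def cls_mod)
  have mx: "move s u m w = mv s x w"
  proof -
    have "tgt s (m mod int N) mod int N = tgt s m mod int N" "src s (m mod int N) mod int N = src s m mod int N"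
      by (simp_all add: tgt_def src_def mod_simps)
    then show ?thesis by (simp add: fun_eq_iff move_def x_def move_coeff_def pt_mod cls_mod)
  qed
  define C where "C = cc ` (edges i - {x})"
  define P where "P = (\<Prod>c\<in>C. [:- c, 1:])"
  have finC: "finite C" by (simp add: C_def)
  have P: "poly P z = (\<Prod>c\<in>C. z - c)" for z by (simp add: P_def poly_prod)
  have P0: "poly P (cc y) = 0" if "y \<in> edges i" "y \<noteq> x" for y
    unfolding P using that finC by (intro prod_zero) (auto simp: C_def)
  have Px: "poly P (cc x) \<noteq> 0"
  proof
    assume "poly P (cc x) = 0"
    then obtain c where "c \<in> C" "cc x = c" unfolding P using finC by (auto simp: prod_zero_iff)
    then obtain y where "y \<in> edges i" "y \<noteq> x" "cc x = cc y" by (auto simp: C_def)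
    then show False using edge_points_ne[of y i x 0] x by simp
  qed
  define p where "p = (\<Sum>r\<le>degree P. scalar (coeff P r) * gen (X s i (int r)))"
  have "act p w = fscale (poly P (cc x)) (mv s x w)"
  proof
    fix js
    have i: "i \<in> index_set n" by (simp add: i_def)
    have "act p w js = (\<Sum>r\<le>degree P. coeff P r * (\<Sum>y\<in>edges i. cc y powi int r * mv s y w js))"
      unfolding p_def act_sum by (simp add: act_at act_X[OF i s] X_op_def)
    also have "\<dots> = (\<Sum>y\<in>edges i. poly P (cc y) * mv s y w js)"
      unfolding sum_distrib_left by (subst sum.swap) (simp add: poly_altdef sum_distrib_right mult.assoc)
    also have "\<dots> = (\<Sum>y\<in>edges i. if y = x then poly P (cc x) * mv s x w js else 0)"
      by (intro sum.cong refl) (auto simp: P0)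
    also have "\<dots> = poly P (cc x) * mv s x w js" using x by (simp add: sum.delta)
    finally show "act p w js = fscale (poly P (cc x)) (mv s x w) js" by simp
  qed
  then have "fscale (poly P (cc x)) (mv s x w) \<in> W" using stable[OF w] by metis
  then show ?thesis unfolding mx by (rule W_unscale[OF Px])
qed

text \<open>Lowering after raising across the edge that ends at the wanted entry multiplies by a nonzero
  number the tensors with this entry, and kills the others.\<close>

lemma W_project:
  assumes w: "w \<in> W" and js0: "js0 \<in> states N k" "w js0 \<noteq> 0"
  shows "l \<le> k \<Longrightarrow> \<exists>w'\<in>W. w' js0 \<noteq> 0 \<and> (\<forall>js. w' js \<noteq> 0 \<longrightarrow> (\<forall>t<l. js ! t = js0 ! t))"
proof (induction l)
  case 0
  then show ?case using w js0 by auto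
next
  case (Suc l)
  then obtain w' where w': "w' \<in> W" "w' js0 \<noteq> 0" "\<And>js. w' js \<noteq> 0 \<Longrightarrow> \<forall>t<l. js ! t = js0 ! t" by auto
  have l: "l < k" using Suc by simp
  define m where "m = js0 ! l - 1"
  have "js0 ! l \<in> set js0" "set js0 \<subseteq> {0..<int N}" using js0 l by (auto simp: states_def)
  then have m: "(m + 1) mod int N = js0 ! l" by (auto simp: m_def)
  define w'' where "w'' = move (-1) l m (move 1 l m w')"
  have "w'' \<in> W" unfolding w''_def by (intro W_move l w') auto
  have val: "w'' js = (if js ! l = js0 ! l
       then (\<Prod>t\<in>{..<k}-{l}. ev t (cls n m) (js ! t) (inverse (pt l m))) * w' js else 0)"
    if "length js = k" for js
    unfolding w''_def move_mixed_same_site(2)[OF that l] m by simp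
  have "(\<Prod>t\<in>{..<k}-{l}. ev t (cls n m) (js0 ! t) (inverse (pt l m))) \<noteq> 0"
  proof
    assume "(\<Prod>t\<in>{..<k}-{l}. ev t (cls n m) (js0 ! t) (inverse (pt l m))) = 0"
    then obtain t where t: "t < k" "t \<noteq> l" "ev t (cls n m) (js0 ! t) (inverse (pt l m)) = 0"
      by (auto simp: prod_zero_iff)
    then show False using ev_nz[OF t(1) l t(2)] by blast
  qed
  then have 1: "w'' js0 \<noteq> 0" using val[of js0] js0 w' by (simp add: states_def)
  have 2: "\<forall>t<Suc l. js ! t = js0 ! t" if "w'' js \<noteq> 0" for js
  proof -
    have "js \<in> states N k" using that \<open>w'' \<in> W\<close> by (intro W_support)
    then have "js ! l = js0 ! l" "w' js \<noteq> 0" using that val[of js] by (auto simp: states_def split: if_splits)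
    then show ?thesis using w'(3)[of js] by (auto simp: less_Suc_eq)
  qed
  show ?case using \<open>w'' \<in> W\<close> 1 2 by blast
qed

lemma W_unit_vec:
  assumes w: "w \<in> W" and js0: "js0 \<in> states N k" "w js0 \<noteq> 0"
  shows "unit_vec js0 \<in> W"
proof -
  obtain w' where w': "w' \<in> W" "w' js0 \<noteq> 0" "\<And>js. w' js \<noteq> 0 \<Longrightarrow> \<forall>t<k. js ! t = js0 ! t"
    using W_project[OF w js0, of k] by auto
  have "w' js = 0" if "js \<noteq> js0" for js
  proof (rule ccontr)
    assume nz: "w' js \<noteq> 0"
    then have "js \<in> states N k" using w' by (intro W_support)
    then have "js = js0" using w'(3)[OF nz] js0 by (intro nth_equalityI) (auto simp: states_def)
    then show False using that by simp
  qed
  then have "w' = fscale (w' js0) (unit_vec js0)" by (auto simp: fun_eq_iff unit_vec_def)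
  then show ?thesis using W_unscale[OF w'(2)] w'(1) by metis
qed

text \<open>Raising operators lower the entry by one; their coefficients never vanish.\<close>

lemma W_lower:
  assumes ls: "ls \<in> states N k" and u: "u < k" and W: "unit_vec ls \<in> W"
  shows "unit_vec (ls[u := (ls ! u - int d) mod int N]) \<in> W"
proof (induction d)
  case 0
  have "ls ! u \<in> set ls" "set ls \<subseteq> {0..<int N}" using ls u by (auto simp: states_def)
  then have "(ls ! u - int 0) mod int N = ls ! u" by auto
  then show ?case using W by simp
next
  case (Suc d)
  let ?l = "ls[u := (ls ! u - int d) mod int N]"
  define m where "m = ls ! u - int (Suc d)"
  have len: "length ls = k" using ls by (simp add: states_def)
  have "ls ! u \<in> set ls" "set ls \<subseteq> {0..<int N}" using ls u by (auto simp: states_def)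
  then have st: "?l \<in> states N k" using states_update[of ls u] u ls N_pos by auto
  have src: "?l ! u = src 1 m mod int N" using u len by (simp add: src_def m_def)
  have "move 1 u m (unit_vec ?l) \<in> W" by (rule W_move[OF u _ Suc]) simp
  then have "fscale (move_coeff 1 u m ?l) (unit_vec (?l[u := tgt 1 m mod int N])) \<in> W"
    unfolding move_unit_vec[OF st u] if_P[OF src] .
  then have "unit_vec (?l[u := tgt 1 m mod int N]) \<in> W" by (rule W_unscale[OF move_coeff_nz[OF u]])
  then show ?case by (simp add: tgt_def m_def)
qed

lemma W_all:
  assumes ls: "ls \<in> states N k" "unit_vec ls \<in> W" and js: "js \<in> states N k"
  shows "l \<le> k \<Longrightarrow> \<exists>ls'\<in>states N k. unit_vec ls' \<in> W \<and> (\<forall>t<l. ls' ! t = js ! t)"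
proof (induction l)
  case 0
  then show ?case using ls by auto
next
  case (Suc l)
  then obtain ls' where ls': "ls' \<in> states N k" "unit_vec ls' \<in> W" "\<forall>t<l. ls' ! t = js ! t" by auto
  have l: "l < k" using Suc by simp
  have "js ! l \<in> set js" "set js \<subseteq> {0..<int N}" "ls' ! l \<in> set ls'" "set ls' \<subseteq> {0..<int N}"
    using js ls' l by (auto simp: states_def)
  then have rng: "js ! l \<in> {0..<int N}" "ls' ! l \<in> {0..<int N}" by auto
  define d where "d = nat ((ls' ! l - js ! l) mod int N)"
  have "int d = (ls' ! l - js ! l) mod int N" using N_pos by (simp add: d_def)
  then have "(ls' ! l - int d) mod int N = js ! l" using rng by (simp add: mod_diff_right_eq)
  then have "unit_vec (ls'[l := js ! l]) \<in> W" using W_lower[OF ls'(1) l ls'(2), of d] by simp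
  moreover have "ls'[l := js ! l] \<in> states N k" using states_update[of ls' l "js ! l"] rng l ls' by simp
  moreover have "\<forall>t<Suc l. ls'[l := js ! l] ! t = js ! t"
    using ls'(1,3) l by (auto simp: less_Suc_eq nth_list_update states_def)
  ultimately show ?case by blast
qed

lemma W_trivial: "W = {0} \<or> W = tensors"
proof (cases "W = {0}")
  case False
  then obtain w where w: "w \<in> W" "w \<noteq> 0" using fs.subspace_0[OF sub] by auto
  then obtain js0 where js0: "w js0 \<noteq> 0" by (auto simp: fun_eq_iff)
  then have st: "js0 \<in> states N k" using w by (intro W_support)
  have "unit_vec js \<in> W" if js: "js \<in> states N k" for js
  proof -
    obtain ls' where "ls' \<in> states N k" "unit_vec ls' \<in> W" "\<forall>t<k. ls' ! t = js ! t"
      using W_all[OF st W_unit_vec[OF w(1) st js0] js, of k] by auto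
    moreover from this have "ls' = js" using js by (intro nth_equalityI) (auto simp: states_def)
    ultimately show ?thesis by simp
  qed
  then have "fs.span (unit_vec ` states N k) \<subseteq> W" by (intro fs.span_minimal sub) auto
  then show ?thesis using WV unfolding span_unit_vec by blast
qed simp

end

lemma irreducible_module_act: "irreducible_module tensors act"
  unfolding irreducible_module_def
proof (intro conjI allI impI)
  have st: "replicate k 0 \<in> states N k" using N_pos by (auto simp: states_def)
  have "unit_vec (replicate k 0) \<noteq> (0 :: int list \<Rightarrow> complex)"
    by (auto simp: fun_eq_iff unit_vec_def)
  then show "tensors \<noteq> {0}" using unit_vec_in_tensor_space[OF st] by blast
next
  fix W assume "W \<subseteq> tensors \<and> fs.subspace W \<and> (\<forall>p. \<forall>w\<in>W. act p w \<in> W)"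
  then show "W = {0} \<or> W = tensors" by (intro W_trivial) auto
qed

end

theorem theorem4p17:
  fixes n L k :: nat and \<tau> \<epsilon> :: complex and a :: "nat \<Rightarrow> complex"
  assumes "n \<ge> 2" and "L \<ge> 1" and "k \<ge> 1"
    and "exp \<tau> = \<epsilon>"
    and "primitive_root_of_unity ((n + 1) * L) \<epsilon>"
    and "\<forall>i<k. a i \<noteq> 0"
    and "\<forall>i<k. \<forall>j<k. i \<noteq> j \<longrightarrow> a i / a j \<notin> {\<epsilon> ^ ((n + 1) * l) | l. l < L}"
    and "\<forall>i<k. \<forall>j<k. i \<noteq> j \<longrightarrow>
           a i / a j \<notin> {\<epsilon> powi (s * 2 + int ((n + 1) * l)) | s l. s \<in> {1, -1} \<and> l < L}"
  defines "V \<equiv> tensor_space ((n + 1) * L) k"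
  shows "drinfeld_pole_free n \<tau> k a \<and>
    (\<exists>act. presented_module (toroidal_relators n \<tau>) V act \<and> drinfeld_action n L \<tau> k a act \<and>
       (\<forall>act'. presented_module (toroidal_relators n \<tau>) V act' \<and> drinfeld_action n L \<tau> k a act'
          \<longrightarrow> (\<forall>p. \<forall>v\<in>V. act' p v = act p v)) \<and>
       irreducible_module V act) \<and>
    (\<exists>B. finite B \<and> module.span fscale B = V) \<and>
    vector_space.dim fscale V = ((n + 1) * L) ^ k"
proof -
  interpret toroidal_tensor n L k \<tau> a
    by unfold_locales (use assms in blast)+
  have V: "V = tensor_space N k" by (simp only: V_def N_def)
  have "\<exists>act. presented_module (toroidal_relators n \<tau>) V act \<and> drinfeld_action n L \<tau> k a act \<and>
       (\<forall>act'. presented_module (toroidal_relators n \<tau>) V act' \<and> drinfeld_action n L \<tau> k a act'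
          \<longrightarrow> (\<forall>p. \<forall>v\<in>V. act' p v = act p v)) \<and>
       irreducible_module V act"
    unfolding V using presented_module_act drinfeld_action_act irreducible_module_act agree_all
    unfolding agree_def by blast
  moreover have "finite (unit_vec ` states N k) \<and> module.span fscale (unit_vec ` states N k) = V"
    by (simp add: finite_states span_unit_vec V)
  moreover have "vector_space.dim fscale V = ((n + 1) * L) ^ k"
    by (simp only: V dim_tensor_space N_def)
  ultimately show ?thesis using drinfeld_pole_free by blast
qed

end
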